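(* Suppose that $X$ and $Y$ are finitely generated operator spaces. Then $X$ and $Y$ are completely isometric if and only if $\varphi^X=\varphi^Y$ for every universal $\mathcal{L}_{OSp}$-sentence $\varphi$. In particular, the complete isometry relation for finitely generated operator spaces is smooth.
   Context: An operator space is a (closed, nonzero) linear subspace $X$ of a C*-algebra, with the induced norms on $M_n(X)$ for all $n$; it is finitely generated exactly when it is finite-dimensional. $X$ and $Y$ are completely isometric if there is a linear bijection $u:X\to Y$ such that $[x_{ij}]\mapsto[u(x_{ij})]$ is an isometry $M_n(X)\to M_n(Y)$ for every $n$. The language $\mathcal{L}_{OSp}$ (continuous logic for metric structures, several sorts). An operator space $X$ is regarded as a structure with one sort for each $n\ge1$, interpreted as $M_n(X)$ with metric $d(x,y)=\|x-y\|$; domains of quantification $D_{n,k}$ ($k\ge1$) interpreted as the closed ball of radius $k$ in $M_n(X)$; function symbols for addition and multiplication by scalars in $\mathbb{Q}(i)$ on each $M_n(X)$; a constant for $0$; and function symbols $x\mapsto axb$ from $M_k(X)$ to $M_n(X)$ for $a\in M_{n,k}(\mathbb{Q}(i))$, $b\in M_{k,n}(\mathbb{Q}(i))$. Formulas are built from atomic formulas using continuous functions $\mathbb{R}^m\to\mathbb{R}$ as connectives and quantifiers $\sup_{x\in D_{n,k}}$, $\inf_{x\in D_{n,k}}$; a sentence is a formula without free variables, $\varphi^X\in\mathbb{R}$ is its value in $X$; a formula is universal if it only uses the quantifier $\sup$. Smoothness. Let $H$ be the separable infinite-dimensional Hilbert space, with $B(H)$ carrying the standard Borel structure in which $A$ is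 Borel iff its intersection with each ball $\{\|x\|\le n\}$ is Borel for the weak operator topology. Finitely generated operator spaces are parametrized by the Borel set of nonzero $\gamma\in B(H)^{\mathbb{N}}$ such that the linear span of $\{\gamma_n:n\in\mathbb{N}\}$, which is the operator space coded by $\gamma$, is finite-dimensional. An equivalence relation $E$ on a standard Borel space $Z$ is smooth if there are a Polish space $P$ and a Borel map $f:Z\to P$ with $z\,E\,z'\iff f(z)=f(z')$. *)

theory Defs
  imports "HOL-Analysis.Analysis" "Jordan_Normal_Form.Matrix"
begin

section \<open>Complex normed spaces and C*-algebras\<close>

class complex_vector = real_vector +
  fixes scaleC :: "complex \<Rightarrow> 'a \<Rightarrow> 'a" (infixr "*\<^sub>C" 75)
  assumes scaleC_add_right: "c *\<^sub>C (x + y) = c *\<^sub>C x + c *\<^sub>C y"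
    and scaleC_add_left: "(b + c) *\<^sub>C x = b *\<^sub>C x + c *\<^sub>C x"
    and scaleC_scaleC: "b *\<^sub>C (c *\<^sub>C x) = (b * c) *\<^sub>C x"
    and scaleC_of_real: "complex_of_real r *\<^sub>C x = r *\<^sub>R x"

lemma scaleC_one [simp]: "1 *\<^sub>C x = (x::'a::complex_vector)"
  using scaleC_of_real[of 1 x] by simp

global_interpretation complex_vector?: vector_space "scaleC :: complex \<Rightarrow> 'a \<Rightarrow> 'a::complex_vector"
  defines cspan_raw_def: cspan = complex_vector.span
    and csubspace_raw_def: csubspace = complex_vector.subspace
  by unfold_locales (simp_all add: scaleC_add_right scaleC_add_left scaleC_scaleC)

hide_const (open) complex_vector.span complex_vector.subspace

class complex_normed_vector = complex_vector + real_normed_vector +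
  assumes norm_scaleC: "norm (c *\<^sub>C x) = cmod c * norm x"

class cstar_algebra = complex_normed_vector + real_normed_algebra + banach +
  fixes star :: "'a \<Rightarrow> 'a"
  assumes scaleC_mult_left: "(c *\<^sub>C x) * y = c *\<^sub>C (x * y)"
    and scaleC_mult_right: "x * (c *\<^sub>C y) = c *\<^sub>C (x * y)"
    and star_star: "star (star x) = x"
    and star_add: "star (x + y) = star x + star y"
    and star_scaleC: "star (c *\<^sub>C x) = cnj c *\<^sub>C star x"
    and star_mult: "star (x * y) = star y * star x"
    and cstar_identity: "norm (star x * x) = (norm x)\<^sup>2"

section \<open>Hilbert spaces\<close>

class chilbert_space = complex_normed_vector + banach +
  fixes cinner :: "'a \<Rightarrow> 'a \<Rightarrow> complex"
  assumes cinner_add_left: "cinner (x + y) z = cinner x z + cinner y z"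
    and cinner_scaleC_left: "cinner (c *\<^sub>C x) y = c * cinner x y"
    and cinner_commute: "cinner x y = cnj (cinner y x)"
    and cinner_self: "cinner x x = complex_of_real ((norm x)\<^sup>2)"

lemma cinner_add_right: "cinner x (y + z) = cinner x y + cinner x (z::'a::chilbert_space)"
  by (metis cinner_add_left cinner_commute complex_cnj_add)

lemma cinner_scaleC_right: "cinner x (c *\<^sub>C y) = cnj c * cinner x (y::'a::chilbert_space)"
  by (metis cinner_scaleC_left cinner_commute complex_cnj_mult)

lemma cinner_zero_left [simp]: "cinner 0 (y::'a::chilbert_space) = 0"
  using cinner_add_left[of 0 0 y] by simp

lemma cinner_zero_right [simp]: "cinner (x::'a::chilbert_space) 0 = 0"
  using cinner_add_right[of x 0 0] by simp

lemma cinner_minus_left: "cinner (- x) (y::'a::chilbert_space) = - cinner x y"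
  using cinner_add_left[of x "- x" y] by (simp add: add_eq_0_iff)

lemma cinner_minus_right: "cinner x (- y::'a::chilbert_space) = - cinner x y"
  using cinner_add_right[of x y "- y"] by (simp add: add_eq_0_iff)

lemma cinner_diff_left: "cinner (x - y) z = cinner x z - cinner y (z::'a::chilbert_space)"
  using cinner_add_left[of x "- y" z] by (simp add: cinner_minus_left)

lemma cinner_diff_right: "cinner x (y - z) = cinner x y - cinner x (z::'a::chilbert_space)"
  using cinner_add_right[of x y "- z"] by (simp add: cinner_minus_right)

lemma cinner_sum_left: "cinner (sum f S) (y::'a::chilbert_space) = (\<Sum>i\<in>S. cinner (f i) y)"
  by (induction S rule: infinite_finite_induct) (auto simp: cinner_add_left)

lemma cinner_sum_right: "cinner (y::'a::chilbert_space) (sum f S) = (\<Sum>i\<in>S. cinner y (f i))"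
  by (induction S rule: infinite_finite_induct) (auto simp: cinner_add_right)

lemma norm_sq_cinner: "(norm (x::'a::chilbert_space))\<^sup>2 = Re (cinner x x)"
  by (simp add: cinner_self)

lemma cinner_cauchy_schwarz: "cmod (cinner x y) \<le> norm x * norm (y::'a::chilbert_space)"
proof (cases "y = 0")
  case False
  define c where "c = cinner x y / complex_of_real ((norm y)\<^sup>2)"
  have n0: "norm y \<noteq> 0" using False by simp
  have cc: "c * complex_of_real ((norm y)\<^sup>2) = cinner x y"
    unfolding c_def using n0 by simp
  have "cinner (x - c *\<^sub>C y) (x - c *\<^sub>C y) = cinner x x - c * cinner y x - cnj c * cinner x y
      + cnj c * (c * cinner y y)"
    by (simp add: cinner_diff_left cinner_diff_right cinner_scaleC_left cinner_scaleC_right algebra_simps)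
  also have "\<dots> = cinner x x - c * cinner y x"
    by (simp only: cinner_self[of y] cc) simp
  also have "c * cinner y x = complex_of_real ((cmod (cinner x y))\<^sup>2 / (norm y)\<^sup>2)"
    unfolding c_def by (subst (2) cinner_commute) (simp add: complex_norm_square[symmetric])
  finally have "(norm (x - c *\<^sub>C y))\<^sup>2 = (norm x)\<^sup>2 - (cmod (cinner x y))\<^sup>2 / (norm y)\<^sup>2"
    unfolding cinner_self by (metis (no_types) of_real_diff of_real_eq_iff)
  moreover have "0 \<le> (norm (x - c *\<^sub>C y))\<^sup>2" by simp
  ultimately have "(cmod (cinner x y))\<^sup>2 / (norm y)\<^sup>2 \<le> (norm x)\<^sup>2" by linarith
  then have "(cmod (cinner x y))\<^sup>2 \<le> (norm x * norm y)\<^sup>2"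
    using n0 by (simp add: divide_le_eq power_mult_distrib)
  then show ?thesis by (rule power2_le_imp_le) simp
qed simp

lemma parallelogram:
  "(norm (x + y))\<^sup>2 + (norm (x - y))\<^sup>2 = 2 * (norm x)\<^sup>2 + 2 * (norm (y::'a::chilbert_space))\<^sup>2"
  unfolding norm_sq_cinner
  by (simp add: cinner_diff_left cinner_diff_right cinner_add_left cinner_add_right)

lemma minimal_norm_exists:
  fixes S :: "'a::chilbert_space set"
  assumes cl: "closed S" and cv: "convex S" and ne: "S \<noteq> {}"
  shows "\<exists>z\<in>S. \<forall>x\<in>S. norm z \<le> norm x"
proof -
  define d where "d = Inf (norm ` S)"
  have bdd: "bdd_below (norm ` S)" by (rule bdd_belowI[of _ 0]) auto
  have d_le: "d \<le> norm x" if "x \<in> S" for x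
    unfolding d_def using that bdd by (simp add: cInf_lower)
  have d0: "0 \<le> d" unfolding d_def using ne by (intro cInf_greatest) auto
  have "\<exists>x\<in>S. norm x < d + 1 / real (Suc n)" for n
  proof -
    have "Inf (norm ` S) < d + 1 / real (Suc n)" unfolding d_def by simp
    then show ?thesis using ne bdd by (auto simp: cInf_less_iff)
  qed
  then obtain s where s: "\<And>n. s n \<in> S" "\<And>n. norm (s n) < d + 1 / real (Suc n)" by metis
  have key: "(norm (x - y))\<^sup>2 \<le> 2 * ((norm x)\<^sup>2 - d\<^sup>2) + 2 * ((norm y)\<^sup>2 - d\<^sup>2)"
    if "x \<in> S" "y \<in> S" for x y
  proof -
    have "(1/2) *\<^sub>R x + (1/2) *\<^sub>R y \<in> S"
      using cv that by (auto simp: convex_def)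
    then have "d \<le> norm ((1/2) *\<^sub>R (x + y))" using d_le by (simp add: scaleR_add_right)
    then have "2 * d \<le> norm (x + y)" by simp
    then have "(2 * d)\<^sup>2 \<le> (norm (x + y))\<^sup>2" using d0 by (intro power_mono) auto
    then show ?thesis using parallelogram[of x y] by (simp add: power2_eq_square)
  qed
  have lim: "(\<lambda>n. (d + 1 / real (Suc n))\<^sup>2 - d\<^sup>2) \<longlonglongrightarrow> 0"
  proof -
    have "(\<lambda>n. (d + 1 / real (Suc n))\<^sup>2 - d\<^sup>2) \<longlonglongrightarrow> (d + 0)\<^sup>2 - d\<^sup>2"
      by (intro tendsto_intros LIMSEQ_Suc[OF lim_1_over_n])
    then show ?thesis by simp
  qed
  have bnd: "(norm (s n))\<^sup>2 - d\<^sup>2 \<le> (d + 1 / real (Suc n))\<^sup>2 - d\<^sup>2" for n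
    using s(2)[of n] by (intro diff_right_mono power_mono) auto
  have "Cauchy s"
  proof (rule CauchyI)
    fix e :: real assume "0 < e"
    then have "0 < e\<^sup>2 / 4" by simp
    with lim have "\<forall>\<^sub>F n in sequentially. (d + 1 / real (Suc n))\<^sup>2 - d\<^sup>2 < e\<^sup>2 / 4"
      by (rule order_tendstoD(2))
    then obtain N where N: "\<And>n. n \<ge> N \<Longrightarrow> (d + 1 / real (Suc n))\<^sup>2 - d\<^sup>2 < e\<^sup>2 / 4"
      by (auto simp: eventually_sequentially)
    have "norm (s m - s n) < e" if "m \<ge> N" "n \<ge> N" for m n
    proof -
      have "(norm (s m - s n))\<^sup>2 < e\<^sup>2"
        using key[OF s(1) s(1), of m n] bnd[of m] bnd[of n] N[OF that(1)] N[OF that(2)] by argo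
      then show ?thesis using \<open>0 < e\<close> by (simp add: power_less_imp_less_base)
    qed
    then show "\<exists>M. \<forall>m\<ge>M. \<forall>n\<ge>M. norm (s m - s n) < e" by blast
  qed
  then obtain z where z: "s \<longlonglongrightarrow> z" using Cauchy_convergent convergent_def by blast
  have "z \<in> S" using cl z s(1) by (meson closed_sequentially)
  moreover have "norm z \<le> d"
  proof (rule LIMSEQ_le[OF tendsto_norm[OF z]])
    show "(\<lambda>n. d + 1 / real (Suc n)) \<longlonglongrightarrow> d"
      using tendsto_add[OF tendsto_const LIMSEQ_Suc[OF lim_1_over_n], of d] by simp
    show "\<exists>N. \<forall>n\<ge>N. norm (s n) \<le> d + 1 / real (Suc n)" using s(2) less_imp_le by blast
  qed
  ultimately show ?thesis using d_le order_trans by blast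
qed

lemma riesz:
  fixes f :: "'a::chilbert_space \<Rightarrow> complex"
  assumes add: "\<And>x y. f (x + y) = f x + f y" and sc: "\<And>c x. f (c *\<^sub>C x) = c * f x"
    and bd: "\<And>x. cmod (f x) \<le> K * norm x"
  shows "\<exists>z. \<forall>x. f x = cinner x z"
proof (cases "\<forall>x. f x = 0")
  case True
  then show ?thesis by (intro exI[of _ 0]) simp
next
  case False
  then obtain x0 where x0: "f x0 \<noteq> 0" by blast
  have scR: "f (r *\<^sub>R x) = r *\<^sub>R f x" for r x
    by (metis sc scaleC_of_real scaleR_conv_of_real)
  have bl: "bounded_linear f"
    by (rule bounded_linear_intro[where K=K]) (auto simp: add scR bd mult.commute)
  have fdiff: "f (x - y) = f x - f y" for x y
    using bl by (simp add: bounded_linear.linear linear_diff)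
  define S where "S = {x. f x = 1}"
  have "closed S"
    unfolding S_def by (intro closed_Collect_eq continuous_on_const
      linear_continuous_on[OF bl])
  moreover have "convex S"
    unfolding S_def convex_def by (auto simp: add scR) (metis of_real_1 of_real_add scaleR_conv_of_real mult.right_neutral)
  moreover have "(1 / f x0) *\<^sub>C x0 \<in> S" unfolding S_def using x0 by (simp add: sc)
  ultimately obtain z where z: "z \<in> S" "\<And>x. x \<in> S \<Longrightarrow> norm z \<le> norm x"
    using minimal_norm_exists[of S] by blast
  have fz: "f z = 1" using z(1) by (simp add: S_def)
  have orth: "cinner y z = 0" if "f y = 0" for y
  proof (cases "y = 0")
    case False
    define c where "c = cinner z y / complex_of_real ((norm y)\<^sup>2)"
    have n0: "norm y \<noteq> 0" using False by simp
    have cc: "c * complex_of_real ((norm y)\<^sup>2) = cinner z y"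
      unfolding c_def using n0 by simp
    have "cinner (z - c *\<^sub>C y) (z - c *\<^sub>C y) = cinner z z - c * cinner y z - cnj c * cinner z y
        + cnj c * (c * cinner y y)"
      by (simp add: cinner_diff_left cinner_diff_right cinner_scaleC_left cinner_scaleC_right algebra_simps)
    also have "\<dots> = cinner z z - c * cinner y z"
      by (simp only: cinner_self[of y] cc) simp
    also have "c * cinner y z = complex_of_real ((cmod (cinner z y))\<^sup>2 / (norm y)\<^sup>2)"
      unfolding c_def by (subst (2) cinner_commute) (simp add: complex_norm_square[symmetric])
    finally have "(norm (z - c *\<^sub>C y))\<^sup>2 = (norm z)\<^sup>2 - (cmod (cinner z y))\<^sup>2 / (norm y)\<^sup>2"
      unfolding cinner_self by (metis (no_types) of_real_diff of_real_eq_iff)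
    moreover have "norm z \<le> norm (z - c *\<^sub>C y)"
      by (rule z(2)) (simp add: S_def fdiff sc that fz)
    then have "(norm z)\<^sup>2 \<le> (norm (z - c *\<^sub>C y))\<^sup>2" by (intro power_mono) auto
    ultimately have "(cmod (cinner z y))\<^sup>2 / (norm y)\<^sup>2 \<le> 0" by linarith
    then have "cinner z y = 0" using n0 by (simp add: divide_le_0_iff)
    then show ?thesis by (metis cinner_commute complex_cnj_zero)
  qed simp
  have z0: "norm z \<noteq> 0" using fz fdiff[of z z] by auto
  have "f x = cinner x ((1 / complex_of_real ((norm z)\<^sup>2)) *\<^sub>C z)" for x
  proof -
    have "cinner (x - f x *\<^sub>C z) z = 0" by (rule orth) (simp add: fdiff sc fz)
    then have "cinner x z = f x * complex_of_real ((norm z)\<^sup>2)"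
      by (simp add: cinner_diff_left cinner_scaleC_left cinner_self)
    then show ?thesis using z0 by (simp add: cinner_scaleC_right)
  qed
  then show ?thesis by blast
qed

section \<open>The C*-algebra of bounded operators\<close>

typedef (overloaded) 'h bop =
  "{T :: 'h::complex_normed_vector \<Rightarrow>\<^sub>L 'h. \<forall>c x. blinfun_apply T (c *\<^sub>C x) = c *\<^sub>C blinfun_apply T x}"
  morphisms blinfun_of_bop Bop
  by (rule exI[of _ 0]) simp

setup_lifting type_definition_bop

lift_definition bop_apply :: "'h::complex_normed_vector bop \<Rightarrow> 'h \<Rightarrow> 'h" is blinfun_apply .

lemma bounded_linear_scaleC: "bounded_linear (\<lambda>x::'a::complex_normed_vector. c *\<^sub>C x)"
proof (rule bounded_linear_intro[where K="cmod c"])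
  show "c *\<^sub>C (r *\<^sub>R x) = r *\<^sub>R (c *\<^sub>C x)" for r and x :: 'a
    by (metis scaleC_of_real scaleC_scaleC mult.commute)
qed (auto simp: scaleC_add_right norm_scaleC mult.commute)

lift_definition scaleC_blinfun :: "complex \<Rightarrow> ('a::real_normed_vector \<Rightarrow>\<^sub>L 'b::complex_normed_vector) \<Rightarrow> ('a \<Rightarrow>\<^sub>L 'b)"
  is "\<lambda>c f x. c *\<^sub>C f x"
  by (rule bounded_linear_compose[OF bounded_linear_scaleC])

lemma scaleR_scaleC_commute: "r *\<^sub>R (c *\<^sub>C x) = c *\<^sub>C (r *\<^sub>R (x::'a::complex_vector))"
  by (metis scaleC_of_real scaleC_scaleC mult.commute)

instantiation bop :: (complex_normed_vector) complex_normed_vector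
begin

lift_definition zero_bop :: "'a bop" is 0 by simp
lift_definition plus_bop :: "'a bop \<Rightarrow> 'a bop \<Rightarrow> 'a bop" is "(+)"
  by (simp add: plus_blinfun.rep_eq scaleC_add_right)
lift_definition minus_bop :: "'a bop \<Rightarrow> 'a bop \<Rightarrow> 'a bop" is "(-)"
  by (simp add: minus_blinfun.rep_eq complex_vector.scale_right_diff_distrib)
lift_definition uminus_bop :: "'a bop \<Rightarrow> 'a bop" is uminus
  by (simp add: uminus_blinfun.rep_eq)
lift_definition scaleR_bop :: "real \<Rightarrow> 'a bop \<Rightarrow> 'a bop" is scaleR
  by (simp add: scaleR_blinfun.rep_eq scaleR_scaleC_commute)
lift_definition scaleC_bop :: "complex \<Rightarrow> 'a bop \<Rightarrow> 'a bop" is scaleC_blinfun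
  by (simp add: scaleC_blinfun.rep_eq scaleC_scaleC mult.commute)
lift_definition norm_bop :: "'a bop \<Rightarrow> real" is norm .
definition dist_bop :: "'a bop \<Rightarrow> 'a bop \<Rightarrow> real" where "dist_bop S T = norm (S - T)"
definition sgn_bop :: "'a bop \<Rightarrow> 'a bop" where "sgn_bop T = inverse (norm T) *\<^sub>R T"
definition uniformity_bop :: "('a bop \<times> 'a bop) filter"
  where "uniformity_bop = (INF e\<in>{0<..}. principal {(x, y). dist x y < e})"
definition open_bop :: "'a bop set \<Rightarrow> bool"
  where "open_bop U = (\<forall>x\<in>U. \<forall>\<^sub>F (x', y) in uniformity. x' = x \<longrightarrow> y \<in> U)"

instance
proof
  fix S T R :: "'a bop" and r q :: real and b c :: complex and U :: "'a bop set"
  show "S + T + R = S + (T + R)" by transfer (simp add: add.assoc)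
  show "S + T = T + S" by transfer (simp add: add.commute)
  show "0 + S = S" by transfer simp
  show "- S + S = 0" by transfer simp
  show "S - T = S + - T" by transfer simp
  show "r *\<^sub>R (S + T) = r *\<^sub>R S + r *\<^sub>R T" by transfer (simp add: scaleR_add_right)
  show "(r + q) *\<^sub>R S = r *\<^sub>R S + q *\<^sub>R S" by transfer (simp add: scaleR_add_left)
  show "r *\<^sub>R q *\<^sub>R S = (r * q) *\<^sub>R S" by transfer simp
  show "1 *\<^sub>R S = S" by transfer simp
  show "dist S T = norm (S - T)" by (rule dist_bop_def)
  show "sgn S = inverse (norm S) *\<^sub>R S" by (rule sgn_bop_def)
  show "uniformity = (INF e\<in>{0<..}. principal {(x::'a bop, y). dist x y < e})"
    by (rule uniformity_bop_def)
  show "open U = (\<forall>x\<in>U. \<forall>\<^sub>F (x', y) in uniformity. x' = x \<longrightarrow> y \<in> U)"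
    by (rule open_bop_def)
  show "norm S = 0 \<longleftrightarrow> S = 0" by transfer simp
  show "norm (S + T) \<le> norm S + norm T" by transfer (rule norm_triangle_ineq)
  show "norm (r *\<^sub>R S) = \<bar>r\<bar> * norm S" by transfer simp
  show "c *\<^sub>C (S + T) = c *\<^sub>C S + c *\<^sub>C T"
    by transfer (rule blinfun_eqI, simp add: scaleC_blinfun.rep_eq plus_blinfun.rep_eq scaleC_add_right)
  show "(b + c) *\<^sub>C S = b *\<^sub>C S + c *\<^sub>C S"
    by transfer (rule blinfun_eqI, simp add: scaleC_blinfun.rep_eq plus_blinfun.rep_eq scaleC_add_left)
  show "b *\<^sub>C c *\<^sub>C S = (b * c) *\<^sub>C S"
    by transfer (rule blinfun_eqI, simp add: scaleC_blinfun.rep_eq scaleC_scaleC)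
  show "complex_of_real r *\<^sub>C S = r *\<^sub>R S"
    by transfer (rule blinfun_eqI, simp add: scaleC_blinfun.rep_eq scaleR_blinfun.rep_eq scaleC_of_real)
  have le: "norm (c *\<^sub>C S) \<le> cmod c * norm S" for c and S :: "'a bop"
  proof transfer
    fix c and S :: "'a \<Rightarrow>\<^sub>L 'a"
    show "norm (scaleC_blinfun c S) \<le> cmod c * norm S"
    proof (rule norm_blinfun_bound)
      show "norm (blinfun_apply (scaleC_blinfun c S) x) \<le> cmod c * norm S * norm x" for x
        using norm_blinfun[of S x]
        by (simp add: scaleC_blinfun.rep_eq norm_scaleC mult.assoc mult_left_mono)
    qed simp
  qed
  show "norm (c *\<^sub>C S) = cmod c * norm S"
  proof (cases "c = 0")
    case True
    have "(0::complex) *\<^sub>C S = 0"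
      by transfer (rule blinfun_eqI, simp add: scaleC_blinfun.rep_eq)
    moreover have "norm (0 :: 'a bop) = 0" by transfer simp
    ultimately show ?thesis using True by simp
  next
    case False
    have "inverse c *\<^sub>C (c *\<^sub>C S) = (inverse c * c) *\<^sub>C S" for c
      by transfer (rule blinfun_eqI, simp add: scaleC_blinfun.rep_eq scaleC_scaleC)
    moreover have "(1::complex) *\<^sub>C S = S"
      by transfer (rule blinfun_eqI, simp add: scaleC_blinfun.rep_eq)
    ultimately have "S = inverse c *\<^sub>C (c *\<^sub>C S)" using False by simp
    then have "norm S \<le> cmod (inverse c) * norm (c *\<^sub>C S)" using le by metis
    then have "cmod c * norm S \<le> norm (c *\<^sub>C S)"
      using False mult_left_mono[of "norm S" "cmod (inverse c) * norm (c *\<^sub>C S)" "cmod c"]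
      by (simp add: norm_inverse flip: mult.assoc)
    with le[of c S] show ?thesis by simp
  qed
qed

end

lemma bop_apply_simps [simp]:
  "bop_apply 0 x = 0"
  "bop_apply (S + T) x = bop_apply S x + bop_apply T x"
  "bop_apply (S - T) x = bop_apply S x - bop_apply T x"
  "bop_apply (- S) x = - bop_apply S x"
  "bop_apply (c *\<^sub>C S) x = c *\<^sub>C bop_apply S x"
  "bop_apply S (x + y) = bop_apply S x + bop_apply S y"
  "bop_apply S (x - y) = bop_apply S x - bop_apply S y"
  "bop_apply S 0 = 0"
  by (transfer; simp add: plus_blinfun.rep_eq minus_blinfun.rep_eq uminus_blinfun.rep_eq
        scaleC_blinfun.rep_eq blinfun.add_right blinfun.diff_right blinfun.zero_right)+

lemma bop_apply_scaleC: "bop_apply S (c *\<^sub>C x) = c *\<^sub>C bop_apply S x"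
  by transfer simp

lemma bop_apply_sum_right: "bop_apply S (sum f A) = (\<Sum>i\<in>A. bop_apply S (f i))"
  by (induction A rule: infinite_finite_induct) auto

lemma bop_apply_sum_left: "bop_apply (sum f A) x = (\<Sum>i\<in>A. bop_apply (f i) x)"
  by (induction A rule: infinite_finite_induct) auto

lemma bop_eqI: "(\<And>x. bop_apply S x = bop_apply T x) \<Longrightarrow> S = T"
  by transfer (rule blinfun_eqI)

lemma norm_bop_apply: "norm (bop_apply S x) \<le> norm S * norm x"
  by transfer (rule norm_blinfun)

lemma norm_bop_bound: "0 \<le> b \<Longrightarrow> (\<And>x. norm (bop_apply S x) \<le> b * norm x) \<Longrightarrow> norm S \<le> b"
  by transfer (rule norm_blinfun_bound)

instance bop :: ("{complex_normed_vector, banach}") banach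
proof
  fix X :: "nat \<Rightarrow> 'a bop" assume X: "Cauchy X"
  have d: "dist (blinfun_of_bop S) (blinfun_of_bop T) = dist S T" for S T :: "'a bop"
    unfolding dist_norm by transfer simp
  have "Cauchy (\<lambda>n. blinfun_of_bop (X n))" using X by (simp add: Cauchy_def d)
  then obtain L where L: "(\<lambda>n. blinfun_of_bop (X n)) \<longlonglongrightarrow> L"
    using Cauchy_convergent convergent_def by blast
  have "blinfun_apply L (c *\<^sub>C x) = c *\<^sub>C blinfun_apply L x" for c x
  proof (rule LIMSEQ_unique)
    show "(\<lambda>n. blinfun_of_bop (X n) (c *\<^sub>C x)) \<longlonglongrightarrow> blinfun_apply L (c *\<^sub>C x)"
      by (intro blinfun.tendsto L tendsto_const)
    have "(\<lambda>n. c *\<^sub>C blinfun_of_bop (X n) x) \<longlonglongrightarrow> c *\<^sub>C blinfun_apply L x"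
      by (intro bounded_linear.tendsto[OF bounded_linear_scaleC] blinfun.tendsto L tendsto_const)
    then show "(\<lambda>n. blinfun_of_bop (X n) (c *\<^sub>C x)) \<longlonglongrightarrow> c *\<^sub>C blinfun_apply L x"
      using blinfun_of_bop[of "X _"] by simp
  qed
  then have BL: "blinfun_of_bop (Bop L) = L" by (simp add: Bop_inverse)
  have "dist (blinfun_of_bop (X n)) L = dist (X n) (Bop L)" for n
    using d[of "X n" "Bop L"] by (simp add: BL)
  then have "X \<longlonglongrightarrow> Bop L" using L by (simp add: LIMSEQ_def)
  then show "convergent X" by (auto simp: convergent_def)
qed

lemma bop_adjoint_exists:
  fixes T :: "'h::chilbert_space bop"
  shows "\<exists>S :: 'h bop. \<forall>x y. cinner (bop_apply T x) y = cinner x (bop_apply S y)"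
proof -
  have "\<exists>z. \<forall>x. cinner (bop_apply T x) y = cinner x z" for y
  proof (rule riesz[where K="norm T * norm y"])
    show "cmod (cinner (bop_apply T x) y) \<le> norm T * norm y * norm x" for x
      using order_trans[OF cinner_cauchy_schwarz[of "bop_apply T x" y]
          mult_right_mono[OF norm_bop_apply[of T x] norm_ge_zero[of y]]]
      by (simp add: ac_simps)
  qed (simp_all add: cinner_add_left bop_apply_scaleC cinner_scaleC_left)
  then obtain g where g: "\<And>x y. cinner (bop_apply T x) y = cinner x (g y)" by metis
  have eqI: "u = v" if "\<And>x. cinner x u = cinner x v" for u v :: 'h
  proof -
    have "cinner (u - v) (u - v) = 0" using that[of "u - v"] by (simp add: cinner_diff_right)
    then show ?thesis by (simp add: cinner_self)
  qed
  have add: "g (x + y) = g x + g y" for x y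
    by (rule eqI) (metis g cinner_add_right)
  have sc: "g (c *\<^sub>C x) = c *\<^sub>C g x" for c x
    by (rule eqI) (metis g cinner_scaleC_right)
  have bd: "norm (g y) \<le> norm y * norm T" for y
  proof (cases "g y = 0")
    case False
    have "(norm (g y))\<^sup>2 = cmod (cinner (g y) (g y))" by (simp add: cinner_self norm_power)
    also have "\<dots> = cmod (cinner (bop_apply T (g y)) y)" by (simp add: g)
    also have "\<dots> \<le> norm (bop_apply T (g y)) * norm y" by (rule cinner_cauchy_schwarz)
    also have "\<dots> \<le> norm T * norm (g y) * norm y" by (intro mult_right_mono norm_bop_apply) simp
    finally show ?thesis using False by (simp add: power2_eq_square mult_ac)
  qed simp
  have bl: "bounded_linear g"
    by (rule bounded_linear_intro[where K="norm T"]) (auto simp: add bd sc simp flip: scaleC_of_real)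
  have "bop_apply (Bop (Blinfun g)) = g"
    by (simp add: bop_apply.rep_eq Bop_inverse bounded_linear_Blinfun_apply[OF bl] sc)
  with g show ?thesis by metis
qed

instantiation bop :: (chilbert_space) cstar_algebra
begin

lift_definition times_bop :: "'a bop \<Rightarrow> 'a bop \<Rightarrow> 'a bop" is blinfun_compose
  by simp

definition star_bop :: "'a bop \<Rightarrow> 'a bop"
  where "star_bop T = (SOME S. \<forall>x y. cinner (bop_apply T x) y = cinner x (bop_apply S y))"

lemma bop_apply_mult: "bop_apply (S * T) x = bop_apply S (bop_apply T (x::'a))"
  by transfer simp

lemma cinner_star: "cinner (bop_apply T x) y = cinner x (bop_apply (star T) (y::'a))"
  unfolding star_bop_def using someI_ex[OF bop_adjoint_exists[of T]] by blast

lemma star_eqI: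
  assumes "\<And>x y. cinner (bop_apply T x) y = cinner x (bop_apply S (y::'a))"
  shows "star T = S"
proof (rule bop_eqI)
  fix y
  let ?d = "bop_apply (star T) y - bop_apply S y"
  have "cinner ?d ?d = 0" using cinner_star[of T ?d y] assms[of ?d y]
    unfolding cinner_diff_right by simp
  then show "bop_apply (star T) y = bop_apply S y" by (simp add: cinner_self)
qed

instance
proof
  fix S T R :: "'a bop" and r :: real and c :: complex
  show "S * T * R = S * (T * R)" by (rule bop_eqI) (simp add: bop_apply_mult)
  show "(S + T) * R = S * R + T * R" by (rule bop_eqI) (simp add: bop_apply_mult)
  show "S * (T + R) = S * T + S * R" by (rule bop_eqI) (simp add: bop_apply_mult)
  show sl: "(c *\<^sub>C S) * T = c *\<^sub>C (S * T)" for c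
    by (rule bop_eqI) (simp add: bop_apply_mult)
  show sr: "S * (c *\<^sub>C T) = c *\<^sub>C (S * T)" for c
    by (rule bop_eqI) (simp add: bop_apply_mult bop_apply_scaleC)
  show "r *\<^sub>R S * T = r *\<^sub>R (S * T)" by (simp only: sl flip: scaleC_of_real)
  show "S * r *\<^sub>R T = r *\<^sub>R (S * T)" by (simp only: sr flip: scaleC_of_real)
  show sub: "norm (S * T) \<le> norm S * norm T" for S T :: "'a bop"
    by transfer (rule norm_blinfun_compose)
  show ss: "star (star S) = S" for S :: "'a bop"
    by (rule star_eqI) (subst (1 2) cinner_commute, simp add: cinner_star)
  show "star (S + T) = star S + star T"
    by (rule star_eqI) (simp add: cinner_add_left cinner_add_right cinner_star)
  show "star (c *\<^sub>C S) = cnj c *\<^sub>C star S"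
    by (rule star_eqI) (simp add: cinner_scaleC_left cinner_scaleC_right cinner_star)
  show "star (S * T) = star T * star S"
    by (rule star_eqI) (simp add: bop_apply_mult cinner_star)
  have sq: "(norm S)\<^sup>2 \<le> norm (star S * S)" for S :: "'a bop"
  proof -
    have "norm S \<le> sqrt (norm (star S * S))"
    proof (rule norm_bop_bound)
      fix x
      have "(norm (bop_apply S x))\<^sup>2 = cmod (cinner (bop_apply S x) (bop_apply S x))"
        by (simp add: cinner_self norm_power)
      also have "\<dots> = cmod (cinner x (bop_apply (star S * S) x))"
        by (simp add: cinner_star bop_apply_mult)
      also have "\<dots> \<le> norm x * norm (bop_apply (star S * S) x)" by (rule cinner_cauchy_schwarz)
      also have "\<dots> \<le> norm x * (norm (star S * S) * norm x)"
        by (intro mult_left_mono norm_bop_apply) simp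
      also have "\<dots> = (sqrt (norm (star S * S)) * norm x)\<^sup>2"
        by (simp add: power_mult_distrib power2_eq_square)
      finally show "norm (bop_apply S x) \<le> sqrt (norm (star S * S)) * norm x"
        by (rule power2_le_imp_le) simp
    qed simp
    then have "(norm S)\<^sup>2 \<le> (sqrt (norm (star S * S)))\<^sup>2" by (intro power_mono) auto
    then show ?thesis by simp
  qed
  have le: "norm S \<le> norm (star S)" for S :: "'a bop"
  proof (cases "norm S = 0")
    case False
    have "norm S * norm S \<le> norm (star S) * norm S"
      using order_trans[OF sq[of S] sub] by (simp add: power2_eq_square)
    then show ?thesis using False by simp
  qed simp
  have "norm (star S) = norm S" using le[of S] le[of "star S"] by (simp add: ss)
  then show "norm (star S * S) = (norm S)\<^sup>2"
    using sq[of S] sub[of "star S" S] by (simp add: power2_eq_square)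
qed

end

section \<open>Operator spaces\<close>

text \<open>
  Square matrices are JNF matrices, so \<open>M\<^sub>n(A)\<close> is \<^term>\<open>carrier_mat n n\<close> and a family
  of norms on the \<open>M\<^sub>n(A)\<close> is a single function on matrices.
\<close>

definition mat_scaleC :: "complex \<Rightarrow> 'a::complex_vector mat \<Rightarrow> 'a mat"
  where "mat_scaleC c x = map_mat (scaleC c) x"

definition mat_star :: "'a::cstar_algebra mat \<Rightarrow> 'a mat"
  where "mat_star x = transpose_mat (map_mat star x)"

text \<open>The two-sided action of scalar matrices, \<open>x \<mapsto> a x b\<close>.\<close>

definition mat_sandwich :: "complex mat \<Rightarrow> 'a::complex_vector mat \<Rightarrow> complex mat \<Rightarrow> 'a mat"
  where "mat_sandwich a x b = mat (dim_row a) (dim_col b)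
    (\<lambda>(i, j). \<Sum>l<dim_row x. \<Sum>m<dim_col x. (a $$ (i, l) * b $$ (m, j)) *\<^sub>C x $$ (l, m))"

text \<open>
  \<open>N\<close> restricts, for every \<open>n \<ge> 1\<close>, to a norm that makes the *-algebra \<open>M\<^sub>n(A)\<close> a C*-algebra.
  A C*-norm on a *-algebra that is complete for it is unique, so this determines \<open>N\<close> on every
  \<open>M\<^sub>n(A)\<close>: it is the usual norm of \<open>M\<^sub>n(A)\<close>.
\<close>

definition matrix_cstar_norm :: "('a::cstar_algebra mat \<Rightarrow> real) \<Rightarrow> bool"
  where "matrix_cstar_norm N \<longleftrightarrow> (\<forall>n\<ge>1.
    (\<forall>x\<in>carrier_mat n n. 0 \<le> N x \<and> (N x = 0 \<longleftrightarrow> x = 0\<^sub>m n n)) \<and>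
    (\<forall>x\<in>carrier_mat n n. \<forall>y\<in>carrier_mat n n. N (x + y) \<le> N x + N y) \<and>
    (\<forall>c. \<forall>x\<in>carrier_mat n n. N (mat_scaleC c x) = cmod c * N x) \<and>
    (\<forall>x\<in>carrier_mat n n. \<forall>y\<in>carrier_mat n n. N (x * y) \<le> N x * N y) \<and>
    (\<forall>x\<in>carrier_mat n n. N (mat_star x * x) = (N x)\<^sup>2) \<and>
    (\<forall>s. (\<forall>k. s k \<in> carrier_mat n n) \<and> (\<forall>e>0. \<exists>K. \<forall>k\<ge>K. \<forall>l\<ge>K. N (s k - s l) < e) \<longrightarrow>
      (\<exists>x\<in>carrier_mat n n. (\<lambda>k. N (s k - x)) \<longlonglongrightarrow> 0)))"

definition mats :: "nat \<Rightarrow> 'a set \<Rightarrow> 'a mat set"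
  where "mats n X = {x \<in> carrier_mat n n. elements_mat x \<subseteq> X}"

definition operator_space :: "'a::cstar_algebra set \<Rightarrow> ('a mat \<Rightarrow> real) \<Rightarrow> bool"
  where "operator_space X N \<longleftrightarrow>
    matrix_cstar_norm N \<and> csubspace X \<and> closed X \<and> X \<noteq> {0}"

definition finitely_generated :: "'a::complex_vector set \<Rightarrow> bool"
  where "finitely_generated X \<longleftrightarrow> (\<exists>B. finite B \<and> X = cspan B)"

definition completely_isometric ::
    "'a::complex_vector set \<Rightarrow> ('a mat \<Rightarrow> real) \<Rightarrow> 'b::complex_vector set \<Rightarrow> ('b mat \<Rightarrow> real) \<Rightarrow> bool"
  where "completely_isometric X N Y M \<longleftrightarrow> (\<exists>u. bij_betw u X Y \<and>
    (\<forall>x\<in>X. \<forall>y\<in>X. u (x + y) = u x + u y) \<and> (\<forall>c. \<forall>x\<in>X. u (c *\<^sub>C x) = c *\<^sub>C u x) \<and>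
    (\<forall>n\<ge>1. \<forall>x\<in>mats n X. \<forall>y\<in>mats n X. M (map_mat u x - map_mat u y) = N (x - y)))"

section \<open>The language of operator spaces\<close>

definition gaussian_rationals :: "complex set"
  where "gaussian_rationals = {z. Re z \<in> \<rat> \<and> Im z \<in> \<rat>}"

text \<open>A variable is given by its sort \<open>n\<close> and an index.\<close>

datatype osp_term =
    TVar nat nat
  | TZero nat
  | TAdd osp_term osp_term
  | TScale complex osp_term
  | TSandwich "complex mat" osp_term "complex mat"

inductive has_sort :: "osp_term \<Rightarrow> nat \<Rightarrow> bool"
  where
    "n \<ge> 1 \<Longrightarrow> has_sort (TVar n i) n"
  | "n \<ge> 1 \<Longrightarrow> has_sort (TZero n) n"
  | "has_sort s n \<Longrightarrow> has_sort t n \<Longrightarrow> has_sort (TAdd s t) n"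
  | "q \<in> gaussian_rationals \<Longrightarrow> has_sort t n \<Longrightarrow> has_sort (TScale q t) n"
  | "n \<ge> 1 \<Longrightarrow> has_sort t k \<Longrightarrow> a \<in> carrier_mat n k \<Longrightarrow> b \<in> carrier_mat k n \<Longrightarrow>
     elements_mat a \<subseteq> gaussian_rationals \<Longrightarrow> elements_mat b \<subseteq> gaussian_rationals \<Longrightarrow>
     has_sort (TSandwich a t b) n"

primrec term_vars :: "osp_term \<Rightarrow> (nat \<times> nat) set"
  where
    "term_vars (TVar n i) = {(n, i)}"
  | "term_vars (TZero n) = {}"
  | "term_vars (TAdd s t) = term_vars s \<union> term_vars t"
  | "term_vars (TScale q t) = term_vars t"
  | "term_vars (TSandwich a t b) = term_vars t"

text \<open>
  In \<open>FConn f \<phi>s\<close> the connective is \<open>f : \<real>\<^sup>m \<rightarrow> \<real>\<close> with \<open>m = length \<phi>s\<close>, where \<open>\<real>\<^sup>m\<close> is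
  \<^term>\<open>powertop_real {..<m}\<close>. \<open>FSup n k i \<phi>\<close> and \<open>FInf n k i \<phi>\<close> quantify the \<open>i\<close>-th variable
  of sort \<open>n\<close> over the domain \<open>D\<^bsub>n,k\<^esub>\<close>.
\<close>

datatype osp_formula =
    FDist osp_term osp_term
  | FConn "(nat \<Rightarrow> real) \<Rightarrow> real" "osp_formula list"
  | FSup nat nat nat osp_formula
  | FInf nat nat nat osp_formula

primrec wf_formula :: "osp_formula \<Rightarrow> bool"
  where
    "wf_formula (FDist s t) = (\<exists>n. has_sort s n \<and> has_sort t n)"
  | "wf_formula (FConn f \<phi>s) =
      (continuous_map (powertop_real {..<length \<phi>s}) euclideanreal f \<and> list_all wf_formula \<phi>s)"
  | "wf_formula (FSup n k i \<phi>) = (n \<ge> 1 \<and> k \<ge> 1 \<and> wf_formula \<phi>)"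
  | "wf_formula (FInf n k i \<phi>) = (n \<ge> 1 \<and> k \<ge> 1 \<and> wf_formula \<phi>)"

primrec free_vars :: "osp_formula \<Rightarrow> (nat \<times> nat) set"
  where
    "free_vars (FDist s t) = term_vars s \<union> term_vars t"
  | "free_vars (FConn f \<phi>s) = \<Union> (set (map free_vars \<phi>s))"
  | "free_vars (FSup n k i \<phi>) = free_vars \<phi> - {(n, i)}"
  | "free_vars (FInf n k i \<phi>) = free_vars \<phi> - {(n, i)}"

definition osp_sentence :: "osp_formula \<Rightarrow> bool"
  where "osp_sentence \<phi> \<longleftrightarrow> wf_formula \<phi> \<and> free_vars \<phi> = {}"

primrec universal :: "osp_formula \<Rightarrow> bool"
  where
    "universal (FDist s t) = True"
  | "universal (FConn f \<phi>s) = list_all universal \<phi>s"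
  | "universal (FSup n k i \<phi>) = universal \<phi>"
  | "universal (FInf n k i \<phi>) = False"

primrec quantifier_free :: "osp_formula \<Rightarrow> bool"
  where
    "quantifier_free (FDist s t) = True"
  | "quantifier_free (FConn f \<phi>s) = list_all quantifier_free \<phi>s"
  | "quantifier_free (FSup n k i \<phi>) = False"
  | "quantifier_free (FInf n k i \<phi>) = False"

text \<open>
  Connectives need not be monotone, so \<^const>\<open>universal\<close> formulas may contain \<open>sup\<close> below a
  decreasing connective. The universal formulas in prenex form are the smaller class
  \<open>sup \<dots> sup \<psi>\<close> with \<open>\<psi>\<close> quantifier-free.
\<close>

inductive prenex_universal :: "osp_formula \<Rightarrow> bool"
  where
    "quantifier_free \<phi> \<Longrightarrow> prenex_universal \<phi>"
  | "prenex_universal \<phi> \<Longrightarrow> prenex_universal (FSup n k i \<phi>)"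

lemma prenex_universal_imp_universal: "prenex_universal \<phi> \<Longrightarrow> universal \<phi>"
proof (induction rule: prenex_universal.induct)
  case (1 \<phi>)
  then show ?case by (induction \<phi>) (auto simp: list_all_iff)
qed simp

type_synonym 'a assignment = "nat \<Rightarrow> nat \<Rightarrow> 'a mat"

primrec eval_term :: "osp_term \<Rightarrow> 'a::complex_vector assignment \<Rightarrow> 'a mat"
  where
    "eval_term (TVar n i) e = e n i"
  | "eval_term (TZero n) e = 0\<^sub>m n n"
  | "eval_term (TAdd s t) e = eval_term s e + eval_term t e"
  | "eval_term (TScale q t) e = mat_scaleC q (eval_term t e)"
  | "eval_term (TSandwich a t b) e = mat_sandwich a (eval_term t e) b"

definition quant_domain :: "'a set \<Rightarrow> ('a mat \<Rightarrow> real) \<Rightarrow> nat \<Rightarrow> nat \<Rightarrow> 'a mat set"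
  where "quant_domain X N n k = {x \<in> mats n X. N x \<le> real k}"

context
  fixes X :: "'a::complex_vector set" and N :: "'a mat \<Rightarrow> real"
begin

primrec eval_formula :: "osp_formula \<Rightarrow> 'a assignment \<Rightarrow> real"
  where
    "eval_formula (FDist s t) = (\<lambda>e. N (eval_term s e - eval_term t e))"
  | "eval_formula (FConn f \<phi>s) =
      (\<lambda>e. f (\<lambda>j\<in>{..<length \<phi>s}. (map eval_formula \<phi>s ! j) e))"
  | "eval_formula (FSup n k i \<phi>) =
      (\<lambda>e. SUP x\<in>quant_domain X N n k. eval_formula \<phi> (e(n := (e n)(i := x))))"
  | "eval_formula (FInf n k i \<phi>) =
      (\<lambda>e. INF x\<in>quant_domain X N n k. eval_formula \<phi> (e(n := (e n)(i := x))))"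

end

text \<open>The value of a sentence does not depend on the assignment.\<close>

definition sentence_value :: "'a::complex_vector set \<Rightarrow> ('a mat \<Rightarrow> real) \<Rightarrow> osp_formula \<Rightarrow> real"
  where "sentence_value X N \<phi> = eval_formula X N \<phi> (\<lambda>n i. 0\<^sub>m n n)"

section \<open>Smoothness and the coding of operator spaces\<close>

definition borel_of_topology :: "'a topology \<Rightarrow> 'a measure"
  where "borel_of_topology P = sigma (topspace P) {U. openin P U}"

text \<open>
  Every Polish space has at most continuum many points, so up to homeomorphism it is a topology on
  a subset of \<^typ>\<open>nat \<Rightarrow> real\<close>.
\<close>

definition smooth_equivalence :: "'z measure \<Rightarrow> ('z \<Rightarrow> 'z \<Rightarrow> bool) \<Rightarrow> bool"
  where "smooth_equivalence Z E \<longleftrightarrow> (\<exists>(P :: (nat \<Rightarrow> real) topology) f.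
    completely_metrizable_space P \<and> separable_space P \<and>
    f \<in> measurable Z (borel_of_topology P) \<and>
    (\<forall>z\<in>space Z. \<forall>z'\<in>space Z. E z z' \<longleftrightarrow> f z = f z'))"

definition weak_operator_topology :: "'h::chilbert_space bop topology"
  where "weak_operator_topology =
    topology_generated_by {{T. cinner (bop_apply T \<xi>) \<eta> \<in> U} | \<xi> \<eta> U. open U}"

definition bop_borel :: "'h::chilbert_space bop measure"
  where "bop_borel = sigma UNIV {A. \<forall>n::nat. A \<inter> cball 0 (real n) \<in>
    sets (borel_of_topology (subtopology weak_operator_topology (cball 0 (real n))))}"

definition fg_codes :: "(nat \<Rightarrow> 'h::chilbert_space bop) set"
  where "fg_codes = {\<gamma>. \<gamma> \<noteq> (\<lambda>_. 0) \<and> finitely_generated (cspan (range \<gamma>))}"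

definition fg_code_space :: "(nat \<Rightarrow> 'h::chilbert_space bop) measure"
  where "fg_code_space = restrict_space (PiM UNIV (\<lambda>_. bop_borel)) fg_codes"

text \<open>The norm of a matrix over \<open>B(H)\<close> acting on \<open>H\<^sup>n\<close>.\<close>

definition mat_act :: "'h::complex_normed_vector bop mat \<Rightarrow> (nat \<Rightarrow> 'h) \<Rightarrow> nat \<Rightarrow> 'h"
  where "mat_act x \<xi> i = (\<Sum>j<dim_col x. bop_apply (x $$ (i, j)) (\<xi> j))"

definition opmat_norm :: "'h::complex_normed_vector bop mat \<Rightarrow> real"
  where "opmat_norm x =
    (SUP \<xi>\<in>{\<xi>. L2_set (\<lambda>j. norm (\<xi> j)) {..<dim_col x} \<le> 1}.
      L2_set (\<lambda>i. norm (mat_act x \<xi> i)) {..<dim_row x})"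

text \<open>
  These are the C*-norms on the \<open>M\<^sub>n(B(H))\<close>, so \<^const>\<open>opmat_norm\<close> is the norm that
  \<^const>\<open>operator_space\<close> refers to for subspaces of \<open>B(H)\<close>.
\<close>

lemma mat_act_scaleR: "mat_act x (\<lambda>j. r *\<^sub>R \<xi> j) i = r *\<^sub>R mat_act x \<xi> i"
  unfolding mat_act_def scaleR_sum_right by (simp add: bop_apply_scaleC flip: scaleC_of_real)

lemma mat_act_L2_bound:
  assumes "x \<in> carrier_mat n n"
  shows "L2_set (\<lambda>i. norm (mat_act x \<xi> i)) {..<n}
    \<le> (\<Sum>i<n. \<Sum>j<n. norm (x $$ (i, j))) * L2_set (\<lambda>j. norm (\<xi> j)) {..<n}"
proof -
  have "norm (mat_act x \<xi> i) \<le> (\<Sum>j<n. norm (x $$ (i, j))) * L2_set (\<lambda>j. norm (\<xi> j)) {..<n}" for i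
  proof -
    have "norm (mat_act x \<xi> i) \<le> (\<Sum>j<n. norm (bop_apply (x $$ (i, j)) (\<xi> j)))"
      using assms by (simp add: mat_act_def norm_sum)
    also have "\<dots> \<le> (\<Sum>j<n. norm (x $$ (i, j)) * L2_set (\<lambda>j. norm (\<xi> j)) {..<n})"
      by (intro sum_mono order_trans[OF norm_bop_apply] mult_left_mono member_le_L2_set) auto
    finally show ?thesis by (simp add: sum_distrib_right)
  qed
  then have "(\<Sum>i<n. norm (mat_act x \<xi> i))
      \<le> (\<Sum>i<n. (\<Sum>j<n. norm (x $$ (i, j))) * L2_set (\<lambda>j. norm (\<xi> j)) {..<n})"
    by (rule sum_mono)
  moreover have "L2_set (\<lambda>i. norm (mat_act x \<xi> i)) {..<n} \<le> (\<Sum>i<n. norm (mat_act x \<xi> i))"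
    by (rule L2_set_le_sum) auto
  ultimately show ?thesis by (simp add: sum_distrib_right)
qed

lemma opmat_norm_bdd:
  assumes x: "x \<in> carrier_mat n n"
  shows "bdd_above ((\<lambda>\<xi>. L2_set (\<lambda>i. norm (mat_act x \<xi> i)) {..<n})
    ` {\<xi>. L2_set (\<lambda>j. norm (\<xi> j)) {..<n} \<le> 1})"
proof (rule bdd_aboveI2)
  fix \<xi> :: "nat \<Rightarrow> 'a"
  assume "\<xi> \<in> {\<xi>. L2_set (\<lambda>j. norm (\<xi> j)) {..<n} \<le> 1}"
  then have "(\<Sum>i<n. \<Sum>j<n. norm (x $$ (i, j))) * L2_set (\<lambda>j. norm (\<xi> j)) {..<n}
      \<le> (\<Sum>i<n. \<Sum>j<n. norm (x $$ (i, j))) * 1"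
    by (intro mult_left_mono sum_nonneg) auto
  then show "L2_set (\<lambda>i. norm (mat_act x \<xi> i)) {..<n} \<le> (\<Sum>i<n. \<Sum>j<n. norm (x $$ (i, j)))"
    using mat_act_L2_bound[OF x, of \<xi>] by simp
qed

lemma opmat_norm_nonneg:
  assumes x: "x \<in> carrier_mat n n"
  shows "0 \<le> opmat_norm x"
proof -
  have "L2_set (\<lambda>i. norm (mat_act x (\<lambda>_. 0) i)) {..<n} \<le> opmat_norm x"
    using x cSUP_upper[OF _ opmat_norm_bdd[OF x], of "\<lambda>_. 0"]
    by (simp add: opmat_norm_def L2_set_def)
  then show ?thesis using L2_set_nonneg order_trans by blast
qed

lemma opmat_norm_apply:
  assumes x: "x \<in> carrier_mat n n"
  shows "L2_set (\<lambda>i. norm (mat_act x \<xi> i)) {..<n} \<le> opmat_norm x * L2_set (\<lambda>j. norm (\<xi> j)) {..<n}"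
proof (cases "L2_set (\<lambda>j. norm (\<xi> j)) {..<n} = 0")
  case True
  then show ?thesis using mat_act_L2_bound[OF x, of \<xi>] by simp
next
  case False
  define q where "q = L2_set (\<lambda>j. norm (\<xi> j)) {..<n}"
  have q: "0 < q" using False L2_set_nonneg[of "\<lambda>j. norm (\<xi> j)"] by (simp add: q_def order_less_le)
  have sc: "L2_set (\<lambda>j. norm (inverse q *\<^sub>R f j)) {..<n} = inverse q * L2_set (\<lambda>j. norm (f j)) {..<n}"
    for f :: "nat \<Rightarrow> 'a"
    using q by (simp add: L2_set_right_distrib)
  have "L2_set (\<lambda>i. norm (mat_act x (\<lambda>j. inverse q *\<^sub>R \<xi> j) i)) {..<n} \<le> opmat_norm x"
  proof -
    have "(\<lambda>j. inverse q *\<^sub>R \<xi> j) \<in> {\<xi>. L2_set (\<lambda>j. norm (\<xi> j)) {..<n} \<le> 1}"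
      unfolding mem_Collect_eq sc using q by (simp flip: q_def)
    from cSUP_upper[OF this opmat_norm_bdd[OF x]] show ?thesis
      using x unfolding opmat_norm_def by simp
  qed
  then have "inverse q * L2_set (\<lambda>i. norm (mat_act x \<xi> i)) {..<n} \<le> opmat_norm x"
    unfolding mat_act_scaleR sc .
  then show ?thesis using q by (simp add: field_simps flip: q_def)
qed

lemma opmat_norm_le:
  assumes x: "x \<in> carrier_mat n n" and b: "0 \<le> b"
    and le: "\<And>\<xi>. L2_set (\<lambda>i. norm (mat_act x \<xi> i)) {..<n} \<le> b * L2_set (\<lambda>j. norm (\<xi> j)) {..<n}"
  shows "opmat_norm x \<le> b"
  unfolding opmat_norm_def
proof (rule cSUP_least)
  show "{\<xi>::nat \<Rightarrow> 'a. L2_set (\<lambda>j. norm (\<xi> j)) {..<dim_col x} \<le> 1} \<noteq> {}"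
    by (auto intro!: exI[of _ "\<lambda>_. 0"] simp: L2_set_def)
  fix \<xi> :: "nat \<Rightarrow> 'a"
  assume "\<xi> \<in> {\<xi>. L2_set (\<lambda>j. norm (\<xi> j)) {..<dim_col x} \<le> 1}"
  then have "b * L2_set (\<lambda>j. norm (\<xi> j)) {..<n} \<le> b * 1" using x b by (intro mult_left_mono) auto
  then show "L2_set (\<lambda>i. norm (mat_act x \<xi> i)) {..<dim_row x} \<le> b" using le[of \<xi>] x by simp
qed

lemma opmat_norm_entry:
  assumes x: "x \<in> carrier_mat n n" and ij: "i < n" "j < n"
  shows "norm (x $$ (i, j)) \<le> opmat_norm x"
proof (rule norm_bop_bound[OF opmat_norm_nonneg[OF x]])
  fix v :: 'a
  let ?\<xi> = "\<lambda>k. if k = j then v else 0"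
  have eq: "bop_apply (x $$ (i, j)) v = mat_act x ?\<xi> i"
    using x ij by (simp add: mat_act_def if_distrib[of "bop_apply _"] cong: if_cong)
  have q: "L2_set (\<lambda>k. norm (?\<xi> k)) {..<n} = norm v"
    using ij by (simp add: L2_set_def if_distrib[of norm] if_distrib[of "\<lambda>t. t\<^sup>2"] cong: if_cong)
  have "norm (mat_act x ?\<xi> i) \<le> L2_set (\<lambda>i. norm (mat_act x ?\<xi> i)) {..<n}"
    using ij by (intro member_le_L2_set) auto
  also have "\<dots> \<le> opmat_norm x * norm v" using opmat_norm_apply[OF x, of ?\<xi>] by (simp only: q)
  finally show "norm (bop_apply (x $$ (i, j)) v) \<le> opmat_norm x * norm v" by (simp only: eq)
qed

lemma opmat_norm_le_sum:
  assumes x: "x \<in> carrier_mat n n"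
  shows "opmat_norm x \<le> (\<Sum>i<n. \<Sum>j<n. norm (x $$ (i, j)))"
  by (rule opmat_norm_le[OF x sum_nonneg mat_act_L2_bound[OF x]]) (simp add: sum_nonneg)

lemma mat_act_mult:
  assumes "x \<in> carrier_mat n n" "y \<in> carrier_mat n n" "i < n"
  shows "mat_act (x * y) \<xi> i = mat_act x (mat_act y \<xi>) (i::nat)"
proof -
  have "mat_act (x * y) \<xi> i = (\<Sum>j<n. \<Sum>k<n. bop_apply (x $$ (i, k)) (bop_apply (y $$ (k, j)) (\<xi> j)))"
    using assms by (simp add: mat_act_def scalar_prod_def bop_apply_sum_left bop_apply_mult atLeast0LessThan)
  also have "\<dots> = (\<Sum>k<n. \<Sum>j<n. bop_apply (x $$ (i, k)) (bop_apply (y $$ (k, j)) (\<xi> j)))"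
    by (rule sum.swap)
  also have "\<dots> = mat_act x (mat_act y \<xi>) i"
    using assms by (simp add: mat_act_def bop_apply_sum_right)
  finally show ?thesis .
qed

lemma mat_star_carrier [simp]: "x \<in> carrier_mat n n \<Longrightarrow> mat_star x \<in> carrier_mat n n"
  by (simp add: mat_star_def)

lemma mat_act_star:
  assumes x: "x \<in> carrier_mat n n"
  shows "(\<Sum>i<n. cinner (mat_act x \<xi> i) (\<eta> i)) = (\<Sum>j<n. cinner (\<xi> j) (mat_act (mat_star x) \<eta> j))"
proof -
  have "(\<Sum>i<n. cinner (mat_act x \<xi> i) (\<eta> i))
      = (\<Sum>i<n. \<Sum>j<n. cinner (\<xi> j) (bop_apply (star (x $$ (i, j))) (\<eta> i)))"
    using x by (simp add: mat_act_def cinner_sum_left cinner_star)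
  also have "\<dots> = (\<Sum>j<n. \<Sum>i<n. cinner (\<xi> j) (bop_apply (star (x $$ (i, j))) (\<eta> i)))"
    by (rule sum.swap)
  also have "\<dots> = (\<Sum>j<n. cinner (\<xi> j) (mat_act (mat_star x) \<eta> j))"
    using x by (simp add: mat_act_def mat_star_def cinner_sum_right)
  finally show ?thesis .
qed

lemma opmat_norm_mult:
  assumes x: "x \<in> carrier_mat n n" and y: "y \<in> carrier_mat n n"
  shows "opmat_norm (x * y) \<le> opmat_norm x * opmat_norm (y :: 'a::chilbert_space bop mat)"
proof (rule opmat_norm_le)
  fix \<xi> :: "nat \<Rightarrow> 'a"
  have "L2_set (\<lambda>i. norm (mat_act (x * y) \<xi> i)) {..<n} = L2_set (\<lambda>i. norm (mat_act x (mat_act y \<xi>) i)) {..<n}"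
    by (rule L2_set_cong) (use x y in \<open>auto simp: mat_act_mult\<close>)
  also have "\<dots> \<le> opmat_norm x * L2_set (\<lambda>i. norm (mat_act y \<xi> i)) {..<n}"
    by (rule opmat_norm_apply[OF x])
  also have "\<dots> \<le> opmat_norm x * (opmat_norm y * L2_set (\<lambda>i. norm (\<xi> i)) {..<n})"
    by (intro mult_left_mono opmat_norm_apply[OF y] opmat_norm_nonneg[OF x])
  finally show "L2_set (\<lambda>i. norm (mat_act (x * y) \<xi> i)) {..<n}
      \<le> opmat_norm x * opmat_norm y * L2_set (\<lambda>i. norm (\<xi> i)) {..<n}" by (simp add: mult.assoc)
qed (use x y opmat_norm_nonneg[OF x] opmat_norm_nonneg[OF y] in auto)

lemma opmat_norm_cstar:
  fixes x :: "'a::chilbert_space bop mat"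
  assumes x: "x \<in> carrier_mat n n"
  shows "opmat_norm (mat_star x * x) = (opmat_norm x)\<^sup>2"
proof -
  have sq: "(opmat_norm x)\<^sup>2 \<le> opmat_norm (mat_star x * x)"
    if x: "x \<in> carrier_mat n n" for x :: "'a bop mat"
  proof -
    let ?y = "mat_star x * x"
    have y: "?y \<in> carrier_mat n n" using mult_carrier_mat[OF mat_star_carrier[OF x] x] .
    have "opmat_norm x \<le> sqrt (opmat_norm ?y)"
    proof (rule opmat_norm_le[OF x])
      fix \<xi> :: "nat \<Rightarrow> 'a"
      let ?q = "L2_set (\<lambda>i. norm (\<xi> i)) {..<n}"
      have "(L2_set (\<lambda>i. norm (mat_act x \<xi> i)) {..<n})\<^sup>2 = (\<Sum>i<n. (norm (mat_act x \<xi> i))\<^sup>2)"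
        by (simp add: L2_set_def sum_nonneg)
      also have "\<dots> = Re (\<Sum>i<n. cinner (mat_act x \<xi> i) (mat_act x \<xi> i))"
        by (simp add: norm_sq_cinner)
      also have "\<dots> = Re (\<Sum>j<n. cinner (\<xi> j) (mat_act ?y \<xi> j))"
        by (simp add: mat_act_star[OF x] mat_act_mult[OF mat_star_carrier[OF x] x])
      also have "\<dots> \<le> cmod (\<Sum>j<n. cinner (\<xi> j) (mat_act ?y \<xi> j))" by (rule complex_Re_le_cmod)
      also have "\<dots> \<le> (\<Sum>j<n. \<bar>norm (\<xi> j)\<bar> * \<bar>norm (mat_act ?y \<xi> j)\<bar>)"
        by (intro sum_norm_le) (simp add: cinner_cauchy_schwarz)
      also have "\<dots> \<le> ?q * L2_set (\<lambda>i. norm (mat_act ?y \<xi> i)) {..<n}" by (rule L2_set_mult_ineq)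
      also have "\<dots> \<le> ?q * (opmat_norm ?y * ?q)"
        by (intro mult_left_mono opmat_norm_apply[OF y] L2_set_nonneg)
      also have "\<dots> = (sqrt (opmat_norm ?y) * ?q)\<^sup>2"
        using opmat_norm_nonneg[OF y] by (simp add: power_mult_distrib power2_eq_square)
      finally show "L2_set (\<lambda>i. norm (mat_act x \<xi> i)) {..<n} \<le> sqrt (opmat_norm ?y) * ?q"
        by (rule power2_le_imp_le) (simp add: opmat_norm_nonneg[OF y] L2_set_nonneg)
    qed (simp add: opmat_norm_nonneg[OF y])
    then have "(opmat_norm x)\<^sup>2 \<le> (sqrt (opmat_norm ?y))\<^sup>2"
      using opmat_norm_nonneg[OF x] by (intro power_mono) auto
    then show ?thesis using opmat_norm_nonneg[OF y] by simp
  qed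
  have le: "opmat_norm x \<le> opmat_norm (mat_star x)"
    if x: "x \<in> carrier_mat n n" for x :: "'a bop mat"
  proof (cases "opmat_norm x = 0")
    case True
    then show ?thesis using opmat_norm_nonneg[OF mat_star_carrier[OF x]] by simp
  next
    case False
    have "opmat_norm x * opmat_norm x \<le> opmat_norm (mat_star x) * opmat_norm x"
      using order_trans[OF sq[OF x] opmat_norm_mult[OF mat_star_carrier[OF x] x]]
      by (simp add: power2_eq_square)
    moreover have "0 < opmat_norm x" using False opmat_norm_nonneg[OF x] by simp
    ultimately show ?thesis by simp
  qed
  have "mat_star (mat_star x) = x" by (rule eq_matI) (auto simp: mat_star_def star_star)
  then have "opmat_norm (mat_star x) = opmat_norm x"
    using le[OF x] le[OF mat_star_carrier[OF x]] by simp
  then show ?thesis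
    using sq[OF x] opmat_norm_mult[OF mat_star_carrier[OF x] x] by (simp add: power2_eq_square)
qed

lemma opmat_norm_triangle:
  assumes x: "x \<in> carrier_mat n n" and y: "y \<in> carrier_mat n n"
  shows "opmat_norm (x + y) \<le> opmat_norm x + opmat_norm y"
proof (rule opmat_norm_le)
  fix \<xi> :: "nat \<Rightarrow> 'a"
  have "L2_set (\<lambda>i. norm (mat_act (x + y) \<xi> i)) {..<n}
      \<le> L2_set (\<lambda>i. norm (mat_act x \<xi> i) + norm (mat_act y \<xi> i)) {..<n}"
  proof (rule L2_set_mono)
    fix i assume "i \<in> {..<n}"
    then have "mat_act (x + y) \<xi> i = mat_act x \<xi> i + mat_act y \<xi> i"
      using x y by (simp add: mat_act_def sum.distrib)
    then show "norm (mat_act (x + y) \<xi> i) \<le> norm (mat_act x \<xi> i) + norm (mat_act y \<xi> i)"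
      by (simp add: norm_triangle_ineq)
  qed simp
  also have "\<dots> \<le> L2_set (\<lambda>i. norm (mat_act x \<xi> i)) {..<n} + L2_set (\<lambda>i. norm (mat_act y \<xi> i)) {..<n}"
    by (rule L2_set_triangle_ineq)
  also have "\<dots> \<le> (opmat_norm x + opmat_norm y) * L2_set (\<lambda>j. norm (\<xi> j)) {..<n}"
    using opmat_norm_apply[OF x, of \<xi>] opmat_norm_apply[OF y, of \<xi>] by (simp add: distrib_right)
  finally show "L2_set (\<lambda>i. norm (mat_act (x + y) \<xi> i)) {..<n}
      \<le> (opmat_norm x + opmat_norm y) * L2_set (\<lambda>j. norm (\<xi> j)) {..<n}" .
qed (use x y opmat_norm_nonneg[OF x] opmat_norm_nonneg[OF y] in auto)

lemma opmat_norm_scaleC: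
  assumes x: "x \<in> carrier_mat n n"
  shows "opmat_norm (mat_scaleC c x) = cmod c * opmat_norm x"
proof -
  have car: "mat_scaleC c x \<in> carrier_mat n n" for c using x by (simp add: mat_scaleC_def)
  have act: "mat_act (mat_scaleC c x) \<xi> i = c *\<^sub>C mat_act x \<xi> i" if "i < n" for c \<xi> i
    using x that by (simp add: mat_act_def mat_scaleC_def complex_vector.scale_sum_right)
  have L2: "L2_set (\<lambda>i. norm (mat_act (mat_scaleC c x) \<xi> i)) {..<n}
      = cmod c * L2_set (\<lambda>i. norm (mat_act x \<xi> i)) {..<n}" for c \<xi>
    unfolding L2_set_right_distrib[OF norm_ge_zero]
    by (rule L2_set_cong) (auto simp: act norm_scaleC)
  have le: "opmat_norm (mat_scaleC c x) \<le> cmod c * opmat_norm x"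
  proof (rule opmat_norm_le[OF car])
    show "L2_set (\<lambda>i. norm (mat_act (mat_scaleC c x) \<xi> i)) {..<n}
        \<le> cmod c * opmat_norm x * L2_set (\<lambda>j. norm (\<xi> j)) {..<n}" for \<xi>
      using mult_left_mono[OF opmat_norm_apply[OF x, of \<xi>] norm_ge_zero[of c]]
      by (simp add: L2 mult.assoc)
  qed (simp add: opmat_norm_nonneg[OF x])
  show ?thesis
  proof (cases "c = 0")
    case True
    then show ?thesis using le opmat_norm_nonneg[OF car, of c] by simp
  next
    case False
    have "opmat_norm x \<le> inverse (cmod c) * opmat_norm (mat_scaleC c x)"
    proof (rule opmat_norm_le[OF x])
      show "L2_set (\<lambda>i. norm (mat_act x \<xi> i)) {..<n}
          \<le> inverse (cmod c) * opmat_norm (mat_scaleC c x) * L2_set (\<lambda>j. norm (\<xi> j)) {..<n}" for \<xi>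
        using opmat_norm_apply[OF car, of c \<xi>] False by (simp add: L2 field_simps)
    qed (simp add: opmat_norm_nonneg[OF car])
    then have "cmod c * opmat_norm x \<le> opmat_norm (mat_scaleC c x)"
      using False by (simp add: field_simps)
    with le show ?thesis by simp
  qed
qed

lemma opmat_norm_eq_0_iff:
  assumes x: "x \<in> carrier_mat n n"
  shows "opmat_norm x = 0 \<longleftrightarrow> x = 0\<^sub>m n n"
proof
  assume "opmat_norm x = 0"
  then show "x = 0\<^sub>m n n" using x opmat_norm_entry[OF x] by (intro eq_matI) auto
next
  assume "x = 0\<^sub>m n n"
  then show "opmat_norm x = 0" using opmat_norm_le_sum[OF x] opmat_norm_nonneg[OF x] by simp
qed

lemma opmat_norm_complete:
  fixes s :: "nat \<Rightarrow> 'h::chilbert_space bop mat"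
  assumes s: "\<forall>k. s k \<in> carrier_mat n n"
    and cauchy: "\<forall>e>0. \<exists>K. \<forall>k\<ge>K. \<forall>l\<ge>K. opmat_norm (s k - s l) < e"
  shows "\<exists>x\<in>carrier_mat n n. (\<lambda>k. opmat_norm (s k - x)) \<longlonglongrightarrow> 0"
proof -
  have dim: "dim_row (s k) = n" "dim_col (s k) = n" for k using s by auto
  have "Cauchy (\<lambda>k. s k $$ (i, j))" if ij: "i < n" "j < n" for i j
  proof (rule CauchyI)
    fix e :: real assume "0 < e"
    then obtain K where K: "\<And>k l. K \<le> k \<Longrightarrow> K \<le> l \<Longrightarrow> opmat_norm (s k - s l) < e"
      using cauchy by blast
    have "norm (s k $$ (i, j) - s l $$ (i, j)) < e" if "K \<le> k" "K \<le> l" for k l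
    proof -
      have "s k - s l \<in> carrier_mat n n" using dim by auto
      from opmat_norm_entry[OF this ij] K[OF that] show ?thesis using dim ij by simp
    qed
    then show "\<exists>K. \<forall>k\<ge>K. \<forall>l\<ge>K. norm (s k $$ (i, j) - s l $$ (i, j)) < e" by blast
  qed
  then have "\<forall>i j. \<exists>l. i < n \<and> j < n \<longrightarrow> (\<lambda>k. s k $$ (i, j)) \<longlonglongrightarrow> l"
    by (metis Cauchy_convergent convergent_def)
  then obtain l where l: "\<And>i j. i < n \<Longrightarrow> j < n \<Longrightarrow> (\<lambda>k. s k $$ (i, j)) \<longlonglongrightarrow> l i j" by metis
  define x where "x = mat n n (\<lambda>(i, j). l i j)"
  have x: "x \<in> carrier_mat n n" by (simp add: x_def)
  have sx: "s k - x \<in> carrier_mat n n" for k using x dim by auto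
  have "(\<lambda>k. \<Sum>i<n. \<Sum>j<n. norm (s k $$ (i, j) - l i j)) \<longlonglongrightarrow> (\<Sum>i<n. \<Sum>j<n. norm (l i j - l i j))"
    by (intro tendsto_intros l) auto
  then have lim0: "(\<lambda>k. \<Sum>i<n. \<Sum>j<n. norm (s k $$ (i, j) - l i j)) \<longlonglongrightarrow> 0" by simp
  have "opmat_norm (s k - x) \<le> (\<Sum>i<n. \<Sum>j<n. norm (s k $$ (i, j) - l i j))" for k
    using opmat_norm_le_sum[OF sx, of k] dim by (simp add: x_def)
  then have "(\<lambda>k. opmat_norm (s k - x)) \<longlonglongrightarrow> 0"
    by (intro tendsto_sandwich[OF _ _ tendsto_const lim0] always_eventually allI opmat_norm_nonneg[OF sx])
  with x show ?thesis by blast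
qed

lemma matrix_cstar_norm_opmat_norm:
  "matrix_cstar_norm (opmat_norm :: 'h::chilbert_space bop mat \<Rightarrow> real)"
  unfolding matrix_cstar_norm_def
  by (intro allI impI conjI ballI opmat_norm_nonneg opmat_norm_eq_0_iff opmat_norm_triangle
      opmat_norm_scaleC opmat_norm_mult opmat_norm_cstar opmat_norm_complete) auto

end

theory Submission
  imports Defs
begin

text \<open>
  Write \<open>\<parallel>\<Sum>\<^sub>i A\<^sub>i \<otimes> b\<^sub>i\<parallel>\<close> for the norm of the matrix with coefficient matrices \<open>A\<^sub>i\<close> evaluated at a tuple
  \<open>b\<close> of elements of \<open>X\<close>. If \<open>b\<close> spans \<open>X\<close>, then a completely isometric map \<open>X \<rightarrow> Y\<close> is a tuple \<open>y\<close>
  in \<open>Y\<close> with \<open>\<parallel>\<Sum>\<^sub>i A\<^sub>i \<otimes> y\<^sub>i\<parallel> = \<parallel>\<Sum>\<^sub>i A\<^sub>i \<otimes> b\<^sub>i\<parallel>\<close> for all \<open>A\<close> of all sizes, and Gaussian rational \<open>A\<close>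
  suffice. As \<open>Y\<close> is finite-dimensional, its balls are compact, so such a \<open>y\<close> exists as soon as
  finitely many of these equations can always be solved up to \<open>\<epsilon>\<close>. That is what the universal sentences
  \<open>sup\<^sub>x (- \<Sum>\<^sub>j \<bar>\<parallel>\<Sum>\<^sub>i A\<^sub>j\<^sub>i \<otimes> x\<^sub>i\<parallel> - c\<^sub>j\<bar>)\<close> with \<open>c\<^sub>j = \<parallel>\<Sum>\<^sub>i A\<^sub>j\<^sub>i \<otimes> b\<^sub>i\<parallel>\<close> express: their value in \<open>X\<close> is \<open>0\<close>.
  Embeddings in both directions give a complete isometry by a dimension count.

  For smoothness the same data are recorded by countably many Borel conditions on a code \<open>\<gamma>\<close>: the
  solvability of finite systems of strict rational bounds on \<open>\<parallel>\<Sum>\<^sub>i A\<^sub>i \<otimes> x\<^sub>i\<parallel>\<close>, where by density \<open>x\<close> may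
  be taken among the Gaussian rational combinations of the \<open>\<gamma>\<^sub>k\<close>.
\<close>


section \<open>Matrix norms on a subspace\<close>

lemma mats_carrier: "x \<in> mats n X \<Longrightarrow> x \<in> carrier_mat n n"
  by (simp add: mats_def)

lemma mats_iff: "x \<in> mats n X \<longleftrightarrow> x \<in> carrier_mat n n \<and> (\<forall>k<n. \<forall>l<n. x $$ (k, l) \<in> X)"
proof
  assume "x \<in> mats n X"
  then have x: "x \<in> carrier_mat n n" "elements_mat x \<subseteq> X" by (auto simp: mats_def)
  then show "x \<in> carrier_mat n n \<and> (\<forall>k<n. \<forall>l<n. x $$ (k, l) \<in> X)"
    using elements_matI[OF x(1)] by (meson subsetD)
next
  assume x: "x \<in> carrier_mat n n \<and> (\<forall>k<n. \<forall>l<n. x $$ (k, l) \<in> X)"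
  have "a \<in> X" if "a \<in> elements_mat x" for a
    using elements_matD[OF that] x by (metis carrier_matD)
  with x show "x \<in> mats n X" by (auto simp: mats_def)
qed

lemma mat_mats: "(\<And>k l. k < n \<Longrightarrow> l < n \<Longrightarrow> f (k, l) \<in> X) \<Longrightarrow> mat n n f \<in> mats n X"
  by (auto simp: mats_iff)

text \<open>A common interface for operator spaces and for spans of codes in \<open>B(H)\<close>:
  the linear and metric facts about the matrix norms that the argument uses, confined to matrices
  over \<open>X\<close> of size \<open>n \<ge> 1\<close>.\<close>

locale matrix_norm_on =
  fixes X :: "'a::complex_vector set" and N :: "'a mat \<Rightarrow> real"
  assumes subspace: "csubspace X"
    and nonneg: "n \<ge> 1 \<Longrightarrow> x \<in> mats n X \<Longrightarrow> 0 \<le> N x"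
    and definite: "n \<ge> 1 \<Longrightarrow> x \<in> mats n X \<Longrightarrow> N x = 0 \<longleftrightarrow> x = 0\<^sub>m n n"
    and triangle: "n \<ge> 1 \<Longrightarrow> x \<in> mats n X \<Longrightarrow> y \<in> mats n X \<Longrightarrow> N (x + y) \<le> N x + N y"
    and scale: "n \<ge> 1 \<Longrightarrow> x \<in> mats n X \<Longrightarrow> N (mat_scaleC c x) = cmod c * N x"

lemma matrix_norm_on_if_cstar_norm:
  assumes "matrix_cstar_norm N" "csubspace X"
  shows "matrix_norm_on X N"
proof (rule matrix_norm_on.intro)
  fix n :: nat and x y :: "'a mat" and c
  assume n: "n \<ge> 1" and "x \<in> mats n X"
  then have x: "x \<in> carrier_mat n n" by (simp add: mats_carrier)
  note N = assms(1)[unfolded matrix_cstar_norm_def, rule_format, OF n]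
  show "0 \<le> N x" "N x = 0 \<longleftrightarrow> x = 0\<^sub>m n n" using conjunct1[OF N] x by simp_all
  show "N (mat_scaleC c x) = cmod c * N x"
    using conjunct1[OF conjunct2[OF conjunct2[OF N]]] x by simp
  assume "y \<in> mats n X"
  then have "y \<in> carrier_mat n n" by (simp add: mats_carrier)
  then show "N (x + y) \<le> N x + N y" using conjunct1[OF conjunct2[OF N]] x by simp
qed fact

lemma matrix_norm_on_operator_space: "operator_space X N \<Longrightarrow> matrix_norm_on X N"
  by (simp add: operator_space_def matrix_norm_on_if_cstar_norm)

section \<open>Continuity of the matrix norms in the coefficients\<close>

definition single_mat :: "nat \<Rightarrow> nat \<Rightarrow> nat \<Rightarrow> 'a::zero \<Rightarrow> 'a mat"
  where "single_mat n k l v = mat n n (\<lambda>p. if p = (k, l) then v else 0)"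

text \<open>Prepares bounds on the norm by norms of matrices with one nonzero entry. Sums of
  matrices are written entrywise because the zero matrix depends on the size.\<close>

lemma sum_mats_expand:
  assumes "x \<in> carrier_mat n n"
  shows "mat n n (\<lambda>p. \<Sum>q\<in>{..<n}\<times>{..<n}. single_mat n (fst q) (snd q) (x $$ q) $$ p) = (x::'a::comm_monoid_add mat)"
proof (rule eq_matI)
  fix i j assume "i < dim_row x" "j < dim_col x"
  with assms have ij: "i < n" "j < n" by auto
  have "(\<Sum>q\<in>{..<n}\<times>{..<n}. single_mat n (fst q) (snd q) (x $$ q) $$ (i, j))
      = (\<Sum>q\<in>{..<n}\<times>{..<n}. if (i, j) = q then x $$ q else 0)"
    by (intro sum.cong) (auto simp: single_mat_def ij)
  also have "\<dots> = x $$ (i, j)" using ij by simp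
  finally show "mat n n (\<lambda>p. \<Sum>q\<in>{..<n}\<times>{..<n}. single_mat n (fst q) (snd q) (x $$ q) $$ p) $$ (i, j) = x $$ (i, j)"
    using ij by simp
qed (use assms in auto)

context matrix_norm_on
begin

lemma zero_in: "0 \<in> X" and add_in: "x \<in> X \<Longrightarrow> y \<in> X \<Longrightarrow> x + y \<in> X"
  and scale_in: "x \<in> X \<Longrightarrow> c *\<^sub>C x \<in> X" and diff_in: "x \<in> X \<Longrightarrow> y \<in> X \<Longrightarrow> x - y \<in> X"
  and sum_in: "(\<And>i. i \<in> I \<Longrightarrow> f i \<in> X) \<Longrightarrow> sum f I \<in> X"
  using subspace by (auto intro: complex_vector.subspace_0 complex_vector.subspace_add
      complex_vector.subspace_scale complex_vector.subspace_diff complex_vector.subspace_sum)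

lemma mats_zero: "0\<^sub>m n n \<in> mats n X"
  and mats_add: "x \<in> mats n X \<Longrightarrow> y \<in> mats n X \<Longrightarrow> x + y \<in> mats n X"
  and mats_diff: "x \<in> mats n X \<Longrightarrow> y \<in> mats n X \<Longrightarrow> x - y \<in> mats n X"
  and mats_scale: "x \<in> mats n X \<Longrightarrow> mat_scaleC c x \<in> mats n X"
  by (auto simp: mats_iff zero_in add_in diff_in scale_in mat_scaleC_def)

lemma norm_zero: "n \<ge> 1 \<Longrightarrow> N (0\<^sub>m n n) = 0"
  using definite mats_zero by blast

lemma norm_diff_commute:
  assumes "n \<ge> 1" "x \<in> mats n X" "y \<in> mats n X"
  shows "N (x - y) = N (y - x)"
proof -
  have "x - y = mat_scaleC (-1) (y - x)"
    using assms by (intro eq_matI) (auto simp: mat_scaleC_def mats_def)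
  then have "N (x - y) = N (mat_scaleC (-1) (y - x))" by (rule arg_cong)
  also have "\<dots> = N (y - x)" using scale[OF assms(1) mats_diff[OF assms(3,2)], of "-1"] by simp
  finally show ?thesis .
qed

lemma norm_diff_bound:
  assumes "n \<ge> 1" "x \<in> mats n X" "y \<in> mats n X"
  shows "\<bar>N x - N y\<bar> \<le> N (x - y)"
proof -
  have "(x - y) + y = x" "(y - x) + x = y"
    using assms by (auto simp: mats_def)
  then have "N x \<le> N (x - y) + N y" "N y \<le> N (y - x) + N x"
    using triangle[OF assms(1) mats_diff[OF assms(2,3)] assms(3)]
      triangle[OF assms(1) mats_diff[OF assms(3,2)] assms(2)] by simp_all
  then show ?thesis using norm_diff_commute[OF assms] by linarith
qed

text \<open>Membership in \<open>mats n X\<close> is proved along with the bound because the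
  triangle inequality in the induction step asks it of the partial sum.\<close>

lemma norm_sum_le:
  assumes n: "n \<ge> 1" and "finite I" and "\<And>i. i \<in> I \<Longrightarrow> f i \<in> mats n X"
  shows "mat n n (\<lambda>p. \<Sum>i\<in>I. f i $$ p) \<in> mats n X \<and> N (mat n n (\<lambda>p. \<Sum>i\<in>I. f i $$ p)) \<le> (\<Sum>i\<in>I. N (f i))"
  using assms(2,3)
proof (induction I rule: finite_induct)
  case empty
  have "mat n n (\<lambda>p. 0) = (0\<^sub>m n n :: 'a mat)" by (rule eq_matI) auto
  then show ?case using norm_zero[OF n] mats_zero by simp
next
  case (insert i I)
  let ?S = "mat n n (\<lambda>p. \<Sum>i\<in>I. f i $$ p)"
  have IH: "?S \<in> mats n X" "N ?S \<le> (\<Sum>i\<in>I. N (f i))" using insert by auto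
  have fi: "f i \<in> mats n X" using insert by auto
  have eq: "mat n n (\<lambda>p. \<Sum>i\<in>insert i I. f i $$ p) = f i + ?S"
    using fi insert(1,2) by (intro eq_matI) (auto simp: mats_def)
  show ?case unfolding eq using triangle[OF n fi IH(1)] IH insert(1,2) mats_add[OF fi IH(1)]
    by auto
qed

lemma norm_le_sum_single:
  assumes n: "n \<ge> 1" and x: "x \<in> mats n X"
  shows "N x \<le> (\<Sum>q\<in>{..<n}\<times>{..<n}. N (single_mat n (fst q) (snd q) (x $$ q)))"
proof -
  have s: "single_mat n (fst q) (snd q) (x $$ q) \<in> mats n X" if "q \<in> {..<n}\<times>{..<n}" for q
    using that x by (auto simp: single_mat_def mats_iff zero_in)
  have fin: "finite ({..<n}\<times>{..<n})" by simp
  show ?thesis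
    using conjunct2[OF norm_sum_le[where f = "\<lambda>q. single_mat n (fst q) (snd q) (x $$ q)", OF n fin s]]
    unfolding sum_mats_expand[OF mats_carrier[OF x]] .
qed

lemma norm_single_comb_le:
  assumes n: "n \<ge> 1" and k: "k < n" "l < n" and "finite J" and c: "\<And>j. j \<in> J \<Longrightarrow> c j \<in> X"
  shows "N (single_mat n k l (\<Sum>j\<in>J. w j *\<^sub>C c j)) \<le> (\<Sum>j\<in>J. cmod (w j) * N (single_mat n k l (c j)))"
proof -
  have s: "single_mat n k l (c j) \<in> mats n X" if "j \<in> J" for j
    using c[OF that] by (auto simp: single_mat_def mats_iff zero_in)
  have eq: "single_mat n k l (\<Sum>j\<in>J. w j *\<^sub>C c j) = mat n n (\<lambda>p. \<Sum>j\<in>J. mat_scaleC (w j) (single_mat n k l (c j)) $$ p)"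
    by (rule eq_matI) (auto simp: single_mat_def mat_scaleC_def)
  have "N (single_mat n k l (\<Sum>j\<in>J. w j *\<^sub>C c j)) \<le> (\<Sum>j\<in>J. N (mat_scaleC (w j) (single_mat n k l (c j))))"
    unfolding eq by (rule conjunct2[OF norm_sum_le[OF n assms(4)]]) (intro mats_scale s)
  also have "\<dots> = (\<Sum>j\<in>J. cmod (w j) * N (single_mat n k l (c j)))"
    by (intro sum.cong refl scale[OF n s])
  finally show ?thesis .
qed

text \<open>By the reverse triangle inequality and the expansion into single-entry matrices, the
  change of the norm is at most a linear combination of the \<open>cmod (W m p j - w p j)\<close>.
  The norms of the matrices \<open>single_mat n k l (c j)\<close> enter only as constants.\<close>

lemma norm_tendsto:
  fixes W :: "'i \<Rightarrow> nat \<times> nat \<Rightarrow> 'j \<Rightarrow> complex"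
  assumes n: "n \<ge> 1" and J: "finite J" and c: "\<And>j. j \<in> J \<Longrightarrow> c j \<in> X"
    and W: "\<And>p j. p \<in> {..<n}\<times>{..<n} \<Longrightarrow> j \<in> J \<Longrightarrow> ((\<lambda>m. W m p j) \<longlongrightarrow> w p j) F"
  shows "((\<lambda>m. N (mat n n (\<lambda>p. \<Sum>j\<in>J. W m p j *\<^sub>C c j))) \<longlongrightarrow> N (mat n n (\<lambda>p. \<Sum>j\<in>J. w p j *\<^sub>C c j))) F"
proof -
  let ?x = "\<lambda>w. mat n n (\<lambda>p. \<Sum>j\<in>J. w p j *\<^sub>C c j)"
  have x: "?x w \<in> mats n X" for w :: "nat \<times> nat \<Rightarrow> 'j \<Rightarrow> complex"
    by (intro mat_mats sum_in scale_in c)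
  have diff: "?x w - ?x v = ?x (\<lambda>p j. w p j - v p j)" for w v :: "nat \<times> nat \<Rightarrow> 'j \<Rightarrow> complex"
    by (rule eq_matI) (simp_all add: sum_subtractf complex_vector.scale_left_diff_distrib)
  let ?B = "\<lambda>m. \<Sum>p\<in>{..<n}\<times>{..<n}. \<Sum>j\<in>J. cmod (W m p j - w p j) * N (single_mat n (fst p) (snd p) (c j))"
  have le: "\<bar>N (?x (W m)) - N (?x w)\<bar> \<le> ?B m" for m
  proof -
    have "\<bar>N (?x (W m)) - N (?x w)\<bar> \<le> N (?x (\<lambda>p j. W m p j - w p j))"
      using norm_diff_bound[OF n x x, of "W m" w] by (simp only: diff)
    also have "\<dots> \<le> (\<Sum>p\<in>{..<n}\<times>{..<n}. N (single_mat n (fst p) (snd p) (\<Sum>j\<in>J. (W m p j - w p j) *\<^sub>C c j)))"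
    proof -
      have "mat n n f $$ q = f q" if "q \<in> {..<n}\<times>{..<n}" for q and f :: "nat \<times> nat \<Rightarrow> 'a"
        using that by auto
      then show ?thesis
        using norm_le_sum_single[OF n x, of "\<lambda>p j. W m p j - w p j"] by (simp cong: sum.cong)
    qed
    also have "\<dots> \<le> ?B m"
    proof (rule sum_mono)
      fix p assume "p \<in> {..<n} \<times> {..<n}"
      then show "N (single_mat n (fst p) (snd p) (\<Sum>j\<in>J. (W m p j - w p j) *\<^sub>C c j))
          \<le> (\<Sum>j\<in>J. cmod (W m p j - w p j) * N (single_mat n (fst p) (snd p) (c j)))"
        by (intro norm_single_comb_le[OF n _ _ J c]) auto
    qed
    finally show ?thesis .
  qed
  have "(?B \<longlongrightarrow> (\<Sum>p\<in>{..<n}\<times>{..<n}. \<Sum>j\<in>J. cmod (w p j - w p j) * N (single_mat n (fst p) (snd p) (c j)))) F"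
    by (rule tendsto_sum, rule tendsto_sum, rule tendsto_mult[OF tendsto_norm[OF tendsto_diff[OF W tendsto_const]] tendsto_const])
  then have B: "(?B \<longlongrightarrow> 0) F" by simp
  have "((\<lambda>m. N (?x (W m)) - N (?x w)) \<longlongrightarrow> 0) F"
    by (rule Lim_null_comparison[OF always_eventually B]) (use le in \<open>simp only: real_norm_def simp_thms\<close>)
  then show ?thesis by (rule LIM_zero_cancel)
qed

end


section \<open>Finite-dimensional subspaces\<close>

text \<open>The product of closed discs is compact by Tychonoff. Over a countable index type the
  product is first countable, so compactness yields convergent subsequences, and convergence in the
  product is coordinatewise.\<close>

lemma bounded_family_convergent_subseq:
  fixes z :: "nat \<Rightarrow> 'i::countable \<Rightarrow> complex"
  assumes "\<And>m p. cmod (z m p) \<le> R"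
  obtains r w where "strict_mono (r :: nat \<Rightarrow> nat)" "\<And>p. (\<lambda>m. z (r m) p) \<longlonglongrightarrow> w p"
proof -
  have "compactin (product_topology (\<lambda>_. euclidean) UNIV) (Pi\<^sub>E (UNIV::'i set) (\<lambda>_. cball (0::complex) R))"
    by (simp add: compactin_PiE)
  then have "seq_compact (Pi\<^sub>E (UNIV::'i set) (\<lambda>_. cball (0::complex) R))"
    by (intro compact_imp_seq_compact) (simp add: euclidean_product_topology)
  then obtain w r where r: "strict_mono (r :: nat \<Rightarrow> nat)" "(z \<circ> r) \<longlonglongrightarrow> w"
    by (rule seq_compactE) (use assms in \<open>auto simp: PiE_def\<close>)
  have "(\<lambda>m. z (r m) p) \<longlonglongrightarrow> w p" for p
    using continuous_on_tendsto_compose[OF continuous_on_product_coordinates[of p] r(2)] by (simp add: o_def)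
  with r(1) show ?thesis using that by blast
qed

lemma finitely_generated_basis:
  fixes X :: "'a::complex_vector set"
  assumes "finitely_generated X"
  obtains c :: "nat \<Rightarrow> 'a" and e :: nat where "\<And>j. c j \<in> X" "\<And>x. x \<in> X \<Longrightarrow> \<exists>z. x = (\<Sum>j<e. z j *\<^sub>C c j)"
    "\<And>z. (\<Sum>j<e. z j *\<^sub>C c j) = 0 \<Longrightarrow> \<forall>j<e. z j = 0"
proof -
  obtain G where G: "finite G" "X = cspan G" using assms by (auto simp: finitely_generated_def)
  obtain B where B: "B \<subseteq> G" "complex_vector.independent B" "G \<subseteq> cspan B"
    using complex_vector.maximal_independent_subset[of G] by metis
  have fin: "finite B" using B(1) G(1) finite_subset by blast
  have XB: "X = cspan B"
    unfolding G(2) by (intro subset_antisym complex_vector.span_mono[OF B(1)]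
        complex_vector.span_minimal[OF B(3) complex_vector.subspace_span])
  obtain f where f: "bij_betw f {..<card B} B"
    using ex_bij_betw_nat_finite[OF fin] by (auto simp: atLeast0LessThan)
  \<comment> \<open>The default 0 puts \<open>c j\<close> in \<open>X\<close> for every
    \<open>j\<close>, also beyond the basis.\<close>
  define c where "c j = (if j < card B then f j else 0)" for j
  have sum_c: "(\<Sum>j<card B. z j *\<^sub>C c j) = (\<Sum>v\<in>B. z (the_inv_into {..<card B} f v) *\<^sub>C v)" for z
    using f by (subst sum.reindex_bij_betw[OF f, symmetric])
      (auto simp: c_def bij_betw_def the_inv_into_f_f intro!: sum.cong)
  have sum_B: "(\<Sum>v\<in>B. u v *\<^sub>C v) = (\<Sum>j<card B. u (f j) *\<^sub>C c j)" for u
    by (subst sum.reindex_bij_betw[OF f, symmetric]) (auto simp: c_def intro!: sum.cong)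
  show ?thesis
  proof (rule that)
    show "c j \<in> X" for j
      using bij_betwE[OF f] by (auto simp: c_def XB complex_vector.span_base complex_vector.span_zero)
    show "\<exists>z. x = (\<Sum>j<card B. z j *\<^sub>C c j)" if "x \<in> X" for x
    proof -
      obtain u where "x = (\<Sum>j<card B. u (f j) *\<^sub>C c j)"
        using \<open>x \<in> X\<close> unfolding XB complex_vector.span_finite[OF fin] sum_B by (rule rangeE)
      then show ?thesis by (rule exI[of _ "\<lambda>j. u (f j)"])
    qed
    show "\<forall>j<card B. z j = 0" if "(\<Sum>j<card B. z j *\<^sub>C c j) = 0" for z
    proof -
      have z0: "z (the_inv_into {..<card B} f v) = 0" if "v \<in> B" for v
      proof (rule ccontr)
        assume "z (the_inv_into {..<card B} f v) \<noteq> 0"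
        then have "complex_vector.dependent B"
          unfolding complex_vector.dependent_finite[OF fin]
          using \<open>v \<in> B\<close> \<open>(\<Sum>j<card B. z j *\<^sub>C c j) = 0\<close>[unfolded sum_c]
          by (intro exI[of _ "\<lambda>v. z (the_inv_into {..<card B} f v)"]) auto
        with B(2) show False by simp
      qed
      show ?thesis
      proof (intro allI impI)
        fix j assume j: "j < card B"
        then have "f j \<in> B" using bij_betwE[OF f] by auto
        from z0[OF this] show "z j = 0"
          using the_inv_into_f_f[OF bij_betw_imp_inj_on[OF f]] j by simp
      qed
    qed
  qed
qed

text \<open>Dimension count: the images of a basis of \<open>e\<close> vectors are \<open>e\<close>
  independent vectors. A vector of \<open>X\<close> outside their span would give
  \<open>e + 1\<close> independent vectors in the span of \<open>e\<close> vectors.\<close>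

lemma linear_inj_on_finitely_generated_surj:
  fixes w :: "'a::complex_vector \<Rightarrow> 'a"
  assumes fg: "finitely_generated X" and wX: "w ` X \<subseteq> X" and inj: "inj_on w X"
    and add: "\<And>x y. x \<in> X \<Longrightarrow> y \<in> X \<Longrightarrow> w (x + y) = w x + w y"
    and sc: "\<And>c x. x \<in> X \<Longrightarrow> w (c *\<^sub>C x) = c *\<^sub>C w x"
  shows "w ` X = X"
proof -
  have sub: "csubspace X" using fg by (auto simp: finitely_generated_def)
  obtain c :: "nat \<Rightarrow> 'a" and e :: nat where c: "\<And>j. c j \<in> X" "\<And>x. x \<in> X \<Longrightarrow> \<exists>z. x = (\<Sum>j<e. z j *\<^sub>C c j)"
    "\<And>z. (\<Sum>j<e. z j *\<^sub>C c j) = 0 \<Longrightarrow> \<forall>j<e. z j = 0"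
    using finitely_generated_basis[OF fg] by blast
  have w0: "w 0 = 0" using sc[OF c(1), of 0] by simp
  have X0: "0 \<in> X" using sub by (rule complex_vector.subspace_0)
  have sum_in: "(\<Sum>j\<in>J. z j *\<^sub>C c j) \<in> X" for z and J :: "nat set"
    by (intro complex_vector.subspace_sum[OF sub] complex_vector.subspace_scale[OF sub] c(1))
  have w_sum: "w (\<Sum>j\<in>J. z j *\<^sub>C c j) = (\<Sum>j\<in>J. z j *\<^sub>C w (c j))" if "finite J" for z J
    using that
  proof (induction J rule: finite_induct)
    case (insert j J)
    then show ?case
      using add[OF complex_vector.subspace_scale[OF sub c(1)] sum_in] by (simp add: sc c(1))
  qed (simp add: w0)
  have cj: "inj_on (w \<circ> c) {..<e}"
  proof (rule inj_onI, rule ccontr)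
    fix i j assume ij: "i \<in> {..<e}" "j \<in> {..<e}" "(w \<circ> c) i = (w \<circ> c) j" "i \<noteq> j"
    then have "c i = c j" using inj c(1) by (auto dest: inj_onD)
    \<comment> \<open>If two basis vectors coincided, \<open>c i - c j = 0\<close> would be a
      nontrivial relation.\<close>
    moreover have "(\<Sum>l<e. (if l = i then 1 else if l = j then -1 else 0) *\<^sub>C c l)
        = (\<Sum>l\<in>{i, j}. (if l = i then 1 else -1) *\<^sub>C c l)"
      using ij by (intro sum.mono_neutral_cong_right) auto
    ultimately have "(\<Sum>l<e. (if l = i then 1 else if l = j then -1 else 0) *\<^sub>C c l) = 0"
      using ij(4) by simp
    from c(3)[OF this] ij(1) show False by auto
  qed
  let ?S = "(w \<circ> c) ` {..<e}"
  have indep: "complex_vector.independent ?S"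
  proof (rule ccontr)
    assume "\<not> ?thesis"
    then have "\<exists>u. (\<exists>v\<in>?S. u v \<noteq> 0) \<and> (\<Sum>v\<in>?S. u v *\<^sub>C v) = 0"
      by (simp only: complex_vector.dependent_finite[OF finite_imageI[OF finite_lessThan]] not_not)
    then obtain u v where u: "v \<in> ?S" "u v \<noteq> 0" "(\<Sum>v\<in>?S. u v *\<^sub>C v) = 0"
      by blast
    have "(\<Sum>v\<in>?S. u v *\<^sub>C v) = w (\<Sum>j<e. u (w (c j)) *\<^sub>C c j)"
      unfolding sum.reindex[OF cj] w_sum[OF finite_lessThan] by simp
    then have "(\<Sum>j<e. u (w (c j)) *\<^sub>C c j) = 0"
      using u(3) w0 by (intro inj_onD[OF inj _ sum_in X0]) simp
    from c(3)[OF this] u(1,2) show False by auto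
  qed
  have Xspan: "X \<subseteq> cspan (c ` {..<e})"
  proof
    fix x assume "x \<in> X"
    then obtain z where "x = (\<Sum>j<e. z j *\<^sub>C c j)" using c(2) by blast
    moreover have "(\<Sum>j<e. z j *\<^sub>C c j) \<in> cspan (c ` {..<e})"
      by (rule complex_vector.span_sum, rule complex_vector.span_scale,
          rule complex_vector.span_base, rule imageI)
    ultimately show "x \<in> cspan (c ` {..<e})" by simp
  qed
  have "X \<subseteq> cspan ?S"
  proof
    fix y assume y: "y \<in> X"
    show "y \<in> cspan ?S"
    proof (rule ccontr)
      assume ny: "y \<notin> cspan ?S"
      have "?S \<subseteq> X" using wX c(1) by (auto simp: image_subset_iff)
      with Xspan y have "insert y ?S \<subseteq> cspan (c ` {..<e})" by (meson insert_subset subset_iff)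
      from complex_vector.independent_span_bound[OF _ complex_vector.independent_insertI[OF ny indep] this]
      have "card (insert y ?S) \<le> card (c ` {..<e})" by simp
      moreover have "card (c ` {..<e}) \<le> e" using card_image_le[of "{..<e}" c] by simp
      moreover have "card (insert y ?S) = Suc (card ?S)"
        using complex_vector.span_base[of y ?S] ny by (intro card_insert_disjoint finite_imageI finite_lessThan) argo
      moreover have "card ?S = e" using card_image[OF cj] by (simp only: card_lessThan)
      ultimately show False by linarith
    qed
  qed
  moreover have "cspan ?S \<subseteq> w ` X"
  proof
    fix y assume "y \<in> cspan ?S"
    then obtain u where "y = (\<Sum>v\<in>?S. u v *\<^sub>C v)"
      unfolding complex_vector.span_finite[OF finite_imageI[OF finite_lessThan]] by (rule rangeE)
    then have "y = w (\<Sum>j<e. u (w (c j)) *\<^sub>C c j)"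
      unfolding sum.reindex[OF cj] w_sum[OF finite_lessThan] by simp
    then show "y \<in> w ` X" using sum_in by (intro image_eqI[where x = "\<Sum>j<e. u (w (c j)) *\<^sub>C c j"])
  qed
  ultimately show ?thesis using wX by auto
qed

text \<open>Comparison of norms in finite dimension, by compactness. If no \<open>K\<close> works,
  there are coefficient vectors with \<open>\<Sum>j<e. cmod (v m j) = 1\<close> whose combinations
  have norm at most \<open>1 / (m + 1)\<close>. A limit of a subsequence is a nontrivial relation
  between the independent \<open>c j\<close>.\<close>

lemma (in matrix_norm_on) coefficient_bound:
  assumes c: "\<And>j. c j \<in> X" and indep: "\<And>z. (\<Sum>j<e. z j *\<^sub>C c j) = 0 \<Longrightarrow> \<forall>j<e. z j = 0"
  shows "\<exists>K\<ge>0. \<forall>z. \<forall>j<e::nat. cmod (z j) \<le> K * N (mat 1 1 (\<lambda>_. \<Sum>j<e. z j *\<^sub>C c j))"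
proof (rule ccontr)
  let ?x = "\<lambda>z. mat 1 1 (\<lambda>_. \<Sum>j<e. z j *\<^sub>C c j)"
  have x: "?x z \<in> mats 1 X" for z by (intro mat_mats sum_in scale_in c)
  assume contra: "\<not> ?thesis"
  have "\<exists>z. \<exists>j<e. real (Suc m) * N (?x z) < cmod (z j)" for m
  proof (rule ccontr)
    assume "\<not> ?thesis"
    then have "\<forall>z. \<forall>j<e. cmod (z j) \<le> real (Suc m) * N (?x z)" by (meson not_le)
    then show False using contra of_nat_0_le_iff by blast
  qed
  then obtain z j where zj: "\<And>m. j m < e" "\<And>m. real (Suc m) * N (?x (z m)) < cmod (z m (j m))"
    by metis
  define s where "s m = (\<Sum>j<e. cmod (z m j))" for m
  have s: "real (Suc m) * N (?x (z m)) < s m" for m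
  proof -
    have "cmod (z m (j m)) \<le> s m" unfolding s_def by (rule member_le_sum) (use zj(1) in auto)
    then show ?thesis using zj(2)[of m] by simp
  qed
  have s0: "s m > 0" for m
    by (rule order.strict_trans1[OF _ s]) (intro mult_nonneg_nonneg nonneg[OF order.refl x] of_nat_0_le_iff)
  \<comment> \<open>The normalized coefficients, extended by 0 to all indices so that they form a
    bounded family over \<open>nat\<close>.\<close>
  define v where "v m j = (if j < e then z m j / of_real (s m) else 0)" for m j
  have "cmod (v m j) \<le> 1" for m j
  proof (cases "j < e")
    case True
    then have "cmod (z m j) \<le> s m" unfolding s_def by (intro member_le_sum) auto
    then show ?thesis using s0[of m] True by (simp add: v_def norm_divide)
  qed (simp add: v_def)
  then obtain r w where r: "strict_mono (r :: nat \<Rightarrow> nat)" and w: "\<And>j. (\<lambda>m. v (r m) j) \<longlonglongrightarrow> w j"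
    by (rule bounded_family_convergent_subseq[of v 1]) (rule that)
  have "?x (v m) = mat_scaleC (1 / of_real (s m)) (?x (z m))" for m
    by (rule eq_matI) (auto simp: mat_scaleC_def v_def complex_vector.scale_sum_right scaleC_scaleC)
  then have "N (?x (v m)) = N (?x (z m)) / s m" for m
    using scale[OF _ x, of "1 / of_real (s m)" "z m"] s0[of m] by (simp add: norm_divide)
  then have Nv: "N (?x (v m)) \<le> 1 / real (Suc m)" for m
    using less_imp_le[OF s[of m]] s0[of m] by (simp add: pos_divide_le_eq pos_le_divide_eq mult.commute)
  have lim: "(\<lambda>m. N (?x (v (r m)))) \<longlonglongrightarrow> N (?x w)"
    by (rule norm_tendsto[where W = "\<lambda>m p. v (r m)" and w = "\<lambda>p. w"]) (simp_all add: c w)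
  have "(\<lambda>m. 1 / real (Suc (r m))) \<longlonglongrightarrow> 0"
    using LIMSEQ_subseq_LIMSEQ[OF LIMSEQ_Suc[OF lim_1_over_n] r] by (simp add: o_def)
  then have "N (?x w) \<le> 0"
    by (rule LIMSEQ_le[OF lim]) (use Nv in auto)
  then have "?x w = 0\<^sub>m 1 1" using definite[OF _ x, of w] nonneg[OF _ x, of w] by simp
  then have "?x w $$ (0, 0) = 0" by simp
  then have "\<forall>j<e. w j = 0" by (intro indep) simp
  then have "(\<Sum>j<e. cmod (w j)) = 0" by simp
  moreover have "(\<lambda>m. \<Sum>j<e. cmod (v (r m) j)) \<longlonglongrightarrow> (\<Sum>j<e. cmod (w j))"
    by (intro tendsto_sum tendsto_norm w)
  moreover have "(\<Sum>j<e. cmod (v m j)) = 1" for m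
    using s0[of m] by (simp add: v_def norm_divide flip: sum_divide_distrib s_def)
  ultimately show False by (simp add: LIMSEQ_const_iff)
qed


section \<open>Complete isometries from local approximation\<close>

text \<open>A complete isometry into \<open>Y\<close>, possibly with smaller range. Norms take the
  place of the distances in \<open>completely_isometric\<close>; by linearity this amounts to the
  same.\<close>

definition matrix_embedding ::
    "'a::complex_vector set \<Rightarrow> ('a mat \<Rightarrow> real) \<Rightarrow> 'b::complex_vector set \<Rightarrow> ('b mat \<Rightarrow> real) \<Rightarrow> ('a \<Rightarrow> 'b) \<Rightarrow> bool"
  where "matrix_embedding X N Y M u \<longleftrightarrow> u ` X \<subseteq> Y \<and>
    (\<forall>x\<in>X. \<forall>y\<in>X. u (x + y) = u x + u y) \<and> (\<forall>c. \<forall>x\<in>X. u (c *\<^sub>C x) = c *\<^sub>C u x) \<and>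
    (\<forall>n\<ge>1. \<forall>x\<in>mats n X. M (map_mat u x) = N x)"

lemma matrix_embeddingD:
  assumes "matrix_embedding X N Y M u"
  shows "x \<in> X \<Longrightarrow> u x \<in> Y" "x \<in> X \<Longrightarrow> y \<in> X \<Longrightarrow> u (x + y) = u x + u y"
    "x \<in> X \<Longrightarrow> u (c *\<^sub>C x) = c *\<^sub>C u x" "n \<ge> 1 \<Longrightarrow> z \<in> mats n X \<Longrightarrow> M (map_mat u z) = N z"
  using assms unfolding matrix_embedding_def by auto

lemma matrix_embedding_diff:
  assumes u: "matrix_embedding X N Y M u" and X: "csubspace X" and "x \<in> X" "y \<in> X"
  shows "u (x - y) = u x - u y"
  using matrix_embeddingD(2)[OF u complex_vector.subspace_diff[OF X assms(3,4)] assms(4)] by simp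

lemma matrix_embedding_zero:
  assumes u: "matrix_embedding X N Y M u" and X: "csubspace X"
  shows "u 0 = 0"
  using matrix_embedding_diff[OF u X complex_vector.subspace_0[OF X] complex_vector.subspace_0[OF X]] by simp

lemma matrix_embedding_inj_on:
  assumes u: "matrix_embedding X N Y M u" and "matrix_norm_on X N" "matrix_norm_on Y M"
  shows "inj_on u X"
proof (rule inj_onI)
  interpret X: matrix_norm_on X N by fact
  interpret Y: matrix_norm_on Y M by fact
  fix x y assume xy: "x \<in> X" "y \<in> X" "u x = u y"
  let ?d = "mat 1 1 (\<lambda>_. x - y)"
  have d: "?d \<in> mats 1 X" by (intro mat_mats X.diff_in xy)
  have "map_mat u ?d = 0\<^sub>m 1 1"
    by (rule eq_matI) (auto simp: matrix_embedding_diff[OF u X.subspace xy(1,2)] xy(3))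
  then have "N ?d = 0" using matrix_embeddingD(4)[OF u order.refl d] Y.norm_zero[of 1] by simp
  then have "?d = 0\<^sub>m 1 1" using X.definite[OF order.refl d] by simp
  then have "?d $$ (0, 0) = 0" by simp
  then show "x = y" by simp
qed

lemma completely_isometric_iff_embedding_onto:
  assumes "matrix_norm_on X N" "matrix_norm_on Y M"
  shows "completely_isometric X N Y M \<longleftrightarrow> (\<exists>u. matrix_embedding X N Y M u \<and> u ` X = Y)"
proof
  interpret X: matrix_norm_on X N by fact
  interpret Y: matrix_norm_on Y M by fact
  show "\<exists>u. matrix_embedding X N Y M u \<and> u ` X = Y" if ci: "completely_isometric X N Y M"
  proof -
    obtain u where u: "bij_betw u X Y" "\<And>x y. x \<in> X \<Longrightarrow> y \<in> X \<Longrightarrow> u (x + y) = u x + u y"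
      "\<And>c x. x \<in> X \<Longrightarrow> u (c *\<^sub>C x) = c *\<^sub>C u x"
      "\<And>n x y. n \<ge> 1 \<Longrightarrow> x \<in> mats n X \<Longrightarrow> y \<in> mats n X \<Longrightarrow> M (map_mat u x - map_mat u y) = N (x - y)"
      using ci unfolding completely_isometric_def by blast
    have u0: "u 0 = 0" using u(2)[OF X.zero_in X.zero_in] by simp
    have "M (map_mat u x) = N x" if "n \<ge> 1" "x \<in> mats n X" for n x
    proof -
      have "map_mat u x - map_mat u (0\<^sub>m n n) = map_mat u x" "x - 0\<^sub>m n n = x"
        using that(2) by (auto simp: mats_def u0 intro!: eq_matI)
      then show ?thesis using u(4)[OF that X.mats_zero] by simp
    qed
    with u show ?thesis
      by (intro exI[of _ u]) (simp add: matrix_embedding_def bij_betw_def)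
  qed
  assume "\<exists>u. matrix_embedding X N Y M u \<and> u ` X = Y"
  then obtain u where u: "matrix_embedding X N Y M u" "u ` X = Y" by blast
  have "M (map_mat u x - map_mat u y) = N (x - y)" if n: "n \<ge> 1" and x: "x \<in> mats n X" and y: "y \<in> mats n X" for n x y
  proof -
    have "map_mat u x - map_mat u y = map_mat u (x - y)"
      using x y by (intro eq_matI) (auto simp: mats_iff matrix_embedding_diff[OF u(1) X.subspace])
    then show ?thesis using matrix_embeddingD(4)[OF u(1) n X.mats_diff[OF x y]] by simp
  qed
  moreover have "bij_betw u X Y"
    using matrix_embedding_inj_on[OF u(1) assms] u(2) by (simp add: bij_betw_def)
  ultimately show "completely_isometric X N Y M"
    unfolding completely_isometric_def using matrix_embeddingD(2,3)[OF u(1)] by blast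
qed

text \<open>The composition of \<open>v\<close> and \<open>u\<close> is an injective linear map of
  the finite-dimensional \<open>Y\<close> into itself, hence onto. So \<open>u\<close> is already
  onto \<open>Y\<close>.\<close>

lemma completely_isometric_if_mutual_embeddings:
  assumes X: "matrix_norm_on X N" and Y: "matrix_norm_on Y M" and fg: "finitely_generated Y"
    and u: "matrix_embedding X N Y M u" and v: "matrix_embedding Y M X N v"
  shows "completely_isometric X N Y M"
proof -
  have uv: "u (v y) \<in> Y" "v y \<in> X" if "y \<in> Y" for y
    using that matrix_embeddingD(1)[OF u] matrix_embeddingD(1)[OF v] by blast+
  have "(\<lambda>y. u (v y)) ` Y = Y"
  proof (rule linear_inj_on_finitely_generated_surj[OF fg])
    show "inj_on (\<lambda>y. u (v y)) Y"
    proof (rule inj_onI)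
      fix x y assume xy: "x \<in> Y" "y \<in> Y" "u (v x) = u (v y)"
      have "v x = v y" by (rule inj_onD[OF matrix_embedding_inj_on[OF u X Y] xy(3) uv(2)[OF xy(1)] uv(2)[OF xy(2)]])
      then show "x = y" using xy(1,2) by (rule inj_onD[OF matrix_embedding_inj_on[OF v Y X]])
    qed
  qed (use uv in \<open>auto simp: matrix_embeddingD(2,3)[OF u] matrix_embeddingD(2,3)[OF v]\<close>)
  moreover have "(\<lambda>y. u (v y)) ` Y \<subseteq> u ` X" using uv(2) by blast
  moreover have "u ` X \<subseteq> Y" using matrix_embeddingD(1)[OF u] by blast
  ultimately have "u ` X = Y" by simp
  with u show ?thesis using completely_isometric_iff_embedding_onto[OF X Y] by blast
qed

lemma completely_isometric_sym:
  assumes X: "matrix_norm_on X N" and Y: "matrix_norm_on Y M" and ci: "completely_isometric X N Y M"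
  shows "completely_isometric Y M X N"
proof -
  interpret X: matrix_norm_on X N by fact
  interpret Y: matrix_norm_on Y M by fact
  obtain u where u: "matrix_embedding X N Y M u" "u ` X = Y"
    using ci completely_isometric_iff_embedding_onto[OF X Y] by blast
  have inj: "inj_on u X" by (rule matrix_embedding_inj_on[OF u(1) X Y])
  let ?v = "inv_into X u"
  have vu: "?v (u x) = x" if "x \<in> X" for x using inv_into_f_f[OF inj that] .
  have uv: "u (?v y) = y" "?v y \<in> X" if "y \<in> Y" for y
    using that u(2) by (auto intro: f_inv_into_f inv_into_into)
  have "matrix_embedding Y M X N ?v"
    unfolding matrix_embedding_def
  proof (intro conjI ballI allI impI)
    show "?v ` Y \<subseteq> X" using uv by blast
    show "?v (x + y) = ?v x + ?v y" if "x \<in> Y" "y \<in> Y" for x y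
    proof -
      have "?v (u (?v x + ?v y)) = ?v x + ?v y" using that by (intro vu X.add_in uv)
      then show ?thesis using that by (simp add: matrix_embeddingD(2)[OF u(1)] uv)
    qed
    show "?v (c *\<^sub>C x) = c *\<^sub>C ?v x" if "x \<in> Y" for c x
    proof -
      have "?v (u (c *\<^sub>C ?v x)) = c *\<^sub>C ?v x" using that by (intro vu X.scale_in uv)
      then show ?thesis using that by (simp add: matrix_embeddingD(3)[OF u(1)] uv)
    qed
    fix n :: nat and y assume n: "1 \<le> n" and y: "y \<in> mats n Y"
    have vy: "map_mat ?v y \<in> mats n X" using y uv by (auto simp: mats_iff)
    have "map_mat u (map_mat ?v y) = y" using y uv by (intro eq_matI) (auto simp: mats_iff)
    then show "N (map_mat ?v y) = M y" using matrix_embeddingD(4)[OF u(1) n vy] by simp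
  qed
  moreover have "?v ` Y = X" unfolding u(2)[symmetric] using vu by (simp add: image_image)
  ultimately show ?thesis using completely_isometric_iff_embedding_onto[OF Y X] by blast
qed

text \<open>A list codes the Gaussian rational entries of a finite sequence of scalar matrices.\<close>

definition rcoef :: "(rat \<times> rat) list \<Rightarrow> nat \<Rightarrow> nat \<Rightarrow> nat \<Rightarrow> complex"
  where "rcoef L i k l = (let p = prod_encode (i, prod_encode (k, l)) in
    if p < length L then Complex (of_rat (fst (L ! p))) (of_rat (snd (L ! p))) else 0)"

lemma rcoef_gaussian: "rcoef L i k l \<in> gaussian_rationals"
  by (simp add: rcoef_def gaussian_rationals_def Let_def)

text \<open>The finitely many index triples have codes below some bound \<open>B\<close>, so a list
  of length \<open>B\<close> can hold arbitrary rational entries at these positions;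
  \<open>h\<close> decodes a position back to its triple.\<close>

lemma rcoef_exists:
  fixes g :: "nat \<Rightarrow> nat \<Rightarrow> nat \<Rightarrow> rat \<times> rat"
  shows "\<exists>L. \<forall>i<d. \<forall>k<n. \<forall>l<n'. rcoef L i k l = Complex (of_rat (fst (g i k l))) (of_rat (snd (g i k l)))"
proof -
  let ?S = "(\<lambda>(i, k, l). prod_encode (i, prod_encode (k, l))) ` ({..<d} \<times> {..<n} \<times> {..<n'})"
  have "finite ?S" by simp
  then obtain B where B: "\<And>p. p \<in> ?S \<Longrightarrow> p < B" using finite_nat_set_iff_bounded by metis
  define h where "h p = g (fst (prod_decode p)) (fst (prod_decode (snd (prod_decode p)))) (snd (prod_decode (snd (prod_decode p))))" for p
  have "rcoef (map h [0..<B]) i k l = Complex (of_rat (fst (g i k l))) (of_rat (snd (g i k l)))"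
    if "i < d" "k < n" "l < n'" for i k l
  proof -
    have "prod_encode (i, prod_encode (k, l)) \<in> ?S" using that by force
    then have "prod_encode (i, prod_encode (k, l)) < B" by (rule B)
    then show ?thesis by (simp add: rcoef_def h_def Let_def)
  qed
  then show ?thesis by blast
qed

text \<open>Real and imaginary parts are approximated by rationals within
  \<open>1 / (m + 1)\<close>. The bounds \<open>n\<close> and \<open>n'\<close> are separate because
  lists also code rectangular arrays: later \<open>rcoef Q i k 0\<close> is the coefficient of the
  \<open>k\<close>-th vector in the \<open>i\<close>-th combination.\<close>

lemma rcoef_tendsto:
  fixes A :: "nat \<Rightarrow> nat \<Rightarrow> nat \<Rightarrow> complex"
  shows "\<exists>L. \<forall>i<d. \<forall>k<n. \<forall>l<n'. (\<lambda>m. rcoef (L m) i k l) \<longlonglongrightarrow> A i k l"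
proof -
  have rat: "\<exists>q. \<bar>real_of_rat q - x\<bar> < 1 / real (Suc m)" for x m
  proof -
    have "x < x + 1 / real (Suc m)" by simp
    from of_rat_dense[OF this] obtain q where "x < real_of_rat q" "real_of_rat q < x + 1 / real (Suc m)" by blast
    then show ?thesis by (intro exI[of _ q]) arith
  qed
  have "\<exists>q. \<forall>x m. \<bar>real_of_rat (q x m) - x\<bar> < 1 / real (Suc m)"
    using rat by (intro choice allI) simp
  then obtain q where q: "\<And>x m. \<bar>real_of_rat (q x m) - x\<bar> < 1 / real (Suc m)" by blast
  have lim: "(\<lambda>m. real_of_rat (q x m)) \<longlonglongrightarrow> x" for x
  proof -
    have "(\<lambda>m. real_of_rat (q x m) - x) \<longlonglongrightarrow> 0"
      by (rule Lim_null_comparison[OF always_eventually LIMSEQ_Suc[OF lim_1_over_n]])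
        (use less_imp_le[OF q] in \<open>simp only: real_norm_def simp_thms\<close>)
    then show ?thesis by (rule LIM_zero_cancel)
  qed
  have "\<exists>L. \<forall>i<d. \<forall>k<n. \<forall>l<n'. rcoef L i k l
      = Complex (of_rat (q (Re (A i k l)) m)) (of_rat (q (Im (A i k l)) m))" for m
    using rcoef_exists[of d n n' "\<lambda>i k l. (q (Re (A i k l)) m, q (Im (A i k l)) m)"] by simp
  then obtain L where L: "\<And>m i k l. i < d \<Longrightarrow> k < n \<Longrightarrow> l < n' \<Longrightarrow>
      rcoef (L m) i k l = Complex (of_rat (q (Re (A i k l)) m)) (of_rat (q (Im (A i k l)) m))"
    by metis
  have "(\<lambda>m. rcoef (L m) i k l) \<longlonglongrightarrow> A i k l" if "i < d" "k < n" "l < n'" for i k l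
    unfolding L[OF that] using tendsto_Complex[OF lim[of "Re (A i k l)"] lim[of "Im (A i k l)"]] by simp
  then show ?thesis by blast
qed

text \<open>\<open>comb n d A x\<close> is \<open>\<Sum>\<^sub>i A\<^sub>i \<otimes> x\<^sub>i\<close>.\<close>

definition comb :: "nat \<Rightarrow> nat \<Rightarrow> (nat \<Rightarrow> nat \<Rightarrow> nat \<Rightarrow> complex) \<Rightarrow> (nat \<Rightarrow> 'a::complex_vector) \<Rightarrow> 'a mat"
  where "comb n d A x = mat n n (\<lambda>p. \<Sum>i<d. A i (fst p) (snd p) *\<^sub>C x i)"

text \<open>The finite, approximate form of embeddability: finitely many norms with Gaussian
  rational coefficients are to be matched at once. A pair \<open>(n, L)\<close> holds a size and a
  coefficient list; pairs of size 0 impose nothing.\<close>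

definition locally_embeds ::
    "'a::complex_vector set \<Rightarrow> ('a mat \<Rightarrow> real) \<Rightarrow> 'b::complex_vector set \<Rightarrow> ('b mat \<Rightarrow> real) \<Rightarrow> bool"
  where "locally_embeds X N Y M \<longleftrightarrow> (\<forall>d b F \<epsilon>. (\<forall>i<d. b i \<in> X) \<and> finite F \<and> \<epsilon> > 0 \<longrightarrow>
    (\<exists>y. (\<forall>i<d. y i \<in> Y) \<and> (\<forall>n L. n \<ge> 1 \<and> (n, L) \<in> F \<longrightarrow>
      \<bar>M (comb n d (rcoef L) y) - N (comb n d (rcoef L) b)\<bar> < \<epsilon>)))"

text \<open>Rewrites a combination of vectors \<open>x i\<close> over fixed vectors
  \<open>c j\<close>, with the varying data moved into the scalars. This is the form to which
  \<open>norm_tendsto\<close> applies.\<close>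

lemma comb_expand:
  assumes "\<And>i. i < d \<Longrightarrow> x i = (\<Sum>j<e. z i j *\<^sub>C c j)"
  shows "comb n d A x = mat n n (\<lambda>p. \<Sum>j<(e::nat). (\<Sum>i<d. A i (fst p) (snd p) * z i j) *\<^sub>C c j)"
proof -
  have "(\<Sum>i<d. A i k l *\<^sub>C x i) = (\<Sum>j<e. (\<Sum>i<d. A i k l * z i j) *\<^sub>C c j)" for k l
  proof -
    have "(\<Sum>i<d. A i k l *\<^sub>C x i) = (\<Sum>i<d. \<Sum>j<e. (A i k l * z i j) *\<^sub>C c j)"
      by (intro sum.cong refl) (simp add: assms complex_vector.scale_sum_right)
    also have "\<dots> = (\<Sum>j<e. \<Sum>i<d. (A i k l * z i j) *\<^sub>C c j)" by (rule sum.swap)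
    finally show ?thesis by (simp add: complex_vector.scale_sum_left)
  qed
  then show ?thesis by (simp add: comb_def)
qed

text \<open>Unit coefficients recover a single vector, so conditions on combinations also control
  the norm of each \<open>x i\<close>.\<close>

lemma comb_single:
  assumes A: "\<And>i'. i' < d \<Longrightarrow> A i' 0 0 = (if i' = i then 1 else 0)" and "i < d"
  shows "comb 1 d A x = mat 1 1 (\<lambda>_. x i)"
proof (rule eq_matI)
  fix k l assume "k < dim_row (mat 1 1 (\<lambda>_. x i))" "l < dim_col (mat 1 1 (\<lambda>_. x i))"
  then have "k = 0" "l = 0" by auto
  have "(\<Sum>i'<d. A i' 0 0 *\<^sub>C x i') = (\<Sum>i'<d. if i' = i then x i' else 0)"
    by (intro sum.cong) (auto simp: A)
  then show "comb 1 d A x $$ (k, l) = mat 1 1 (\<lambda>_. x i) $$ (k, l)"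
    using \<open>i < d\<close> \<open>k = 0\<close> \<open>l = 0\<close> by (simp add: comb_def)
qed (auto simp: comb_def)

lemma (in matrix_norm_on) comb_mats: "(\<And>i. i < d \<Longrightarrow> x i \<in> X) \<Longrightarrow> comb n d A x \<in> mats n X"
  unfolding comb_def by (intro mat_mats sum_in scale_in) auto

text \<open>Carries equalities of norms from Gaussian rational to arbitrary complex
  coefficients.\<close>

lemma (in matrix_norm_on) norm_comb_rcoef_tendsto:
  assumes n: "n \<ge> 1" and x: "\<And>i. i < d \<Longrightarrow> x i \<in> X"
    and L: "\<forall>i<d. \<forall>k<n. \<forall>l<n. (\<lambda>m. rcoef (L m) i k l) \<longlonglongrightarrow> A i k l"
  shows "(\<lambda>m. N (comb n d (rcoef (L m)) x)) \<longlonglongrightarrow> N (comb n d A x)"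
  unfolding comb_def
  by (rule norm_tendsto[where W = "\<lambda>m p i. rcoef (L m) i (fst p) (snd p)" and w = "\<lambda>p i. A i (fst p) (snd p)"])
    (use n x L in auto)

section \<open>From approximate solutions to an exact embedding\<close>

text \<open>Approximate solutions \<open>y m\<close> for growing finite sets of conditions have
  bounded coefficients in a basis of \<open>Y\<close>. A subsequence of the coefficients converges
  and yields a tuple \<open>v\<close> satisfying every condition exactly, first for rational and
  then for all coefficients. Sending each \<open>b i\<close> to \<open>v i\<close> then defines the
  embedding.\<close>

lemma embedding_if_locally_embeds:
  fixes X :: "'a::complex_vector set" and Y :: "'b::complex_vector set"
  assumes "matrix_norm_on X N" "matrix_norm_on Y M" "finitely_generated X" "finitely_generated Y"
    and loc: "locally_embeds X N Y M"
  shows "\<exists>u. matrix_embedding X N Y M u"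
proof -
  interpret X: matrix_norm_on X N by fact
  interpret Y: matrix_norm_on Y M by fact
  obtain b :: "nat \<Rightarrow> 'a" and d :: nat where b: "\<And>i. b i \<in> X" "\<And>x. x \<in> X \<Longrightarrow> \<exists>z. x = (\<Sum>i<d. z i *\<^sub>C b i)"
    by (rule finitely_generated_basis[OF assms(3)]) (rule that)
  obtain c :: "nat \<Rightarrow> 'b" and e :: nat where c: "\<And>j. c j \<in> Y" "\<And>x. x \<in> Y \<Longrightarrow> \<exists>z. x = (\<Sum>j<e. z j *\<^sub>C c j)"
    "\<And>z. (\<Sum>j<e. z j *\<^sub>C c j) = 0 \<Longrightarrow> \<forall>j<e. z j = 0"
    by (rule finitely_generated_basis[OF assms(4)]) (rule that)
  obtain K where K: "K \<ge> 0" "\<And>z j. j < e \<Longrightarrow> cmod (z j) \<le> K * M (mat 1 1 (\<lambda>_. \<Sum>j<e. z j *\<^sub>C c j))"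
    using Y.coefficient_bound[of c e, OF c(1,3)] by blast
  \<comment> \<open>\<open>Lu i\<close> lists the \<open>i\<close>-th unit coefficients of size
    1.\<close>
  have "\<forall>i. \<exists>L. \<forall>i'<d. rcoef L i' 0 0 = (if i' = i then 1 else 0)"
  proof
    fix i
    show "\<exists>L. \<forall>i'<d. rcoef L i' 0 0 = (if i' = i then 1 else 0)"
      using rcoef_exists[of d 1 1 "\<lambda>i' _ _. (if i' = i then 1 else 0, 0)"]
      by (elim exE) (rule exI, auto simp: complex_eq_iff)
  qed
  then obtain Lu where Lu: "\<And>i i'. i' < d \<Longrightarrow> rcoef (Lu i) i' 0 0 = (if i' = i then 1 else 0)"
    by metis
  \<comment> \<open>The enumeration by \<open>from_nat\<close> exhausts all conditions as
    \<open>m\<close> grows. The conditions \<open>Lu i\<close> are in every \<open>F m\<close>, so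
    the approximants are bounded from the start.\<close>
  define F :: "nat \<Rightarrow> (nat \<times> (rat \<times> rat) list) set" where "F m = from_nat ` {..m} \<union> (\<lambda>i. (1, Lu i)) ` {..<d}" for m
  have "\<exists>y. (\<forall>i<d. y i \<in> Y) \<and> (\<forall>n L. n \<ge> 1 \<and> (n, L) \<in> F m \<longrightarrow>
      \<bar>M (comb n d (rcoef L) y) - N (comb n d (rcoef L) b)\<bar> < 1 / real (Suc m))" for m
    by (rule loc[unfolded locally_embeds_def, rule_format]) (simp add: b(1) F_def)
  then obtain y where y: "\<And>m i. i < d \<Longrightarrow> y m i \<in> Y" "\<And>m n L. n \<ge> 1 \<Longrightarrow> (n, L) \<in> F m \<Longrightarrow>
      \<bar>M (comb n d (rcoef L) (y m)) - N (comb n d (rcoef L) b)\<bar> < 1 / real (Suc m)"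
    by metis
  define z where "z m i = (SOME a. y m i = (\<Sum>j<e. a j *\<^sub>C c j))" for m i
  have z: "y m i = (\<Sum>j<e. z m i j *\<^sub>C c j)" if "i < d" for m i
    unfolding z_def by (rule someI_ex[OF c(2)[OF y(1)[OF that]]])
  have comb_y: "comb n d A (y m) = mat n n (\<lambda>p. \<Sum>j<e. (\<Sum>i<d. A i (fst p) (snd p) * z m i j) *\<^sub>C c j)" for n m A
    by (rule comb_expand) (rule z)
  \<comment> \<open>The error \<open>1 / (m + 1)\<close> is at most 1, so the norm of
    \<open>y m i\<close> exceeds that of \<open>b i\<close> by at most 1; \<open>K\<close> turns
    norm bounds into coefficient bounds. Inserting 0 covers \<open>d = 0\<close> and makes
    \<open>R\<close> nonnegative.\<close>
  define R where "R = K * (Max (insert 0 ((\<lambda>i. N (mat 1 1 (\<lambda>_. b i))) ` {..<d})) + 1)"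
  have bound: "cmod (z m i j) \<le> R" if "i < d" "j < e" for m i j
  proof -
    have "(1, Lu i) \<in> F m" using that by (simp add: F_def)
    from y(2)[OF order.refl this] have "\<bar>M (mat 1 1 (\<lambda>_. y m i)) - N (mat 1 1 (\<lambda>_. b i))\<bar> < 1 / real (Suc m)"
      by (simp only: comb_single[of d "rcoef (Lu i)" i, OF Lu that(1)])
    also have "\<dots> \<le> 1" by simp
    finally have "M (mat 1 1 (\<lambda>_. y m i)) \<le> N (mat 1 1 (\<lambda>_. b i)) + 1" by linarith
    also have "N (mat 1 1 (\<lambda>_. b i)) \<le> Max (insert 0 ((\<lambda>i. N (mat 1 1 (\<lambda>_. b i))) ` {..<d}))"
      using that by (intro Max_ge) auto
    finally have "K * M (mat 1 1 (\<lambda>_. y m i)) \<le> R"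
      unfolding R_def by (intro mult_left_mono K(1)) simp
    then show ?thesis using K(2)[OF that(2), of "z m i"] z[OF that(1), of m] by simp
  qed
  have R0: "0 \<le> R" unfolding R_def using K(1) by (intro mult_nonneg_nonneg add_nonneg_nonneg Max_ge) auto
  \<comment> \<open>Extension by 0 gives a bounded family over the countable type of all index
    pairs.\<close>
  define z' where "z' m p = (if fst p < d \<and> snd p < e then z m (fst p) (snd p) else 0)" for m and p :: "nat \<times> nat"
  have "cmod (z' m p) \<le> R" for m p
    using bound R0 by (simp add: z'_def)
  then obtain r w where r: "strict_mono (r :: nat \<Rightarrow> nat)" and w': "\<And>p. (\<lambda>m. z' (r m) p) \<longlonglongrightarrow> w p"
    by (rule bounded_family_convergent_subseq[of z' R]) (rule that)
  have w: "(\<lambda>m. z (r m) i j) \<longlonglongrightarrow> w (i, j)" if "i < d" "j < e" for i j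
    using w'[of "(i, j)"] that by (simp add: z'_def)
  define v where "v i = (\<Sum>j<e. w (i, j) *\<^sub>C c j)" for i
  have v: "v i \<in> Y" for i unfolding v_def by (intro Y.sum_in Y.scale_in c(1))
  have rat_eq: "M (comb n d (rcoef L) v) = N (comb n d (rcoef L) b)" if n: "n \<ge> 1" for n L
  proof -
    have "(\<lambda>m. M (comb n d (rcoef L) (y (r m)))) \<longlonglongrightarrow> M (comb n d (rcoef L) v)"
    proof -
      have "(\<lambda>m. M (mat n n (\<lambda>p. \<Sum>j<e. (\<Sum>i<d. rcoef L i (fst p) (snd p) * z (r m) i j) *\<^sub>C c j)))
          \<longlonglongrightarrow> M (mat n n (\<lambda>p. \<Sum>j<e. (\<Sum>i<d. rcoef L i (fst p) (snd p) * w (i, j)) *\<^sub>C c j))"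
        by (rule Y.norm_tendsto[OF n finite_lessThan c(1)]) (auto intro!: tendsto_sum tendsto_mult tendsto_const w)
      then show ?thesis
        unfolding comb_expand[where x = v and z = "\<lambda>i j. w (i, j)", OF v_def] comb_y .
    qed
    moreover have "(\<lambda>m. M (comb n d (rcoef L) (y (r m)))) \<longlonglongrightarrow> N (comb n d (rcoef L) b)"
    proof -
      have lim: "(\<lambda>m. 1 / real (Suc (r m))) \<longlonglongrightarrow> 0"
        using LIMSEQ_subseq_LIMSEQ[OF LIMSEQ_Suc[OF lim_1_over_n] r] by (simp only: o_def)
      have "\<forall>\<^sub>F m in sequentially. norm (M (comb n d (rcoef L) (y (r m))) - N (comb n d (rcoef L) b)) \<le> 1 / real (Suc (r m))"
        unfolding eventually_sequentially real_norm_def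
      proof (intro exI allI impI)
        \<comment> \<open>Since \<open>r m \<ge> m\<close>, the condition \<open>(n, L)\<close>
          belongs to \<open>F (r m)\<close> from its own code number on.\<close>
        fix m assume "to_nat (n, L) \<le> m"
        then have "to_nat (n, L) \<le> r m" using seq_suble[OF r, of m] by linarith
        then have "from_nat (to_nat (n, L)) \<in> F (r m)" unfolding F_def by blast
        then show "\<bar>M (comb n d (rcoef L) (y (r m))) - N (comb n d (rcoef L) b)\<bar> \<le> 1 / real (Suc (r m))"
          using y(2)[OF n] by (simp only: from_nat_to_nat less_imp_le)
      qed
      then have "(\<lambda>m. M (comb n d (rcoef L) (y (r m))) - N (comb n d (rcoef L) b)) \<longlonglongrightarrow> 0"
        using lim by (rule Lim_null_comparison)
      then show ?thesis by (rule LIM_zero_cancel)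
    qed
    ultimately show ?thesis by (rule LIMSEQ_unique)
  qed
  have eq: "M (comb n d A v) = N (comb n d A b)" if n: "n \<ge> 1" for n A
  proof -
    obtain L where L: "\<forall>i<d. \<forall>k<n. \<forall>l<n. (\<lambda>m. rcoef (L m) i k l) \<longlonglongrightarrow> A i k l"
      using rcoef_tendsto[of d n n A] by blast
    from Y.norm_comb_rcoef_tendsto[where x = v, OF n v L] have "(\<lambda>m. N (comb n d (rcoef (L m)) b)) \<longlonglongrightarrow> M (comb n d A v)"
      by (simp only: rat_eq[OF n])
    then show ?thesis using X.norm_comb_rcoef_tendsto[where x = b, OF n b(1) L] by (rule LIMSEQ_unique)
  qed
  obtain coef where coef: "\<And>x. x \<in> X \<Longrightarrow> x = (\<Sum>i<d. coef x i *\<^sub>C b i)"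
    using b(2) by metis
  define u where "u x = (\<Sum>i<d. coef x i *\<^sub>C v i)" for x
  \<comment> \<open>\<open>coef\<close> is a mere choice, so linearity of \<open>u\<close> has to
    come from here: a relation between the \<open>b i\<close> gives a combination of norm 0, and the
    same combination of the \<open>v i\<close> has the same norm.\<close>
  have zeroI: "(\<Sum>i<d. a i *\<^sub>C v i) = 0" if "(\<Sum>i<d. a i *\<^sub>C b i) = 0" for a
  proof -
    have "comb 1 d (\<lambda>i _ _. a i) b = 0\<^sub>m 1 1" by (rule eq_matI) (simp_all add: comb_def that)
    then have "M (comb 1 d (\<lambda>i _ _. a i) v) = 0" using eq[of 1 "\<lambda>i _ _. a i"] X.norm_zero[of 1] by simp
    then have "comb 1 d (\<lambda>i _ _. a i) v = 0\<^sub>m 1 1"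
      using Y.definite[OF order.refl Y.comb_mats[OF v]] by simp
    then have "comb 1 d (\<lambda>i _ _. a i) v $$ (0, 0) = 0" by simp
    then show ?thesis by (simp add: comb_def)
  qed
  have "matrix_embedding X N Y M u"
    unfolding matrix_embedding_def
  proof (intro conjI ballI allI impI)
    show "u ` X \<subseteq> Y" unfolding u_def by (intro image_subsetI Y.sum_in Y.scale_in v)
    show "u (x + y) = u x + u y" if x: "x \<in> X" and y: "y \<in> X" for x y
    proof -
      have "(\<Sum>i<d. (coef (x + y) i - (coef x i + coef y i)) *\<^sub>C b i) = (x + y) - (x + y)"
        unfolding complex_vector.scale_left_diff_distrib scaleC_add_left sum_subtractf sum.distrib
        by (simp only: coef[OF x, symmetric] coef[OF y, symmetric] coef[OF X.add_in[OF x y], symmetric])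
      then have "(\<Sum>i<d. (coef (x + y) i - (coef x i + coef y i)) *\<^sub>C v i) = 0" by (intro zeroI) simp
      then show ?thesis
        by (simp add: u_def complex_vector.scale_left_diff_distrib scaleC_add_left sum_subtractf sum.distrib)
    qed
    show "u (q *\<^sub>C x) = q *\<^sub>C u x" if x: "x \<in> X" for q x
    proof -
      have "(\<Sum>i<d. (coef (q *\<^sub>C x) i - q * coef x i) *\<^sub>C b i) = q *\<^sub>C x - q *\<^sub>C x"
        unfolding complex_vector.scale_left_diff_distrib sum_subtractf scaleC_scaleC[symmetric]
          complex_vector.scale_sum_right[symmetric]
        by (simp only: coef[OF x, symmetric] coef[OF X.scale_in[OF x], symmetric])
      then have "(\<Sum>i<d. (coef (q *\<^sub>C x) i - q * coef x i) *\<^sub>C v i) = 0" by (intro zeroI) simp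
      then show ?thesis
        by (simp add: u_def complex_vector.scale_left_diff_distrib sum_subtractf complex_vector.scale_sum_right scaleC_scaleC)
    qed
    fix n :: nat and x assume n: "n \<ge> 1" and x: "x \<in> mats n X"
    \<comment> \<open>Expanding the entries of \<open>x\<close> in the \<open>b i\<close> turns
      \<open>x\<close> into a combination with scalar coefficient matrices, to which
      \<open>eq\<close> applies.\<close>
    have "comb n d (\<lambda>i k l. coef (x $$ (k, l)) i) b = x"
      by (rule eq_matI) (use x in \<open>auto simp: comb_def mats_iff coef[symmetric]\<close>)
    moreover have "comb n d (\<lambda>i k l. coef (x $$ (k, l)) i) v = map_mat u x"
      by (rule eq_matI) (use mats_carrier[OF x] in \<open>auto simp: comb_def u_def\<close>)
    ultimately show "M (map_mat u x) = N x" using eq[OF n, of "\<lambda>i k l. coef (x $$ (k, l)) i"] by simp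
  qed
  then show ?thesis by blast
qed

theorem completely_isometric_if_locally_embeds:
  assumes "matrix_norm_on X N" "matrix_norm_on Y M" "finitely_generated X" "finitely_generated Y"
    and "locally_embeds X N Y M" "locally_embeds Y M X N"
  shows "completely_isometric X N Y M"
  using assms embedding_if_locally_embeds completely_isometric_if_mutual_embeddings by metis


section \<open>Sentences\<close>

lemma (in matrix_norm_on) eval_term_mats:
  assumes "has_sort t n" and "\<And>n i. n \<ge> 1 \<Longrightarrow> e n i \<in> mats n X"
  shows "n \<ge> 1 \<and> eval_term t e \<in> mats n X"
  using assms(1)
proof (induction rule: has_sort.induct)
  case (5 n t k a b)
  then show ?case
    by (auto simp: mats_iff mat_sandwich_def intro!: sum_in scale_in)
qed (simp_all add: assms(2) mats_zero mats_add mats_scale)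

lemma sum_embedding:
  assumes u: "matrix_embedding X N Y M u" and X: "csubspace X" and f: "\<And>i. i \<in> I \<Longrightarrow> f i \<in> X"
  shows "u (sum f I) = (\<Sum>i\<in>I. u (f i))"
  using f
proof (induction I rule: infinite_finite_induct)
  case (insert i I)
  then show ?case
    by (simp add: matrix_embeddingD(2)[OF u _ complex_vector.subspace_sum[OF X]])
qed (simp_all add: matrix_embedding_zero[OF u X])

text \<open>Terms are built from linear operations with scalar coefficients, and these commute with
  the entrywise application of a linear map.\<close>

lemma eval_term_embedding:
  assumes u: "matrix_embedding X N Y M u" and X: "matrix_norm_on X N"
    and "has_sort t n" and e: "\<And>n i. n \<ge> 1 \<Longrightarrow> e n i \<in> mats n X"
  shows "eval_term t (\<lambda>n i. map_mat u (e n i)) = map_mat u (eval_term t e)"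
  using assms(3)
proof (induction rule: has_sort.induct)
  interpret X: matrix_norm_on X N by fact
  {
    case (2 n)
    then show ?case by (auto simp: matrix_embedding_zero[OF u X.subspace] intro!: eq_matI)
  next
    case (3 s n t)
    have "eval_term s e \<in> mats n X" "eval_term t e \<in> mats n X"
      using X.eval_term_mats[OF 3(1)] X.eval_term_mats[OF 3(2)] e by blast+
    with 3 show ?case
      by (auto simp: mats_iff matrix_embeddingD(2)[OF u] intro!: eq_matI)
  next
    case (4 q t n)
    have "eval_term t e \<in> mats n X" using X.eval_term_mats[OF 4(2)] e by blast
    with 4 show ?case
      by (auto simp: mats_iff mat_scaleC_def matrix_embeddingD(3)[OF u] intro!: eq_matI)
  next
    case (5 n t k a b)
    have t: "eval_term t e \<in> mats k X" using X.eval_term_mats[OF 5(2)] e by blast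
    have "mat_sandwich a (map_mat u (eval_term t e)) b = map_mat u (mat_sandwich a (eval_term t e) b)"
    proof (rule eq_matI)
      fix i j assume "i < dim_row (map_mat u (mat_sandwich a (eval_term t e) b))"
        "j < dim_col (map_mat u (mat_sandwich a (eval_term t e) b))"
      then have ij: "i < dim_row a" "j < dim_col b" by (simp_all add: mat_sandwich_def)
      have entry: "eval_term t e $$ (l, m) \<in> X" if "l < k" "m < k" for l m
        using t that by (simp add: mats_iff)
      have dim: "dim_row (eval_term t e) = k" "dim_col (eval_term t e) = k" using t by (auto simp: mats_def)
      have "u (\<Sum>l<k. \<Sum>m<k. (a $$ (i, l) * b $$ (m, j)) *\<^sub>C eval_term t e $$ (l, m))
          = (\<Sum>l<k. u (\<Sum>m<k. (a $$ (i, l) * b $$ (m, j)) *\<^sub>C eval_term t e $$ (l, m)))"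
        by (rule sum_embedding[OF u X.subspace]) (auto intro!: X.sum_in X.scale_in entry)
      also have "\<dots> = (\<Sum>l<k. \<Sum>m<k. u ((a $$ (i, l) * b $$ (m, j)) *\<^sub>C eval_term t e $$ (l, m)))"
        by (intro sum.cong refl sum_embedding[OF u X.subspace]) (auto intro!: X.scale_in entry)
      also have "\<dots> = (\<Sum>l<k. \<Sum>m<k. (a $$ (i, l) * b $$ (m, j)) *\<^sub>C u (eval_term t e $$ (l, m)))"
        by (intro sum.cong refl matrix_embeddingD(3)[OF u] entry) auto
      finally show "mat_sandwich a (map_mat u (eval_term t e)) b $$ (i, j)
          = map_mat u (mat_sandwich a (eval_term t e) b) $$ (i, j)"
        using ij by (simp add: mat_sandwich_def dim)
    qed (simp_all add: mat_sandwich_def)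
    with 5 show ?case by simp
  }
qed simp

text \<open>An embedding onto \<open>Y\<close> maps each quantifier domain of \<open>X\<close> onto
  the corresponding one of \<open>Y\<close>, so suprema and infima are taken over the same values.
  Distances agree by linearity of \<open>u\<close>.\<close>

lemma eval_formula_isometry:
  assumes u: "matrix_embedding X N Y M u" "u ` X = Y" and X: "matrix_norm_on X N" and Y: "matrix_norm_on Y M"
  shows "wf_formula \<phi> \<Longrightarrow> (\<And>n i. n \<ge> 1 \<Longrightarrow> e n i \<in> mats n X) \<Longrightarrow>
    eval_formula Y M \<phi> (\<lambda>n i. map_mat u (e n i)) = eval_formula X N \<phi> e"
proof (induction \<phi> arbitrary: e)
  interpret X: matrix_norm_on X N by fact
  have dom: "quant_domain Y M n k = map_mat u ` quant_domain X N n k" if n: "n \<ge> 1" for n k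
  proof -
    have "\<exists>x\<in>mats n X. map_mat u x = y" if y: "y \<in> mats n Y" for y
    proof -
      have "map_mat (inv_into X u) y \<in> mats n X"
        using y u(2) by (auto simp: mats_iff intro!: inv_into_into)
      moreover have "map_mat u (map_mat (inv_into X u) y) = y"
        using y u(2) by (intro eq_matI) (auto simp: mats_iff f_inv_into_f)
      ultimately show ?thesis by blast
    qed
    moreover have "map_mat u x \<in> mats n Y" if "x \<in> mats n X" for x
      using that matrix_embeddingD(1)[OF u(1)] by (auto simp: mats_iff)
    ultimately show ?thesis
      using matrix_embeddingD(4)[OF u(1) n] by (fastforce simp: quant_domain_def)
  qed
  have upd: "(\<lambda>m j. map_mat u ((e(n := (e n)(i := x))) m j))
      = (\<lambda>m j. map_mat u (e m j))(n := ((\<lambda>m j. map_mat u (e m j)) n)(i := map_mat u x))" for e :: "'a assignment" and n i x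
    by (rule ext)+ simp
  have mats_upd: "(e(n := (e n)(i := x))) m j \<in> mats m X"
    if "\<And>n i. n \<ge> 1 \<Longrightarrow> e n i \<in> mats n X" "x \<in> quant_domain X N n k" "m \<ge> 1" for e :: "'a assignment" and n i x m j k
    using that by (auto simp: quant_domain_def)
  {
    case (FDist s t)
    then obtain n where n: "has_sort s n" "has_sort t n" by auto
    have st: "n \<ge> 1" "eval_term s e \<in> mats n X" "eval_term t e \<in> mats n X"
      using X.eval_term_mats[OF n(1)] X.eval_term_mats[OF n(2)] FDist(2) by blast+
    have "map_mat u (eval_term s e) - map_mat u (eval_term t e) = map_mat u (eval_term s e - eval_term t e)"
      using st(2,3) by (intro eq_matI) (auto simp: mats_iff matrix_embedding_diff[OF u(1) X.subspace])
    then show ?case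
      using matrix_embeddingD(4)[OF u(1) st(1) X.mats_diff[OF st(2,3)]]
      by (simp add: eval_term_embedding[OF u(1) X n(1)] eval_term_embedding[OF u(1) X n(2)] FDist(2))
  next
    case (FConn f \<phi>s)
    have "eval_formula Y M (\<phi>s ! j) (\<lambda>n i. map_mat u (e n i)) = eval_formula X N (\<phi>s ! j) e" if "j < length \<phi>s" for j
      using FConn that by (simp add: list_all_length)
    then show ?case by (simp cong: restrict_cong)
  next
    case (FSup n k i \<phi>)
    have n: "n \<ge> 1" and wf: "wf_formula \<phi>" using FSup(2) by auto
    have "eval_formula Y M \<phi> (\<lambda>m j. map_mat u ((e(n := (e n)(i := x))) m j)) = eval_formula X N \<phi> (e(n := (e n)(i := x)))"
      if "x \<in> quant_domain X N n k" for x
      by (rule FSup.IH[OF wf]) (rule mats_upd[OF FSup(3) that])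
    then show ?case by (simp only: eval_formula.simps dom[OF n] image_image upd cong: image_cong)
  next
    case (FInf n k i \<phi>)
    have n: "n \<ge> 1" and wf: "wf_formula \<phi>" using FInf(2) by auto
    have "eval_formula Y M \<phi> (\<lambda>m j. map_mat u ((e(n := (e n)(i := x))) m j)) = eval_formula X N \<phi> (e(n := (e n)(i := x)))"
      if "x \<in> quant_domain X N n k" for x
      by (rule FInf.IH[OF wf]) (rule mats_upd[OF FInf(3) that])
    then show ?case by (simp only: eval_formula.simps dom[OF n] image_image upd cong: image_cong)
  }
qed

lemma sentence_value_eq_if_completely_isometric:
  assumes X: "matrix_norm_on X N" and Y: "matrix_norm_on Y M" and ci: "completely_isometric X N Y M"
    and \<phi>: "wf_formula \<phi>"
  shows "sentence_value X N \<phi> = sentence_value Y M \<phi>"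
proof -
  interpret X: matrix_norm_on X N by fact
  obtain u where u: "matrix_embedding X N Y M u" "u ` X = Y"
    using ci completely_isometric_iff_embedding_onto[OF X Y] by blast
  have "map_mat u (0\<^sub>m n n) = 0\<^sub>m n n" for n
    by (rule eq_matI) (simp_all add: matrix_embedding_zero[OF u(1) X.subspace])
  then show ?thesis
    using eval_formula_isometry[OF u X Y \<phi>, of "\<lambda>n i. 0\<^sub>m n n"] X.mats_zero by (simp add: sentence_value_def)
qed

text \<open>
  A term for \<^term>\<open>comb n d (rcoef L) x\<close>: the \<open>k\<close>-th row of \<open>A\<^sub>i \<otimes> x\<^sub>i\<close> is the sandwich of \<open>x\<^sub>i\<close>
  between the \<open>k\<close>-th unit column and the \<open>k\<close>-th row of \<open>A\<^sub>i\<close>.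
\<close>

definition comb_term :: "nat \<Rightarrow> nat \<Rightarrow> (rat \<times> rat) list \<Rightarrow> osp_term"
  where "comb_term n d L = foldr (\<lambda>(i, k). TAdd (TSandwich (mat n 1 (\<lambda>p. if fst p = k then 1 else 0))
    (TVar 1 i) (mat 1 n (\<lambda>p. rcoef L i k (snd p))))) (List.product [0..<d] [0..<n]) (TZero n)"

lemma has_sort_comb_term:
  assumes "n \<ge> 1"
  shows "has_sort (comb_term n d L) n"
proof -
  have "0 \<in> gaussian_rationals" "1 \<in> gaussian_rationals" by (simp_all add: gaussian_rationals_def)
  then have g: "elements_mat (mat n 1 (\<lambda>p. if fst p = k then 1 else 0)) \<subseteq> gaussian_rationals"
    "elements_mat (mat 1 n (\<lambda>p. rcoef L i k (snd p))) \<subseteq> gaussian_rationals" for i k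
    by (auto simp: elements_mat_def rcoef_gaussian)
  have "has_sort (foldr (\<lambda>(i, k). TAdd (TSandwich (mat n 1 (\<lambda>p. if fst p = k then 1 else 0))
    (TVar 1 i) (mat 1 n (\<lambda>p. rcoef L i k (snd p))))) ps (TZero n)) n" for ps
  proof (induction ps)
    case (Cons p ps)
    have "has_sort (TSandwich (mat n 1 (\<lambda>p. if fst p = k then 1 else 0)) (TVar 1 i) (mat 1 n (\<lambda>p. rcoef L i k (snd p)))) n" for i k
      using assms g by (intro has_sort.intros(5)[where k = 1] has_sort.intros(1)) simp_all
    with Cons show ?case by (auto simp: case_prod_beta intro: has_sort.intros(3))
  qed (use assms in \<open>auto intro: has_sort.intros\<close>)
  then show ?thesis by (simp only: comb_term_def)
qed

lemma term_vars_comb_term: "term_vars (comb_term n d L) \<subseteq> {1} \<times> {..<d}"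
proof -
  have *: "term_vars (foldr (\<lambda>(i, k). TAdd (TSandwich (mat n 1 (\<lambda>p. if fst p = k then 1 else 0))
    (TVar 1 i) (mat 1 n (\<lambda>p. rcoef L i k (snd p))))) ps (TZero n)) \<subseteq> {1} \<times> {..<d}"
    if "fst ` set ps \<subseteq> {..<d}" for ps
    using that by (induction ps) auto
  show ?thesis unfolding comb_term_def by (rule *) auto
qed

lemma eval_comb_term:
  assumes e: "\<And>i. i < d \<Longrightarrow> e 1 i \<in> carrier_mat 1 1"
  shows "eval_term (comb_term n d L) e = comb n d (rcoef L) (\<lambda>i. e 1 i $$ (0, 0))"
proof -
  \<comment> \<open>Generalized from the product list to any list of index pairs with first
    components below \<open>d\<close>, for induction on the list.\<close>
  have *: "eval_term (foldr (\<lambda>(i, k). TAdd (TSandwich (mat n 1 (\<lambda>p. if fst p = k then 1 else 0))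
      (TVar 1 i) (mat 1 n (\<lambda>p. rcoef L i k (snd p))))) ps (TZero n)) e
    = mat n n (\<lambda>p. \<Sum>(i, k)\<leftarrow>ps. (if fst p = k then rcoef L i k (snd p) else 0) *\<^sub>C e 1 i $$ (0, 0))"
    if "fst ` set ps \<subseteq> {..<d}" for ps
    using that
  proof (induction ps)
    case Nil
    then show ?case by (auto intro!: eq_matI)
  next
    case (Cons q ps)
    obtain i k where q: "q = (i, k)" by fastforce
    have "i < d" using Cons(2) q by simp
    with e have dim: "dim_row (e 1 i) = 1" "dim_col (e 1 i) = 1" by auto
    have "mat_sandwich (mat n 1 (\<lambda>p. if fst p = k then 1 else 0)) (e 1 i) (mat 1 n (\<lambda>p. rcoef L i k (snd p)))
      = mat n n (\<lambda>p. (if fst p = k then rcoef L i k (snd p) else 0) *\<^sub>C e 1 i $$ (0, 0))"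
      by (rule eq_matI) (simp_all add: mat_sandwich_def dim[simplified])
    then show ?case using Cons by (auto simp: q intro!: eq_matI)
  qed
  have "eval_term (comb_term n d L) e = mat n n (\<lambda>p. \<Sum>(i, k)\<leftarrow>List.product [0..<d] [0..<n].
      (if fst p = k then rcoef L i k (snd p) else 0) *\<^sub>C e 1 i $$ (0, 0))"
    unfolding comb_term_def by (rule *) auto
  also have "\<dots> = comb n d (rcoef L) (\<lambda>i. e 1 i $$ (0, 0))"
    unfolding comb_def
  proof (rule cong_mat[OF refl refl])
    fix r s assume rs: "r < n" "s < n"
    define p where "p = (r, s)"
    have "(\<Sum>(i, k)\<leftarrow>List.product [0..<d] [0..<n]. (if fst p = k then rcoef L i k (snd p) else 0) *\<^sub>C e 1 i $$ (0, 0))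
        = (\<Sum>(i, k)\<in>{..<d} \<times> {..<n}. (if fst p = k then rcoef L i k (snd p) else 0) *\<^sub>C e 1 i $$ (0, 0))"
      by (subst sum_list_distinct_conv_sum_set) (simp_all add: distinct_product atLeast0LessThan)
    also have "\<dots> = (\<Sum>i<d. \<Sum>k<n. if fst p = k then rcoef L i k (snd p) *\<^sub>C e 1 i $$ (0, 0) else 0)"
      by (subst sum.cartesian_product[symmetric]) (intro sum.cong refl, simp)
    also have "\<dots> = (\<Sum>i<d. rcoef L i (fst p) (snd p) *\<^sub>C e 1 i $$ (0, 0))" using rs by (simp add: p_def)
    finally show "(\<Sum>(i, k)\<leftarrow>List.product [0..<d] [0..<n]. (if fst (r, s) = k then rcoef L i k (snd (r, s)) else 0) *\<^sub>C e 1 i $$ (0, 0))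
        = (\<Sum>i<d. rcoef L i (fst (r, s)) (snd (r, s)) *\<^sub>C e 1 i $$ (0, 0))"
      unfolding p_def .
  qed
  finally show ?thesis .
qed

section \<open>Universal sentences expressing approximate solvability\<close>

primrec sup_upto :: "nat \<Rightarrow> nat \<Rightarrow> osp_formula \<Rightarrow> osp_formula"
  where
    "sup_upto k 0 \<phi> = \<phi>"
  | "sup_upto k (Suc d) \<phi> = FSup 1 k d (sup_upto k d \<phi>)"

lemma wf_sup_upto: "k \<ge> 1 \<Longrightarrow> wf_formula (sup_upto k d \<phi>) \<longleftrightarrow> wf_formula \<phi>"
  by (induction d) auto

lemma free_vars_sup_upto: "free_vars (sup_upto k d \<phi>) = free_vars \<phi> - {1} \<times> {..<d}"
  by (induction d) (auto simp: lessThan_Suc)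

lemma prenex_universal_sup_upto: "quantifier_free \<phi> \<Longrightarrow> prenex_universal (sup_upto k d \<phi>)"
  by (induction d) (auto intro: prenex_universal.intros)

context matrix_norm_on
begin

lemma quant_domain_nonempty: "quant_domain X N 1 k \<noteq> {}"
proof -
  have "0\<^sub>m 1 1 \<in> quant_domain X N 1 k" using mats_zero[of 1] norm_zero[of 1] by (simp add: quant_domain_def)
  then show ?thesis by blast
qed

text \<open>The upper bound 0 passes through every supremum because the domains contain the zero
  matrix. It also supplies the boundedness under which the real \<open>SUP\<close> is a true
  supremum.\<close>

lemma eval_sup_upto_nonpos:
  assumes "\<And>e. eval_formula X N \<phi> e \<le> 0"
  shows "eval_formula X N (sup_upto k d \<phi>) e \<le> 0"
proof (induction d arbitrary: e)
  case (Suc d)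
  show ?case unfolding sup_upto.simps eval_formula.simps
    by (rule cSUP_least[OF quant_domain_nonempty Suc])
qed (simp add: assms)

lemma eval_sup_upto_lower:
  assumes \<phi>: "\<And>e. eval_formula X N \<phi> e \<le> 0"
    and "\<And>i. i < d \<Longrightarrow> x i \<in> quant_domain X N 1 k"
  shows "eval_formula X N \<phi> (e(1 := \<lambda>i. if i < d then x i else e 1 i)) \<le> eval_formula X N (sup_upto k d \<phi>) e"
  using assms(2)
proof (induction d arbitrary: e)
  case (Suc d)
  \<comment> \<open>The outermost quantifier binds variable \<open>d\<close>; it receives
    \<open>x d\<close> before the induction hypothesis treats the inner ones.\<close>
  let ?e = "e(1 := (e 1)(d := x d))"
  have eq: "e(1 := \<lambda>i. if i < Suc d then x i else e 1 i) = ?e(1 := \<lambda>i. if i < d then x i else ?e 1 i)"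
    by (rule ext)+ (auto simp: less_Suc_eq)
  have "eval_formula X N \<phi> (e(1 := \<lambda>i. if i < Suc d then x i else e 1 i)) \<le> eval_formula X N (sup_upto k d \<phi>) ?e"
    unfolding eq by (rule Suc.IH) (rule Suc.prems, simp)
  also have "\<dots> \<le> eval_formula X N (sup_upto k (Suc d) \<phi>) e"
    unfolding sup_upto.simps eval_formula.simps
    by (rule cSUP_upper2[OF _ Suc.prems[OF lessI] order.refl])
      (intro bdd_aboveI2[where M = 0] eval_sup_upto_nonpos[OF \<phi>])
  finally show ?case .
qed simp

lemma eval_sup_upto_approx:
  assumes "\<delta> < eval_formula X N (sup_upto k d \<phi>) e" and \<phi>: "\<And>e. eval_formula X N \<phi> e \<le> 0"
  shows "\<exists>e'. (\<forall>i<d. e' 1 i \<in> quant_domain X N 1 k) \<and> \<delta> < eval_formula X N \<phi> e'"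
proof -
  \<comment> \<open>Strengthened: the variables from \<open>d\<close> on keep their values, so the
    witness for an outer quantifier survives the choice of the inner ones.\<close>
  have "\<exists>e'. (\<forall>i<d. e' 1 i \<in> quant_domain X N 1 k) \<and> (\<forall>i\<ge>d. e' 1 i = e 1 i) \<and> \<delta> < eval_formula X N \<phi> e'"
    using assms(1)
  proof (induction d arbitrary: e)
    case (Suc d)
    have "bdd_above ((\<lambda>x. eval_formula X N (sup_upto k d \<phi>) (e(1 := (e 1)(d := x)))) ` quant_domain X N 1 k)"
      by (intro bdd_aboveI2[where M = 0] eval_sup_upto_nonpos[OF \<phi>])
    then obtain x where x: "x \<in> quant_domain X N 1 k" "\<delta> < eval_formula X N (sup_upto k d \<phi>) (e(1 := (e 1)(d := x)))"
      using Suc.prems unfolding sup_upto.simps eval_formula.simps by (subst (asm) less_cSUP_iff[OF quant_domain_nonempty]) auto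
    from Suc.IH[OF x(2)] obtain e' where e': "\<forall>i<d. e' 1 i \<in> quant_domain X N 1 k"
      "\<forall>i\<ge>d. e' 1 i = (e(1 := (e 1)(d := x))) 1 i" "\<delta> < eval_formula X N \<phi> e'" by blast
    with x(1) show ?case by (intro exI[of _ e']) (auto simp: less_Suc_eq)
  qed auto
  then show ?thesis by blast
qed

end

text \<open>In \<open>X\<close> the tuple \<open>b\<close> shows that the supremum is at least 0,
  hence so it is in \<open>Y\<close>. A tuple in \<open>Y\<close> where the quantifier-free part
  exceeds \<open>-\<epsilon>\<close> has every absolute deviation below \<open>\<epsilon>\<close>,
  because these are nonnegative with sum below \<open>\<epsilon>\<close>.\<close>

lemma locally_embeds_if_sentence_values_eq:
  fixes X :: "'a::complex_vector set" and Y :: "'b::complex_vector set"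
  assumes X: "matrix_norm_on X N" and Y: "matrix_norm_on Y M"
    and eq: "\<And>\<phi>. osp_sentence \<phi> \<Longrightarrow> prenex_universal \<phi> \<Longrightarrow> sentence_value X N \<phi> = sentence_value Y M \<phi>"
  shows "locally_embeds X N Y M"
  unfolding locally_embeds_def
proof (intro allI impI)
  interpret X: matrix_norm_on X N by fact
  interpret Y: matrix_norm_on Y M by fact
  fix d :: nat and b :: "nat \<Rightarrow> 'a" and F :: "(nat \<times> (rat \<times> rat) list) set" and \<epsilon> :: real
  assume "(\<forall>i<d. b i \<in> X) \<and> finite F \<and> 0 < \<epsilon>"
  then have b: "\<And>i. i < d \<Longrightarrow> b i \<in> X" and "finite F" and \<epsilon>: "0 < \<epsilon>" by auto
  \<comment> \<open>Pairs of size 0 are dropped, since the formula may only contain terms of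
    positive sort.\<close>
  then obtain cs where cs: "set cs = {c \<in> F. fst c \<ge> 1}" using finite_list[of "{c \<in> F. fst c \<ge> 1}"] by auto
  let ?v = "\<lambda>c. N (comb (fst c) d (rcoef (snd c)) b)"
  \<comment> \<open>Connectives are arbitrary continuous functions, so the norms measured in
    \<open>X\<close> can be built in as real parameters.\<close>
  define f where "f v = - (\<Sum>j<length cs. \<bar>v j - ?v (cs ! j)\<bar>)" for v :: "nat \<Rightarrow> real"
  define \<phi> where "\<phi> = FConn f (map (\<lambda>c. FDist (comb_term (fst c) d (snd c)) (TZero (fst c))) cs)"
  \<comment> \<open>A quantifier radius whose ball contains all \<open>b i\<close>. Inserting 0
    covers \<open>d = 0\<close>, and the successor ensures \<open>k \<ge> 1\<close>.\<close>
  obtain k where k: "k \<ge> 1" "\<And>i. i < d \<Longrightarrow> N (mat 1 1 (\<lambda>_. b i)) \<le> real k"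
  proof -
    obtain k where "Max (insert 0 ((\<lambda>i. N (mat 1 1 (\<lambda>_. b i))) ` {..<d})) \<le> real k"
      using real_arch_simple by blast
    then have "N (mat 1 1 (\<lambda>_. b i)) \<le> real (Suc k)" if "i < d" for i
    proof -
      have "N (mat 1 1 (\<lambda>_. b i)) \<le> Max (insert 0 ((\<lambda>i. N (mat 1 1 (\<lambda>_. b i))) ` {..<d}))"
        using that by (intro Max_ge) auto
      then show ?thesis using \<open>Max _ \<le> real k\<close> unfolding of_nat_Suc by linarith
    qed
    then show ?thesis using that[of "Suc k"] by simp
  qed
  have "continuous_map (powertop_real {..<length cs}) euclideanreal f"
    unfolding f_def by (intro continuous_map_minus continuous_map_sum continuous_map_real_abs
        continuous_map_diff continuous_map_product_projection) auto
  then have "wf_formula \<phi>"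
    using cs by (auto simp: \<phi>_def list_all_iff intro!: exI has_sort_comb_term has_sort.intros(2))
  moreover have "free_vars \<phi> \<subseteq> {1} \<times> {..<d}"
    using term_vars_comb_term by (fastforce simp: \<phi>_def)
  ultimately have sentence: "osp_sentence (sup_upto k d \<phi>)"
    by (auto simp: osp_sentence_def wf_sup_upto[OF k(1)] free_vars_sup_upto)
  have "quantifier_free \<phi>" by (simp add: \<phi>_def list_all_iff)
  note eq' = eq[OF sentence prenex_universal_sup_upto[OF this], unfolded sentence_value_def]
  have f0: "f v \<le> 0" for v by (simp add: f_def sum_nonneg)
  have nonpos: "eval_formula X N \<phi> e \<le> 0" "eval_formula Y M \<phi> e' \<le> 0" for e e'
    by (simp_all add: \<phi>_def f0)
  have eval_X: "eval_formula X N \<phi> e = - (\<Sum>j<length cs. \<bar>N (comb (fst (cs ! j)) d (rcoef (snd (cs ! j))) (\<lambda>i. e 1 i $$ (0, 0))) - ?v (cs ! j)\<bar>)"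
    if e: "\<And>i. i < d \<Longrightarrow> e 1 i \<in> mats 1 X" for e
  proof -
    have "x - 0\<^sub>m n n = x" if "x \<in> mats n X" for x n
      using that by (auto simp: mats_def intro!: eq_matI)
    moreover have "comb n d (rcoef L) (\<lambda>i. e 1 i $$ (0, 0)) \<in> mats n X" for n L
      by (rule X.comb_mats) (use e in \<open>auto simp: mats_iff\<close>)
    ultimately show ?thesis
      by (simp add: \<phi>_def f_def eval_comb_term[of d e, OF mats_carrier[OF e]])
  qed
  have eval_Y: "eval_formula Y M \<phi> e = - (\<Sum>j<length cs. \<bar>M (comb (fst (cs ! j)) d (rcoef (snd (cs ! j))) (\<lambda>i. e 1 i $$ (0, 0))) - ?v (cs ! j)\<bar>)"
    if e: "\<And>i. i < d \<Longrightarrow> e 1 i \<in> mats 1 Y" for e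
  proof -
    have "x - 0\<^sub>m n n = x" if "x \<in> mats n Y" for x n
      using that by (auto simp: mats_def intro!: eq_matI)
    moreover have "comb n d (rcoef L) (\<lambda>i. e 1 i $$ (0, 0)) \<in> mats n Y" for n L
      by (rule Y.comb_mats) (use e in \<open>auto simp: mats_iff\<close>)
    ultimately show ?thesis
      by (simp add: \<phi>_def f_def eval_comb_term[of d e, OF mats_carrier[OF e]])
  qed
  have b_dom: "mat 1 1 (\<lambda>_. b i) \<in> quant_domain X N 1 k" if "i < d" for i
    unfolding quant_domain_def using k(2)[OF that] mat_mats[of 1 "\<lambda>_. b i" X] b[OF that] by simp
  \<comment> \<open>The assignment that \<open>eval_sup_upto_lower\<close> forms from the tuple
    \<open>b\<close>; all deviations vanish there.\<close>
  let ?e = "(\<lambda>n i. 0\<^sub>m n n)(1 := \<lambda>i. if i < d then mat 1 1 (\<lambda>_. b i) else 0\<^sub>m 1 1)"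
  have "comb n d A (\<lambda>i. ?e 1 i $$ (0, 0)) = comb n d A b" for n A
    unfolding comb_def by (intro cong_mat refl sum.cong) simp
  then have "eval_formula X N \<phi> ?e = 0"
    by (subst eval_X) (use b_dom in \<open>auto simp: quant_domain_def\<close>)
  then have "0 \<le> eval_formula Y M (sup_upto k d \<phi>) (\<lambda>n i. 0\<^sub>m n n)"
    using X.eval_sup_upto_lower[where d = d and x = "\<lambda>i. mat 1 1 (\<lambda>_. b i)" and e = "\<lambda>n i. 0\<^sub>m n n", OF nonpos(1) b_dom]
    unfolding eq' by (simp only:)
  with \<epsilon> have "- \<epsilon> < eval_formula Y M (sup_upto k d \<phi>) (\<lambda>n i. 0\<^sub>m n n)" by linarith
  then obtain e where e: "\<forall>i<d. e 1 i \<in> quant_domain Y M 1 k" "- \<epsilon> < eval_formula Y M \<phi> e"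
    using Y.eval_sup_upto_approx nonpos(2) by blast
  have e_mats: "e 1 i \<in> mats 1 Y" if "i < d" for i using e(1) that by (simp add: quant_domain_def)
  let ?y = "\<lambda>i. e 1 i $$ (0, 0)"
  have "\<bar>M (comb n d (rcoef L) ?y) - N (comb n d (rcoef L) b)\<bar> < \<epsilon>" if n: "n \<ge> 1" "(n, L) \<in> F" for n L
  proof -
    have "(n, L) \<in> set cs" using n cs by simp
    then obtain j where j: "j < length cs" "cs ! j = (n, L)" by (auto simp: in_set_conv_nth)
    have "\<bar>M (comb (fst (cs ! j)) d (rcoef (snd (cs ! j))) ?y) - ?v (cs ! j)\<bar>
        \<le> (\<Sum>j<length cs. \<bar>M (comb (fst (cs ! j)) d (rcoef (snd (cs ! j))) ?y) - ?v (cs ! j)\<bar>)"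
      by (rule member_le_sum[of j "{..<length cs}" "\<lambda>j. \<bar>M (comb (fst (cs ! j)) d (rcoef (snd (cs ! j))) ?y) - ?v (cs ! j)\<bar>"])
        (use j in auto)
    also have "\<dots> = - eval_formula Y M \<phi> e" by (subst eval_Y) (simp_all only: e_mats minus_minus)
    also have "\<dots> < \<epsilon>" using e(2) by linarith
    finally show ?thesis by (simp only: j fst_conv snd_conv)
  qed
  moreover have "?y i \<in> Y" if "i < d" for i using e_mats[OF that] by (simp add: mats_iff)
  ultimately show "\<exists>y. (\<forall>i<d. y i \<in> Y) \<and> (\<forall>n L. n \<ge> 1 \<and> (n, L) \<in> F \<longrightarrow>
      \<bar>M (comb n d (rcoef L) y) - N (comb n d (rcoef L) b)\<bar> < \<epsilon>)"
    by (intro exI[of _ ?y]) blast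
qed


section \<open>Smoothness\<close>

text \<open>Size, coefficient list, and strict lower and upper bound. The type is countable, so
  finite lists of conditions can be enumerated.\<close>

type_synonym norm_condition = "nat \<times> (rat \<times> rat) list \<times> rat \<times> rat"

definition satisfies :: "('a::complex_vector mat \<Rightarrow> real) \<Rightarrow> nat \<Rightarrow> norm_condition list \<Rightarrow> (nat \<Rightarrow> 'a) \<Rightarrow> bool"
  where "satisfies N d cs x \<longleftrightarrow> (\<forall>(n, L, \<alpha>, \<beta>)\<in>set cs. n \<ge> 1 \<longrightarrow>
    of_rat \<alpha> < N (comb n d (rcoef L) x) \<and> N (comb n d (rcoef L) x) < of_rat \<beta>)"

lemma satisfies_embedding:
  assumes u: "matrix_embedding X N Y M u" and X: "matrix_norm_on X N" and x: "\<And>i. i < d \<Longrightarrow> x i \<in> X"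
    and sat: "satisfies N d cs x"
  shows "satisfies M d cs (\<lambda>i. u (x i))"
proof -
  interpret X: matrix_norm_on X N by fact
  have "M (comb n d A (\<lambda>i. u (x i))) = N (comb n d A x)" if "n \<ge> 1" for n A
  proof -
    have "map_mat u (comb n d A x) = comb n d A (\<lambda>i. u (x i))"
    proof (rule eq_matI)
      fix k l assume "k < dim_row (comb n d A (\<lambda>i. u (x i)))" "l < dim_col (comb n d A (\<lambda>i. u (x i)))"
      then have kl: "k < n" "l < n" by (simp_all add: comb_def)
      have "u (\<Sum>i<d. A i k l *\<^sub>C x i) = (\<Sum>i<d. u (A i k l *\<^sub>C x i))"
        by (rule sum_embedding[OF u X.subspace]) (simp add: x X.scale_in)
      also have "\<dots> = (\<Sum>i<d. A i k l *\<^sub>C u (x i))"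
        by (intro sum.cong refl matrix_embeddingD(3)[OF u]) (simp add: x)
      finally show "map_mat u (comb n d A x) $$ (k, l) = comb n d A (\<lambda>i. u (x i)) $$ (k, l)"
        using kl by (simp add: comb_def)
    qed (simp_all add: comb_def)
    then have "M (comb n d A (\<lambda>i. u (x i))) = M (map_mat u (comb n d A x))" by (rule arg_cong[OF sym])
    also have "\<dots> = N (comb n d A x)" by (rule matrix_embeddingD(4)[OF u that X.comb_mats[OF x]])
    finally show ?thesis .
  qed
  with sat show ?thesis unfolding satisfies_def by fastforce
qed

text \<open>Each norm of a combination of \<open>b\<close> is enclosed strictly between two
  rationals closer to it than \<open>\<epsilon>\<close>. A tuple obeying the same bounds deviates by
  less than \<open>\<epsilon>\<close>.\<close>

lemma locally_embeds_if_satisfies: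
  fixes X :: "'a::complex_vector set" and Y :: "'b::complex_vector set"
  assumes "\<And>d cs x. (\<forall>i<d. x i \<in> X) \<and> satisfies N d cs x \<Longrightarrow> \<exists>y. (\<forall>i<d. y i \<in> Y) \<and> satisfies M d cs y"
  shows "locally_embeds X N Y M"
  unfolding locally_embeds_def
proof (intro allI impI)
  fix d :: nat and b :: "nat \<Rightarrow> 'a" and F :: "(nat \<times> (rat \<times> rat) list) set" and \<epsilon> :: real
  assume *: "(\<forall>i<d. b i \<in> X) \<and> finite F \<and> 0 < \<epsilon>"
  then obtain fs where fs: "set fs = F" using finite_list by blast
  let ?v = "\<lambda>c. N (comb (fst c) d (rcoef (snd c)) b)"
  have "\<exists>q. v - \<epsilon> < real_of_rat q \<and> real_of_rat q < v" for v
    using of_rat_dense[of "v - \<epsilon>" v] * by auto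
  then obtain lo where lo: "\<And>v. v - \<epsilon> < real_of_rat (lo v)" "\<And>v. real_of_rat (lo v) < v" by metis
  have "\<exists>q. v < real_of_rat q \<and> real_of_rat q < v + \<epsilon>" for v
    using of_rat_dense[of v "v + \<epsilon>"] * by auto
  then obtain up where up: "\<And>v. v < real_of_rat (up v)" "\<And>v. real_of_rat (up v) < v + \<epsilon>" by metis
  let ?cs = "map (\<lambda>c. (fst c, snd c, lo (?v c), up (?v c))) fs"
  have "satisfies N d ?cs b" by (auto simp: satisfies_def lo up)
  with * assms obtain y where y: "\<forall>i<d. y i \<in> Y" "satisfies M d ?cs y" by blast
  have "\<bar>M (comb n d (rcoef L) y) - N (comb n d (rcoef L) b)\<bar> < \<epsilon>" if "n \<ge> 1" "(n, L) \<in> F" for n L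
  proof -
    have "(n, L, lo (?v (n, L)), up (?v (n, L))) \<in> set ?cs" using that(2) fs by force
    then have "of_rat (lo (?v (n, L))) < M (comb n d (rcoef L) y)" "M (comb n d (rcoef L) y) < of_rat (up (?v (n, L)))"
      using y(2) that(1) unfolding satisfies_def by blast+
    then show ?thesis using lo(1)[of "?v (n, L)"] up(2)[of "?v (n, L)"] by (simp only: fst_conv snd_conv)
  qed
  with y(1) show "\<exists>y. (\<forall>i<d. y i \<in> Y) \<and> (\<forall>n L. n \<ge> 1 \<and> (n, L) \<in> F \<longrightarrow>
      \<bar>M (comb n d (rcoef L) y) - N (comb n d (rcoef L) b)\<bar> < \<epsilon>)" by blast
qed

text \<open>Stated for all large \<open>m\<close>, not just for one, so that finitely many vectors
  can share the same \<open>m\<close>.\<close>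

lemma span_range_eventually:
  fixes \<gamma> :: "nat \<Rightarrow> 'a::complex_vector"
  assumes "x \<in> cspan (range \<gamma>)"
  shows "\<forall>\<^sub>F m in sequentially. \<exists>a. x = (\<Sum>k<m. a k *\<^sub>C \<gamma> k)"
  using assms
proof (induction rule: complex_vector.span_induct_alt)
  case base
  have "0 = (\<Sum>k<m. 0 *\<^sub>C \<gamma> k)" for m by simp
  then show ?case by (intro always_eventually allI) (rule exI)
next
  case (step c x y)
  then obtain j where j: "x = \<gamma> j" by blast
  from step(2) eventually_gt_at_top[of j] show ?case
  proof eventually_elim
    case (elim m)
    then obtain a where a: "y = (\<Sum>k<m. a k *\<^sub>C \<gamma> k)" by blast
    have "(\<Sum>k<m. (if k = j then c else 0) *\<^sub>C \<gamma> k) = (\<Sum>k<m. if k = j then c *\<^sub>C \<gamma> k else 0)"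
      by (intro sum.cong) auto
    also have "\<dots> = c *\<^sub>C x" using elim(2) j by simp
    finally have "c *\<^sub>C x + y = (\<Sum>k<m. ((if k = j then c else 0) + a k) *\<^sub>C \<gamma> k)"
      by (simp only: a scaleC_add_left sum.distrib)
    then show ?case by (rule exI[of _ "\<lambda>k. (if k = j then c else 0) + a k"])
  qed
qed

text \<open>Strict bounds are open conditions, and each norm is continuous in the coefficients with
  respect to the \<open>\<gamma> k\<close>. So Gaussian rational coefficients suffice, which leaves
  countably many candidate tuples.\<close>

lemma satisfies_span_iff:
  fixes \<gamma> :: "nat \<Rightarrow> 'a::complex_vector"
  assumes X: "matrix_norm_on (cspan (range \<gamma>)) N"
  shows "(\<exists>x. (\<forall>i<d. x i \<in> cspan (range \<gamma>)) \<and> satisfies N d cs x) \<longleftrightarrow>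
    (\<exists>m Q. satisfies N d cs (\<lambda>i. \<Sum>k<m. rcoef Q i k 0 *\<^sub>C \<gamma> k))" (is "?lhs \<longleftrightarrow> ?rhs")
proof
  interpret X: matrix_norm_on "cspan (range \<gamma>)" N by fact
  have \<gamma>: "\<gamma> k \<in> cspan (range \<gamma>)" for k by (simp add: complex_vector.span_base)
  show ?lhs if ?rhs
  proof -
    from that obtain m Q where "satisfies N d cs (\<lambda>i. \<Sum>k<m. rcoef Q i k 0 *\<^sub>C \<gamma> k)" by blast
    moreover have "(\<Sum>k<m. rcoef Q i k 0 *\<^sub>C \<gamma> k) \<in> cspan (range \<gamma>)" for i
      by (intro X.sum_in X.scale_in \<gamma>)
    ultimately show ?thesis by (intro exI[of _ "\<lambda>i. \<Sum>k<m. rcoef Q i k 0 *\<^sub>C \<gamma> k"] conjI allI impI)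
  qed
  assume ?lhs
  then obtain x where x: "\<And>i. i < d \<Longrightarrow> x i \<in> cspan (range \<gamma>)" "satisfies N d cs x" by blast
  have "\<forall>\<^sub>F m in sequentially. \<forall>i\<in>{..<d}. \<exists>a. x i = (\<Sum>k<m. a k *\<^sub>C \<gamma> k)"
    by (intro eventually_ball_finite ballI span_range_eventually x(1)) auto
  then obtain m where "\<forall>i\<in>{..<d}. \<exists>a. x i = (\<Sum>k<m. a k *\<^sub>C \<gamma> k)"
    using eventually_happens'[OF sequentially_bot] by blast
  then obtain a where a: "\<And>i. i < d \<Longrightarrow> x i = (\<Sum>k<m. a i k *\<^sub>C \<gamma> k)" by (metis lessThan_iff)
  obtain Q where Q: "\<forall>i<d. \<forall>k<m. \<forall>l<1. (\<lambda>s. rcoef (Q s) i k l) \<longlonglongrightarrow> a i k"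
    using rcoef_tendsto[of d m 1 "\<lambda>i k _. a i k"] by blast
  let ?x = "\<lambda>s i. \<Sum>k<m. rcoef (Q s) i k 0 *\<^sub>C \<gamma> k"
  have lim: "(\<lambda>s. N (comb n d A (?x s))) \<longlonglongrightarrow> N (comb n d A x)" if n: "n \<ge> 1" for n A
  proof -
    have "(\<lambda>s. N (mat n n (\<lambda>p. \<Sum>k<m. (\<Sum>i<d. A i (fst p) (snd p) * rcoef (Q s) i k 0) *\<^sub>C \<gamma> k)))
        \<longlonglongrightarrow> N (mat n n (\<lambda>p. \<Sum>k<m. (\<Sum>i<d. A i (fst p) (snd p) * a i k) *\<^sub>C \<gamma> k))"
      by (rule X.norm_tendsto[OF n finite_lessThan \<gamma>])
        (use Q in \<open>auto intro!: tendsto_sum tendsto_mult tendsto_const\<close>)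
    moreover have "comb n d A x = mat n n (\<lambda>p. \<Sum>k<m. (\<Sum>i<d. A i (fst p) (snd p) * a i k) *\<^sub>C \<gamma> k)"
      by (rule comb_expand) (rule a)
    moreover have "comb n d A (?x s) = mat n n (\<lambda>p. \<Sum>k<m. (\<Sum>i<d. A i (fst p) (snd p) * rcoef (Q s) i k 0) *\<^sub>C \<gamma> k)" for s
      by (rule comb_expand) (rule refl)
    ultimately show ?thesis by (simp only:)
  qed
  have "\<forall>\<^sub>F s in sequentially. satisfies N d cs (?x s)"
    unfolding satisfies_def
  proof (intro eventually_ball_finite finite_set ballI)
    fix c assume c: "c \<in> set cs"
    obtain n L \<alpha> \<beta> where eq: "c = (n, L, \<alpha>, \<beta>)" by (cases c) auto
    have "\<forall>\<^sub>F s in sequentially. of_rat \<alpha> < N (comb n d (rcoef L) (?x s)) \<and> N (comb n d (rcoef L) (?x s)) < of_rat \<beta>"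
      if "n \<ge> 1"
    proof -
      have "of_rat \<alpha> < N (comb n d (rcoef L) x)" "N (comb n d (rcoef L) x) < of_rat \<beta>"
        using x(2) c eq that unfolding satisfies_def by blast+
      then show ?thesis using order_tendstoD[OF lim[OF that]] by (intro eventually_conj) blast+
    qed
    then show "\<forall>\<^sub>F s in sequentially. case c of (n, L, \<alpha>, \<beta>) \<Rightarrow> n \<ge> 1 \<longrightarrow>
        of_rat \<alpha> < N (comb n d (rcoef L) (?x s)) \<and> N (comb n d (rcoef L) (?x s)) < of_rat \<beta>"
      by (cases "n \<ge> 1") (simp_all only: eq prod.case simp_thms eventually_True)
  qed
  then show ?rhs using eventually_happens'[OF sequentially_bot] by blast
qed

section \<open>Borel measurability of the matrix norms over B(H)\<close>

lemma bounded_bilinear_cinner: "bounded_bilinear (cinner :: 'h::chilbert_space \<Rightarrow> 'h \<Rightarrow> complex)"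
proof
  fix a a' b b' :: 'h and r :: real
  show "cinner (a + a') b = cinner a b + cinner a' b" by (rule cinner_add_left)
  show "cinner a (b + b') = cinner a b + cinner a b'" by (rule cinner_add_right)
  show "cinner (r *\<^sub>R a) b = r *\<^sub>R cinner a b"
    by (simp add: cinner_scaleC_left scaleR_conv_of_real flip: scaleC_of_real)
  show "cinner a (r *\<^sub>R b) = r *\<^sub>R cinner a b"
    by (simp add: cinner_scaleC_right scaleR_conv_of_real flip: scaleC_of_real)
  show "\<exists>K. \<forall>a b :: 'h. cmod (cinner a b) \<le> norm a * norm b * K"
    by (intro exI[of _ 1]) (simp add: cinner_cauchy_schwarz)
qed

lemma tendsto_bop_apply: "(f \<longlongrightarrow> v) F \<Longrightarrow> ((\<lambda>s. bop_apply T (f s)) \<longlongrightarrow> bop_apply T v) F"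
  unfolding bop_apply.rep_eq by (rule bounded_linear.tendsto[OF blinfun.bounded_linear_right])

definition mat_pairing :: "'h::chilbert_space bop mat \<Rightarrow> nat \<Rightarrow> (nat \<Rightarrow> 'h) \<Rightarrow> (nat \<Rightarrow> 'h) \<Rightarrow> complex"
  where "mat_pairing x n \<xi> \<eta> = (\<Sum>i<n. cinner (mat_act x \<xi> i) (\<eta> i))"

lemma cmod_mat_pairing_le:
  assumes x: "x \<in> carrier_mat n n"
  shows "cmod (mat_pairing x n \<xi> \<eta>) \<le> opmat_norm x * L2_set (\<lambda>i. norm (\<xi> i)) {..<n} * L2_set (\<lambda>i. norm (\<eta> i)) {..<n}"
proof -
  have "cmod (mat_pairing x n \<xi> \<eta>) \<le> (\<Sum>i<n. \<bar>norm (mat_act x \<xi> i)\<bar> * \<bar>norm (\<eta> i)\<bar>)"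
    unfolding mat_pairing_def by (intro sum_norm_le) (simp add: cinner_cauchy_schwarz)
  also have "\<dots> \<le> L2_set (\<lambda>i. norm (mat_act x \<xi> i)) {..<n} * L2_set (\<lambda>i. norm (\<eta> i)) {..<n}"
    by (rule L2_set_mult_ineq)
  also have "\<dots> \<le> opmat_norm x * L2_set (\<lambda>i. norm (\<xi> i)) {..<n} * L2_set (\<lambda>i. norm (\<eta> i)) {..<n}"
    by (intro mult_right_mono opmat_norm_apply[OF x] L2_set_nonneg)
  finally show ?thesis .
qed

text \<open>Reduces a norm bound to pairings with tuples from \<open>D\<close>, which are countably
  many when \<open>D\<close> is countable. For the converse, the inequality extends to all
  \<open>\<xi>\<close> and \<open>\<eta>\<close> by coordinatewise approximation; then
  \<open>\<eta> = mat_act x \<xi>\<close> is inserted and one factor of its norm cancelled.\<close>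

lemma opmat_norm_le_iff_dense:
  fixes x :: "'h::chilbert_space bop mat"
  assumes x: "x \<in> carrier_mat n n" and D: "closure D = UNIV"
  shows "opmat_norm x \<le> c \<longleftrightarrow> 0 \<le> c \<and> (\<forall>\<xi>\<in>Pi\<^sub>E {..<n} (\<lambda>_. D). \<forall>\<eta>\<in>Pi\<^sub>E {..<n} (\<lambda>_. D).
    cmod (mat_pairing x n \<xi> \<eta>) \<le> c * L2_set (\<lambda>i. norm (\<xi> i)) {..<n} * L2_set (\<lambda>i. norm (\<eta> i)) {..<n})"
    (is "_ \<longleftrightarrow> 0 \<le> c \<and> (\<forall>\<xi>\<in>?E. \<forall>\<eta>\<in>?E. ?P \<xi> \<eta>)")
proof (intro iffI conjI ballI)
  assume le: "opmat_norm x \<le> c"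
  then show "0 \<le> c" using opmat_norm_nonneg[OF x] by linarith
  show "?P \<xi> \<eta>" for \<xi> \<eta>
    by (rule order_trans[OF cmod_mat_pairing_le[OF x]]) (intro mult_right_mono le L2_set_nonneg)
next
  assume *: "0 \<le> c \<and> (\<forall>\<xi>\<in>?E. \<forall>\<eta>\<in>?E. ?P \<xi> \<eta>)"
  have "\<forall>v. \<exists>f. (\<forall>s. f s \<in> D) \<and> f \<longlonglongrightarrow> v"
    using D closure_sequential by blast
  then obtain f where f: "\<And>v s. f v s \<in> D" "\<And>v. f v \<longlonglongrightarrow> v" by metis
  \<comment> \<open>The restriction places the approximating tuples in the extensional product
    \<open>?E\<close>.\<close>
  define g where "g \<xi> s = restrict (\<lambda>i. f (\<xi> i) s) {..<n}" for \<xi> :: "nat \<Rightarrow> 'h" and s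
  have g: "g \<xi> s \<in> ?E" for \<xi> s by (auto simp: g_def f)
  have g_lim: "(\<lambda>s. g \<xi> s i) \<longlonglongrightarrow> \<xi> i" if "i < n" for \<xi> i
    using f(2)[of "\<xi> i"] that by (simp add: g_def)
  have act_lim: "(\<lambda>s. mat_act x (g \<xi> s) i) \<longlonglongrightarrow> mat_act x \<xi> i" for \<xi> i
    unfolding mat_act_def by (intro tendsto_sum tendsto_bop_apply g_lim) (use x in auto)
  have P: "?P \<xi> \<eta>" for \<xi> \<eta>
  proof (rule LIMSEQ_le)
    show "(\<lambda>s. cmod (mat_pairing x n (g \<xi> s) (g \<eta> s))) \<longlonglongrightarrow> cmod (mat_pairing x n \<xi> \<eta>)"
      unfolding mat_pairing_def
      by (intro tendsto_norm tendsto_sum bounded_bilinear.tendsto[OF bounded_bilinear_cinner] act_lim g_lim) auto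
    show "(\<lambda>s. c * L2_set (\<lambda>i. norm (g \<xi> s i)) {..<n} * L2_set (\<lambda>i. norm (g \<eta> s i)) {..<n})
        \<longlonglongrightarrow> c * L2_set (\<lambda>i. norm (\<xi> i)) {..<n} * L2_set (\<lambda>i. norm (\<eta> i)) {..<n}"
      unfolding L2_set_def
      by (intro tendsto_mult tendsto_const tendsto_real_sqrt tendsto_sum tendsto_power tendsto_norm g_lim) auto
    show "\<exists>s0. \<forall>s\<ge>s0. cmod (mat_pairing x n (g \<xi> s) (g \<eta> s))
        \<le> c * L2_set (\<lambda>i. norm (g \<xi> s i)) {..<n} * L2_set (\<lambda>i. norm (g \<eta> s i)) {..<n}"
      by (intro exI allI impI) (rule *[THEN conjunct2, rule_format, OF g g])
  qed
  show "opmat_norm x \<le> c"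
  proof (rule opmat_norm_le[OF x])
    show "0 \<le> c" using * by blast
    fix \<xi> :: "nat \<Rightarrow> 'h"
    let ?a = "L2_set (\<lambda>i. norm (mat_act x \<xi> i)) {..<n}" and ?q = "L2_set (\<lambda>i. norm (\<xi> i)) {..<n}"
    have "?a\<^sup>2 = (\<Sum>i<n. (norm (mat_act x \<xi> i))\<^sup>2)" by (simp add: L2_set_def sum_nonneg)
    also have "\<dots> = Re (mat_pairing x n \<xi> (mat_act x \<xi>))" by (simp add: mat_pairing_def norm_sq_cinner)
    also have "\<dots> \<le> cmod (mat_pairing x n \<xi> (mat_act x \<xi>))" by (rule complex_Re_le_cmod)
    also have "\<dots> \<le> c * ?q * ?a" by (rule P)
    finally have "?a * ?a \<le> c * ?q * ?a" by (simp only: power2_eq_square)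
    moreover have "0 \<le> ?a" "0 \<le> c * ?q" using \<open>0 \<le> c\<close> by (simp_all add: L2_set_nonneg)
    ultimately show "?a \<le> c * ?q" unfolding mult_le_cancel_right by linarith
  qed
qed

text \<open>Matrix coefficients are continuous for the weak operator topology by its definition, so
  preimages of open sets have relatively open traces on all balls.\<close>

lemma measurable_cinner_bop: "(\<lambda>T. cinner (bop_apply T \<xi>) \<eta>) \<in> borel_measurable (bop_borel :: 'h::chilbert_space bop measure)"
proof (rule borel_measurableI)
  fix U :: "complex set" assume U: "open U"
  let ?A = "{T :: 'h bop. cinner (bop_apply T \<xi>) \<eta> \<in> U}"
  have "openin weak_operator_topology ?A"
    unfolding weak_operator_topology_def using U by (intro topology_generated_by_Basis) blast
  then have "openin (subtopology weak_operator_topology (cball 0 (real n))) (?A \<inter> cball 0 (real n))" for n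
    by (auto simp: openin_subtopology)
  then have "?A \<inter> cball 0 (real n) \<in> sets (borel_of_topology (subtopology weak_operator_topology (cball 0 (real n))))" for n
    unfolding borel_of_topology_def by (intro in_measure_of) (use openin_subset in blast)+
  then have "?A \<in> sets bop_borel"
    unfolding bop_borel_def by (intro in_measure_of) auto
  moreover have "(\<lambda>T. cinner (bop_apply T \<xi>) \<eta>) -` U \<inter> space bop_borel = ?A"
    by (auto simp: bop_borel_def space_measure_of_conv)
  ultimately show "(\<lambda>T. cinner (bop_apply T \<xi>) \<eta>) -` U \<inter> space bop_borel \<in> sets bop_borel" by simp
qed

lemma countable_dense_closure: "\<exists>D :: 'a::second_countable_topology set. countable D \<and> closure D = UNIV"
proof -
  obtain D :: "'a set" where D: "countable D" "\<And>X. open X \<Longrightarrow> X \<noteq> {} \<Longrightarrow> \<exists>d\<in>D. d \<in> X"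
    by (rule countable_dense_setE) (rule that)
  have "- closure D = {}" using D(2)[of "- closure D"] closure_subset[of D] by blast
  with D(1) show ?thesis by blast
qed

lemma pred_countable_Ball:
  assumes I: "countable I" and P: "\<And>i. i \<in> I \<Longrightarrow> Measurable.pred M (\<lambda>x. P x i)"
  shows "Measurable.pred M (\<lambda>x. \<forall>i\<in>I. P x i)"
proof (cases "I = {}")
  case False
  then have "(\<forall>i\<in>I. P x i) \<longleftrightarrow> (\<forall>n. P x (from_nat_into I n))" for x
    using from_nat_into_surj[OF I] from_nat_into[OF False] by metis
  then show ?thesis using P from_nat_into[OF False] by (simp add: pred_intros_countable(1))
qed simp

text \<open>Separability of the Hilbert space provides a countable dense \<open>D\<close>. A
  sublevel set of the norm is then a countable intersection of conditions on finite sums of matrix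
  coefficients of the \<open>\<gamma> k\<close>.\<close>

lemma measurable_opmat_norm:
  fixes W :: "nat \<times> nat \<Rightarrow> nat \<Rightarrow> complex"
  shows "(\<lambda>\<gamma>. opmat_norm (mat n n (\<lambda>p. \<Sum>k<m. W p k *\<^sub>C \<gamma> k)))
    \<in> borel_measurable (PiM UNIV (\<lambda>_. bop_borel :: 'h::{chilbert_space, second_countable_topology} bop measure))"
    (is "?f \<in> borel_measurable ?M")
proof -
  obtain D :: "'h set" where D: "countable D" "closure D = UNIV"
    using countable_dense_closure by blast
  let ?x = "\<lambda>\<gamma>. mat n n (\<lambda>p. \<Sum>k<m. W p k *\<^sub>C \<gamma> k)"
  let ?E = "Pi\<^sub>E {..<n} (\<lambda>_. D)"
  have E: "countable ?E" using D(1) by (intro countable_PiE) auto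
  have pairing: "(\<lambda>\<gamma>. mat_pairing (?x \<gamma>) n \<xi> \<eta>) \<in> borel_measurable ?M" for \<xi> \<eta> :: "nat \<Rightarrow> 'h"
  proof -
    have "mat_pairing (?x \<gamma>) n \<xi> \<eta> = (\<Sum>i<n. \<Sum>j<n. \<Sum>k<m. W (i, j) k * cinner (bop_apply (\<gamma> k) (\<xi> j)) (\<eta> i))" for \<gamma>
      by (simp add: mat_pairing_def mat_act_def bop_apply_sum_left cinner_sum_left cinner_scaleC_left)
    moreover have "(\<lambda>\<gamma>. cinner (bop_apply (\<gamma> k) v) w) \<in> borel_measurable ?M" for k v w
      using measurable_compose[OF measurable_component_singleton[of k UNIV "\<lambda>_. bop_borel"] measurable_cinner_bop] by simp
    ultimately show ?thesis by simp
  qed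
  show ?thesis
  proof (rule borel_measurable_iff_le[THEN iffD2], rule allI)
    fix c
    have "Measurable.pred ?M (\<lambda>\<gamma>. 0 \<le> c \<and> (\<forall>\<xi>\<in>?E. \<forall>\<eta>\<in>?E.
      cmod (mat_pairing (?x \<gamma>) n \<xi> \<eta>) \<le> c * L2_set (\<lambda>i. norm (\<xi> i)) {..<n} * L2_set (\<lambda>i. norm (\<eta> i)) {..<n}))"
    proof (intro pred_intros_logic pred_countable_Ball E)
      show "Measurable.pred ?M (\<lambda>\<gamma>. cmod (mat_pairing (?x \<gamma>) n \<xi> \<eta>)
          \<le> c * L2_set (\<lambda>i. norm (\<xi> i)) {..<n} * L2_set (\<lambda>i. norm (\<eta> i)) {..<n})" for \<xi> \<eta>
        unfolding pred_def by (intro borel_measurable_le measurable_compose[OF pairing borel_measurable_norm] borel_measurable_const)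
    qed simp
    moreover have "?f \<gamma> \<le> c \<longleftrightarrow> 0 \<le> c \<and> (\<forall>\<xi>\<in>?E. \<forall>\<eta>\<in>?E.
      cmod (mat_pairing (?x \<gamma>) n \<xi> \<eta>) \<le> c * L2_set (\<lambda>i. norm (\<xi> i)) {..<n} * L2_set (\<lambda>i. norm (\<eta> i)) {..<n})" for \<gamma>
      by (rule opmat_norm_le_iff_dense[OF mat_carrier D(2)])
    ultimately show "{\<gamma> \<in> space ?M. ?f \<gamma> \<le> c} \<in> sets ?M" by (simp only: pred_def)
  qed
qed

section \<open>The classifying map on codes\<close>

text \<open>A 0-1 sequence indexed by the pairs of a tuple length and a finite list of conditions.
  The search runs only over Gaussian rational combinations of the \<open>\<gamma> k\<close> so that
  the map is Borel.\<close>

definition code_invariant :: "(nat \<Rightarrow> 'h::chilbert_space bop) \<Rightarrow> nat \<Rightarrow> real"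
  where "code_invariant \<gamma> j = (case from_nat j of (d, cs) \<Rightarrow>
    if \<exists>m Q. satisfies opmat_norm d cs (\<lambda>i. \<Sum>k<m. rcoef Q i k 0 *\<^sub>C \<gamma> k) then 1 else 0)"

text \<open>The existential quantifiers range over countable types and the conditions over a finite
  list, so each coordinate is a countable Boolean combination of bounds on measurable norms.\<close>

lemma measurable_code_invariant:
  "(code_invariant :: (nat \<Rightarrow> 'h::{chilbert_space, second_countable_topology} bop) \<Rightarrow> nat \<Rightarrow> real)
    \<in> borel_measurable (PiM UNIV (\<lambda>_. bop_borel))" (is "_ \<in> borel_measurable ?M")
proof (rule measurable_coordinatewise_then_product)
  fix j
  obtain d :: nat and cs :: "norm_condition list" where dc: "from_nat j = (d, cs)" by fastforce
  have norm: "(\<lambda>\<gamma>. opmat_norm (comb n d A (\<lambda>i. \<Sum>k<m. rcoef Q i k 0 *\<^sub>C \<gamma> k))) \<in> borel_measurable ?M" for n A m Q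
  proof -
    have "comb n d A (\<lambda>i. \<Sum>k<m. rcoef Q i k 0 *\<^sub>C \<gamma> k)
        = mat n n (\<lambda>p. \<Sum>k<m. (\<Sum>i<d. A i (fst p) (snd p) * rcoef Q i k 0) *\<^sub>C \<gamma> k)" for \<gamma> :: "nat \<Rightarrow> 'h bop"
      by (rule comb_expand) (rule refl)
    then show ?thesis by (simp only: measurable_opmat_norm)
  qed
  have "Measurable.pred ?M (\<lambda>\<gamma>. satisfies opmat_norm d cs (\<lambda>i. \<Sum>k<m. rcoef Q i k 0 *\<^sub>C \<gamma> k))" for m Q
    unfolding satisfies_def case_prod_beta
    by (intro pred_intros_countable_bounded pred_intros_logic borel_measurable_pred_less norm borel_measurable_const) simp_all
  then have "Measurable.pred ?M (\<lambda>\<gamma>. \<exists>m Q. satisfies opmat_norm d cs (\<lambda>i. \<Sum>k<m. rcoef Q i k 0 *\<^sub>C \<gamma> k))"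
    by (intro pred_intros_countable)
  then show "(\<lambda>\<gamma>. code_invariant \<gamma> j) \<in> borel_measurable ?M"
    unfolding code_invariant_def dc prod.case by (intro measurable_If measurable_const) (simp_all add: pred_def)
qed

text \<open>By \<open>satisfies_span_iff\<close> the invariant depends only on the span: it records
  which finite systems of bounds have solutions there. Embeddings in both directions transport
  solutions; conversely, equal solvability gives \<open>locally_embeds\<close> both ways.\<close>

lemma code_invariant_eq_iff:
  fixes \<gamma> \<gamma>' :: "nat \<Rightarrow> 'h::chilbert_space bop"
  assumes "finitely_generated (cspan (range \<gamma>))" "finitely_generated (cspan (range \<gamma>'))"
  shows "completely_isometric (cspan (range \<gamma>)) opmat_norm (cspan (range \<gamma>')) opmat_norm
    \<longleftrightarrow> code_invariant \<gamma> = code_invariant \<gamma>'"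
proof
  let ?X = "cspan (range \<gamma>)" and ?Y = "cspan (range \<gamma>')"
  have X: "matrix_norm_on ?X opmat_norm" and Y: "matrix_norm_on ?Y opmat_norm"
    by (simp_all add: matrix_norm_on_if_cstar_norm[OF matrix_cstar_norm_opmat_norm])
  have inv: "code_invariant \<delta> j = (case from_nat j of (d, cs) \<Rightarrow>
      if \<exists>x. (\<forall>i<d. x i \<in> cspan (range \<delta>)) \<and> satisfies opmat_norm d cs x then 1 else 0)"
    if "matrix_norm_on (cspan (range \<delta>)) opmat_norm" for \<delta> :: "nat \<Rightarrow> 'h bop" and j
    unfolding code_invariant_def satisfies_span_iff[OF that] ..
  {
    assume ci: "completely_isometric ?X opmat_norm ?Y opmat_norm"
    obtain u v where uv: "matrix_embedding ?X opmat_norm ?Y opmat_norm u" "matrix_embedding ?Y opmat_norm ?X opmat_norm v"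
      using ci completely_isometric_sym[OF X Y ci] completely_isometric_iff_embedding_onto[OF X Y]
        completely_isometric_iff_embedding_onto[OF Y X] by blast
    have "(\<exists>x. (\<forall>i<d. x i \<in> ?X) \<and> satisfies opmat_norm d cs x) \<longleftrightarrow> (\<exists>x. (\<forall>i<d. x i \<in> ?Y) \<and> satisfies opmat_norm d cs x)" for d cs
    proof
      assume "\<exists>x. (\<forall>i<d. x i \<in> ?X) \<and> satisfies opmat_norm d cs x"
      then obtain x where "\<forall>i<d. x i \<in> ?X" "satisfies opmat_norm d cs x" by blast
      then show "\<exists>x. (\<forall>i<d. x i \<in> ?Y) \<and> satisfies opmat_norm d cs x"
        using satisfies_embedding[OF uv(1) X] matrix_embeddingD(1)[OF uv(1)] by (intro exI[of _ "\<lambda>i. u (x i)"]) simp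
    next
      assume "\<exists>x. (\<forall>i<d. x i \<in> ?Y) \<and> satisfies opmat_norm d cs x"
      then obtain x where "\<forall>i<d. x i \<in> ?Y" "satisfies opmat_norm d cs x" by blast
      then show "\<exists>x. (\<forall>i<d. x i \<in> ?X) \<and> satisfies opmat_norm d cs x"
        using satisfies_embedding[OF uv(2) Y] matrix_embeddingD(1)[OF uv(2)] by (intro exI[of _ "\<lambda>i. v (x i)"]) simp
    qed
    then show "code_invariant \<gamma> = code_invariant \<gamma>'"
      by (intro ext) (simp only: inv[OF X] inv[OF Y])
  }
  assume eq: "code_invariant \<gamma> = code_invariant \<gamma>'"
  have iff: "(\<exists>x. (\<forall>i<d. x i \<in> ?X) \<and> satisfies opmat_norm d cs x) \<longleftrightarrow> (\<exists>x. (\<forall>i<d. x i \<in> ?Y) \<and> satisfies opmat_norm d cs x)" for d cs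
    using fun_cong[OF eq, of "to_nat (d, cs)"] unfolding inv[OF X] inv[OF Y] from_nat_to_nat prod.case
    by (simp only: split: if_splits) auto
  have "locally_embeds ?X opmat_norm ?Y opmat_norm" "locally_embeds ?Y opmat_norm ?X opmat_norm"
    by (rule locally_embeds_if_satisfies, use iff in blast)+
  then show "completely_isometric ?X opmat_norm ?Y opmat_norm"
    using completely_isometric_if_locally_embeds[OF X Y assms] by blast
qed

lemma separable_space_euclidean: "separable_space (euclidean :: 'a::second_countable_topology topology)"
  unfolding separable_space_def using countable_dense_closure[where 'a = 'a] by simp

text \<open>The Polish space is that of all real sequences with the product topology, and
  \<open>code_invariant\<close> is the Borel reduction.\<close>

lemma smooth_completely_isometric:
  "smooth_equivalence (fg_code_space :: (nat \<Rightarrow> 'h::{chilbert_space, second_countable_topology} bop) measure)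
    (\<lambda>\<gamma> \<gamma>'. completely_isometric (cspan (range \<gamma>)) opmat_norm (cspan (range \<gamma>')) opmat_norm)"
  unfolding smooth_equivalence_def
proof (intro exI[of _ euclidean] exI[of _ code_invariant] conjI ballI)
  show "completely_metrizable_space (euclidean :: (nat \<Rightarrow> real) topology)"
    by (rule completely_metrizable_space_euclidean)
  show "separable_space (euclidean :: (nat \<Rightarrow> real) topology)" by (rule separable_space_euclidean)
  have "borel_of_topology euclidean = (borel :: (nat \<Rightarrow> real) measure)"
    by (simp add: borel_of_topology_def borel_def)
  then show "(code_invariant :: (nat \<Rightarrow> 'h bop) \<Rightarrow> _) \<in> measurable fg_code_space (borel_of_topology euclidean)"
    unfolding fg_code_space_def by (simp only: measurable_restrict_space1[OF measurable_code_invariant])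
  fix \<gamma> \<gamma>' :: "nat \<Rightarrow> 'h bop" assume "\<gamma> \<in> space fg_code_space" "\<gamma>' \<in> space fg_code_space"
  then have "finitely_generated (cspan (range \<gamma>))" "finitely_generated (cspan (range \<gamma>'))"
    by (auto simp: fg_code_space_def space_restrict_space fg_codes_def)
  then show "completely_isometric (cspan (range \<gamma>)) opmat_norm (cspan (range \<gamma>')) opmat_norm
      \<longleftrightarrow> code_invariant \<gamma> = code_invariant \<gamma>'" by (rule code_invariant_eq_iff)
qed

section \<open>Characterization by universal sentences, and smoothness\<close>

theorem corollary5p6:
  shows "(\<forall>(X :: 'a::cstar_algebra set) N (Y :: 'b::cstar_algebra set) M.
      operator_space X N \<and> finitely_generated X \<and> operator_space Y M \<and> finitely_generated Y \<longrightarrow>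
        (completely_isometric X N Y M \<longleftrightarrow>
          (\<forall>\<phi>. osp_sentence \<phi> \<and> universal \<phi> \<longrightarrow> sentence_value X N \<phi> = sentence_value Y M \<phi>)) \<and>
        (completely_isometric X N Y M \<longleftrightarrow>
          (\<forall>\<phi>. osp_sentence \<phi> \<and> prenex_universal \<phi> \<longrightarrow> sentence_value X N \<phi> = sentence_value Y M \<phi>))) \<and>
    (\<not> finitely_generated (UNIV :: 'h::{chilbert_space, second_countable_topology} set) \<longrightarrow>
      smooth_equivalence (fg_code_space :: (nat \<Rightarrow> 'h bop) measure)
        (\<lambda>\<gamma> \<gamma>'. completely_isometric (cspan (range \<gamma>)) opmat_norm (cspan (range \<gamma>')) opmat_norm))"
proof (intro conjI[of "\<forall>X N Y M. _ X N Y M"] allI impI smooth_completely_isometric)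
  fix X :: "'a set" and N and Y :: "'b set" and M
  assume *: "operator_space X N \<and> finitely_generated X \<and> operator_space Y M \<and> finitely_generated Y"
  then have X: "matrix_norm_on X N" and Y: "matrix_norm_on Y M"
    by (simp_all add: matrix_norm_on_operator_space)
  \<comment> \<open>Both equivalences follow from one cycle: agreement on prenex universal sentences
    gives a complete isometry, this gives agreement on all sentences, in particular on universal
    ones, and those include the prenex ones.\<close>
  let ?P = "\<forall>\<phi>. osp_sentence \<phi> \<and> prenex_universal \<phi> \<longrightarrow> sentence_value X N \<phi> = sentence_value Y M \<phi>"
  have "completely_isometric X N Y M" if ?P
  proof (rule completely_isometric_if_locally_embeds[OF X Y])
    show "locally_embeds X N Y M"
      by (rule locally_embeds_if_sentence_values_eq[OF X Y]) (use that in blast)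
    show "locally_embeds Y M X N"
      by (rule locally_embeds_if_sentence_values_eq[OF Y X]) (use that in \<open>auto intro: sym\<close>)
  qed (use * in blast)+
  moreover have "sentence_value X N \<phi> = sentence_value Y M \<phi>"
    if "completely_isometric X N Y M" "osp_sentence \<phi>" for \<phi>
    using sentence_value_eq_if_completely_isometric[OF X Y that(1)] that(2) by (simp add: osp_sentence_def)
  ultimately show "(completely_isometric X N Y M \<longleftrightarrow>
        (\<forall>\<phi>. osp_sentence \<phi> \<and> universal \<phi> \<longrightarrow> sentence_value X N \<phi> = sentence_value Y M \<phi>)) \<and>
      (completely_isometric X N Y M \<longleftrightarrow> ?P)"
    using prenex_universal_imp_universal by blast
qed

end
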